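(* Let $A$ be a densely defined strongly positive operator in a Banach space $X$ with spectral characteristics $\rho_0,\varphi$, let $\alpha\in(0,1)$ and $u_0\in D(A^{\alpha})$. Let $u_h(t)=e^{-At}B^{-1}u_0$, $t\ge 0$, be the solution of the homogeneous nonlocal problem $u'(t)+Au(t)=0$, $u(0)+\sum_{k=1}^m\alpha_k u(t_k)=u_0$, and let $$u_{h,N}(t)=\frac{h}{2\pi i}\sum_{k=-N}^{N}\mathcal F(t,kh)$$ be its Sinc-quadrature approximation, with $\mathcal F$, $a_I$, $d_1$ and all parameters as defined in the context. Then $u_{h,N}$ converges exponentially to $u_h$ in the following sense. (i) If $h=\sqrt{\dfrac{2\pi d_1}{\alpha(N+1)}}$ (so $h=O(1/\sqrt N)$), then the error is of order $O(e^{-c\sqrt N})$ uniformly in $t\ge 0$; namely there is a constant $c'>0$ independent of $t$ and $N$ such that for all $t\ge 0$ and $N\ge 1$ $$\|u_h(t)-u_{h,N}(t)\|\le \frac{c'}{\alpha}\exp\left(-\sqrt{\frac{\pi d_1\alpha}{2}(N+1)}\right)\|A^{\alpha}u_0\|.$$ (ii) For each fixed $t>0$, if $h=c_1\ln N/N$ with some positive constant $c_1$ (i.e. for a suitable choice of $c_1>0$), then, as $N\to\infty$, $$\|u_h(t)-u_{h,N}(t)\|=O\left(\max\left\{e^{-\pi d_1N/(c_1\ln N)},\; e^{-c_1a_ItN/2-c_1\alpha\ln N}\right\}\right).$$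
   Context: Strongly positive operator: $A$ is a densely defined closed operator in the Banach space $X$ for which there are $\rho_0>0$, $\varphi\in(0,\pi/2)$ (the spectral characteristics of $A$) and $M>0$ such that the spectrum of $A$ lies in the sector $\Sigma=\{\rho_0+re^{i\theta}: r\in[0,\infty),\ |\theta|<\varphi\}$, and outside $\Sigma$ and on its boundary $\|(zI-A)^{-1}\|\le \dfrac{M}{1+|z|}$. $e^{-At}$ is the semigroup generated by $-A$; $A^\alpha$ is the fractional power. Nonlocal data: $m\ge1$, $0<t_1<t_2<\dots<t_m\le T$, $\alpha_1,\dots,\alpha_m\in\mathbb R$, satisfying the existence and uniqueness condition $\sum_{i=1}^m|\alpha_i|<1$ or $\sum_{i=1}^m|\alpha_i|e^{-\rho_0t_i}<1$. Put $B=I+\sum_{i=1}^m\alpha_ie^{-At_i}$, which is then boundedly invertible, and for complex $z$ put $B^{-1}(z)=\left(1+\sum_{i=1}^m\alpha_ie^{-zt_i}\right)^{-1}$. Parameters of the integration hyperbola: fix $\rho_1$ with $0<\rho_1<\rho_0$ and $\sum_{i=1}^m|\alpha_i|e^{-\rho_1t_i}<1$. Put $b_0=\rho_0\tan\varphi$, $$d_1=\arccos\left(\frac{\rho_1}{\sqrt{\rho_0^2+b_0^2}}\right)-\varphi,\quad a_I=\sqrt{\rho_0^2+b_0^2}\,\cos\left(\tfrac{d_1}{2}+\varphi\right),\quad b_I=\sqrt{\rho_0^2+b_0^2}\,\sin\left(\tfrac{d_1}{2}+\varphi\right),$$ $$z(\xi)=a_I\cosh\xi-ib_I\sinh\xi,\qquad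 z'(\xi)=a_I\sinh\xi-ib_I\cosh\xi,\quad \xi\in\mathbb R.$$ The integrand is $$\mathcal F(t,\xi)=\frac{e^{-z(\xi)t}\,z'(\xi)}{1+\sum_{i=1}^m\alpha_ie^{-z(\xi)t_i}}\left[(z(\xi)I-A)^{-1}-\frac{1}{z(\xi)}I\right]u_0 .$$ *)

theory Defs
  imports "HOL-Analysis.Analysis" "HOL-Library.Landau_Symbols"
begin

section \<open>Complex Banach spaces\<close>

class complex_banach = banach +
  fixes scaleC :: "complex \<Rightarrow> 'a \<Rightarrow> 'a"  (infixr "*\<^sub>C" 75)
  assumes scaleC_add_right: "c *\<^sub>C (x + y) = c *\<^sub>C x + c *\<^sub>C y"
    and scaleC_add_left: "(c + d) *\<^sub>C x = c *\<^sub>C x + d *\<^sub>C x"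
    and scaleC_scaleC: "c *\<^sub>C (d *\<^sub>C x) = (c * d) *\<^sub>C x"
    and scaleC_one: "1 *\<^sub>C x = x"
    and scaleR_scaleC: "r *\<^sub>R x = complex_of_real r *\<^sub>C x"
    and norm_scaleC: "norm (c *\<^sub>C x) = cmod c * norm x"

definition bounded_clinear :: "('a::complex_banach \<Rightarrow> 'a) \<Rightarrow> bool" where
  "bounded_clinear f \<longleftrightarrow> bounded_linear f \<and> (\<forall>c x. f (c *\<^sub>C x) = c *\<^sub>C f x)"


section \<open>Unbounded operators and strong positivity\<close>

text \<open>An unbounded operator is given by its domain \<open>D\<close> and a function \<open>A\<close>, of which
  only the values on \<open>D\<close> matter.\<close>

definition linear_operator :: "'a::complex_banach set \<Rightarrow> ('a \<Rightarrow> 'a) \<Rightarrow> bool" where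
  "linear_operator D A \<longleftrightarrow>
     0 \<in> D \<and> (\<forall>x\<in>D. \<forall>y\<in>D. x + y \<in> D \<and> A (x + y) = A x + A y) \<and>
     (\<forall>c. \<forall>x\<in>D. c *\<^sub>C x \<in> D \<and> A (c *\<^sub>C x) = c *\<^sub>C A x)"

definition closed_densely_defined :: "'a::complex_banach set \<Rightarrow> ('a \<Rightarrow> 'a) \<Rightarrow> bool" where
  "closed_densely_defined D A \<longleftrightarrow>
     linear_operator D A \<and> closure D = UNIV \<and> closed {(x, A x) | x. x \<in> D}"

definition resolvent :: "'a::complex_banach set \<Rightarrow> ('a \<Rightarrow> 'a) \<Rightarrow> complex \<Rightarrow> 'a \<Rightarrow> 'a" where
  "resolvent D A z = inv_into D (\<lambda>x. z *\<^sub>C x - A x)"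

definition resolvent_set :: "'a::complex_banach set \<Rightarrow> ('a \<Rightarrow> 'a) \<Rightarrow> complex set" where
  "resolvent_set D A =
     {z. bij_betw (\<lambda>x. z *\<^sub>C x - A x) D UNIV \<and> bounded_clinear (resolvent D A z)}"

definition spectrum :: "'a::complex_banach set \<Rightarrow> ('a \<Rightarrow> 'a) \<Rightarrow> complex set" where
  "spectrum D A = - resolvent_set D A"

definition sector :: "real \<Rightarrow> real \<Rightarrow> complex set" where
  "sector \<rho>\<^sub>0 \<phi> = {of_real \<rho>\<^sub>0 + of_real r * cis \<theta> | r \<theta>. 0 \<le> r \<and> \<bar>\<theta>\<bar> < \<phi>}"

definition strongly_positive ::
    "'a::complex_banach set \<Rightarrow> ('a \<Rightarrow> 'a) \<Rightarrow> real \<Rightarrow> real \<Rightarrow> bool" where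
  "strongly_positive D A \<rho>\<^sub>0 \<phi> \<longleftrightarrow>
     closed_densely_defined D A \<and> 0 < \<rho>\<^sub>0 \<and> 0 < \<phi> \<and> \<phi> < pi / 2 \<and>
     spectrum D A \<subseteq> sector \<rho>\<^sub>0 \<phi> \<and>
     (\<exists>M>0. \<forall>z \<in> - sector \<rho>\<^sub>0 \<phi> \<union> frontier (sector \<rho>\<^sub>0 \<phi>).
        z \<in> resolvent_set D A \<and> onorm (resolvent D A z) \<le> M / (1 + cmod z))"


section \<open>Semigroups and fractional powers\<close>

definition C0_semigroup :: "(real \<Rightarrow> 'a::complex_banach \<Rightarrow> 'a) \<Rightarrow> bool" where
  "C0_semigroup S \<longleftrightarrow>
     (\<forall>t\<ge>0. bounded_clinear (S t)) \<and> (\<forall>x. S 0 x = x) \<and>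
     (\<forall>s\<ge>0. \<forall>t\<ge>0. \<forall>x. S (s + t) x = S s (S t x)) \<and>
     (\<forall>x. ((\<lambda>t. S t x) \<longlongrightarrow> x) (at_right 0))"

text \<open>The infinitesimal generator of \<open>S\<close> is exactly \<open>G\<close> with domain \<open>D\<close>; this determines
  \<open>S t\<close> uniquely for \<open>t \<ge> 0\<close>.\<close>

definition semigroup_generated_by ::
    "(real \<Rightarrow> 'a::complex_banach \<Rightarrow> 'a) \<Rightarrow> 'a set \<Rightarrow> ('a \<Rightarrow> 'a) \<Rightarrow> bool" where
  "semigroup_generated_by S D G \<longleftrightarrow>
     C0_semigroup S \<and>
     (\<forall>x y. ((\<lambda>t. (1 / t) *\<^sub>R (S t x - x)) \<longlongrightarrow> y) (at_right 0) \<longleftrightarrow> x \<in> D \<and> y = G x)"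

text \<open>For a positive operator and \<open>0 < \<alpha> < 1\<close>,
  \<open>A\<^sup>-\<^sup>\<alpha> = sin (\<pi>\<alpha>) / \<pi> \<integral> s\<^sup>-\<^sup>\<alpha> (s I + A)\<^sup>-\<^sup>1 ds\<close> over \<open>(0,\<infinity>)\<close> (Balakrishnan, Krasnoselskii);
  it is bounded and injective, and \<open>A\<^sup>\<alpha>\<close> is its inverse, with domain the range of \<open>A\<^sup>-\<^sup>\<alpha>\<close>.
  Note \<open>(s I + A)\<^sup>-\<^sup>1 = - (- s I - A)\<^sup>-\<^sup>1\<close>. The integral is the gauge (Henstock-Kurzweil) integral,
  since the Bochner integral of the library is restricted to separable spaces.\<close>

definition neg_frac_power ::
    "'a::complex_banach set \<Rightarrow> ('a \<Rightarrow> 'a) \<Rightarrow> real \<Rightarrow> 'a \<Rightarrow> 'a" where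
  "neg_frac_power D A \<alpha> x =
     (sin (pi * \<alpha>) / pi) *\<^sub>R
       integral {0<..} (\<lambda>s::real. (s powr - \<alpha>) *\<^sub>R (- resolvent D A (of_real (- s)) x))"

definition frac_domain :: "'a::complex_banach set \<Rightarrow> ('a \<Rightarrow> 'a) \<Rightarrow> real \<Rightarrow> 'a set" where
  "frac_domain D A \<alpha> = range (neg_frac_power D A \<alpha>)"

definition frac_power ::
    "'a::complex_banach set \<Rightarrow> ('a \<Rightarrow> 'a) \<Rightarrow> real \<Rightarrow> 'a \<Rightarrow> 'a" where
  "frac_power D A \<alpha> = inv (neg_frac_power D A \<alpha>)"


section \<open>The nonlocal problem\<close>

text \<open>In what follows \<open>al i\<close> and \<open>tt i\<close>, \<open>1 \<le> i \<le> m\<close>, are the coefficients \<open>\<alpha>\<^sub>i\<close> and the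
  times \<open>t\<^sub>i\<close> of the nonlocal condition \<open>u(0) + \<Sum>\<^sub>i \<alpha>\<^sub>i u(t\<^sub>i) = u\<^sub>0\<close>, and \<open>S t\<close> plays the role of
  \<open>e\<^sup>-\<^sup>A\<^sup>t\<close>.\<close>

definition B_op ::
    "(real \<Rightarrow> 'a::complex_banach \<Rightarrow> 'a) \<Rightarrow> nat \<Rightarrow> (nat \<Rightarrow> real) \<Rightarrow> (nat \<Rightarrow> real) \<Rightarrow> 'a \<Rightarrow> 'a" where
  "B_op S m al tt x = x + (\<Sum>i=1..m. al i *\<^sub>R S (tt i) x)"

definition u_hom ::
    "(real \<Rightarrow> 'a::complex_banach \<Rightarrow> 'a) \<Rightarrow> nat \<Rightarrow> (nat \<Rightarrow> real) \<Rightarrow> (nat \<Rightarrow> real) \<Rightarrow> 'a \<Rightarrow> real \<Rightarrow> 'a"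
  where
  "u_hom S m al tt u\<^sub>0 t = S t (inv (B_op S m al tt) u\<^sub>0)"

definition B_inv_symbol ::
    "nat \<Rightarrow> (nat \<Rightarrow> real) \<Rightarrow> (nat \<Rightarrow> real) \<Rightarrow> complex \<Rightarrow> complex" where
  "B_inv_symbol m al tt z = inverse (1 + (\<Sum>i=1..m. of_real (al i) * exp (- z * of_real (tt i))))"


section \<open>The integration hyperbola and the quadrature\<close>

definition b0 :: "real \<Rightarrow> real \<Rightarrow> real" where
  "b0 \<rho>\<^sub>0 \<phi> = \<rho>\<^sub>0 * tan \<phi>"

definition d1 :: "real \<Rightarrow> real \<Rightarrow> real \<Rightarrow> real" where
  "d1 \<rho>\<^sub>0 \<phi> \<rho>\<^sub>1 = arccos (\<rho>\<^sub>1 / sqrt (\<rho>\<^sub>0\<^sup>2 + (b0 \<rho>\<^sub>0 \<phi>)\<^sup>2)) - \<phi>"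

definition a_I :: "real \<Rightarrow> real \<Rightarrow> real \<Rightarrow> real" where
  "a_I \<rho>\<^sub>0 \<phi> \<rho>\<^sub>1 = sqrt (\<rho>\<^sub>0\<^sup>2 + (b0 \<rho>\<^sub>0 \<phi>)\<^sup>2) * cos (d1 \<rho>\<^sub>0 \<phi> \<rho>\<^sub>1 / 2 + \<phi>)"

definition b_I :: "real \<Rightarrow> real \<Rightarrow> real \<Rightarrow> real" where
  "b_I \<rho>\<^sub>0 \<phi> \<rho>\<^sub>1 = sqrt (\<rho>\<^sub>0\<^sup>2 + (b0 \<rho>\<^sub>0 \<phi>)\<^sup>2) * sin (d1 \<rho>\<^sub>0 \<phi> \<rho>\<^sub>1 / 2 + \<phi>)"

definition hyp_z :: "real \<Rightarrow> real \<Rightarrow> real \<Rightarrow> real \<Rightarrow> complex" where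
  "hyp_z \<rho>\<^sub>0 \<phi> \<rho>\<^sub>1 \<xi> =
     of_real (a_I \<rho>\<^sub>0 \<phi> \<rho>\<^sub>1 * cosh \<xi>) - \<i> * of_real (b_I \<rho>\<^sub>0 \<phi> \<rho>\<^sub>1 * sinh \<xi>)"

definition hyp_z' :: "real \<Rightarrow> real \<Rightarrow> real \<Rightarrow> real \<Rightarrow> complex" where
  "hyp_z' \<rho>\<^sub>0 \<phi> \<rho>\<^sub>1 \<xi> =
     of_real (a_I \<rho>\<^sub>0 \<phi> \<rho>\<^sub>1 * sinh \<xi>) - \<i> * of_real (b_I \<rho>\<^sub>0 \<phi> \<rho>\<^sub>1 * cosh \<xi>)"

definition integrand ::
    "'a::complex_banach set \<Rightarrow> ('a \<Rightarrow> 'a) \<Rightarrow> real \<Rightarrow> real \<Rightarrow> real \<Rightarrow>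
     nat \<Rightarrow> (nat \<Rightarrow> real) \<Rightarrow> (nat \<Rightarrow> real) \<Rightarrow> 'a \<Rightarrow> real \<Rightarrow> real \<Rightarrow> 'a" where
  "integrand D A \<rho>\<^sub>0 \<phi> \<rho>\<^sub>1 m al tt u\<^sub>0 t \<xi> =
     (let z = hyp_z \<rho>\<^sub>0 \<phi> \<rho>\<^sub>1 \<xi>; z' = hyp_z' \<rho>\<^sub>0 \<phi> \<rho>\<^sub>1 \<xi> in
       (exp (- z * of_real t) * z' * B_inv_symbol m al tt z) *\<^sub>C
         (resolvent D A z u\<^sub>0 - (1 / z) *\<^sub>C u\<^sub>0))"

definition u_sinc ::
    "'a::complex_banach set \<Rightarrow> ('a \<Rightarrow> 'a) \<Rightarrow> real \<Rightarrow> real \<Rightarrow> real \<Rightarrow>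
     nat \<Rightarrow> (nat \<Rightarrow> real) \<Rightarrow> (nat \<Rightarrow> real) \<Rightarrow> 'a \<Rightarrow> real \<Rightarrow> nat \<Rightarrow> real \<Rightarrow> 'a" where
  "u_sinc D A \<rho>\<^sub>0 \<phi> \<rho>\<^sub>1 m al tt u\<^sub>0 h N t =
     (of_real h / (2 * of_real pi * \<i>)) *\<^sub>C
       (\<Sum>k\<in>{- int N..int N}. integrand D A \<rho>\<^sub>0 \<phi> \<rho>\<^sub>1 m al tt u\<^sub>0 t (of_int k * h))"

end

theory Submission
  imports Defs "HOL-Complex_Analysis.Cauchy_Integral_Formula"
begin

text \<open>
The error of the quadrature is a trapezoidal error on a strip. With \<open>f = \<surd>(\<rho>\<^sub>0\<^sup>2 + b\<^sub>0\<^sup>2)\<close> and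
\<open>\<psi> = d\<^sub>1/2 + \<phi>\<close> the hyperbola is \<open>z(\<xi>) = f cosh (\<xi> - \<i>\<psi>)\<close>, so every contour that matters is a horizontal line
in the plane of \<open>w\<close>, where \<open>z = f cosh w\<close>. The line \<open>Im w = -\<phi>\<close> is the hyperbola that touches the
spectral sector in its vertex \<open>\<rho>\<^sub>0\<close>, and \<open>Im w = -(\<phi> + d\<^sub>1)\<close> is the one through \<open>\<rho>\<^sub>1\<close>. Between
them the resolvent exists, the sum \<open>\<Sum> \<alpha>\<^sub>i exp (- z t\<^sub>i)\<close> stays below \<open>1\<close> in modulus, and \<open>Re z > 0\<close>. The integrand
is therefore analytic on a strip of half-width \<open>d\<^sub>1/2\<close> around the integration line, up to its boundary.

For \<open>u = A\<^sup>-\<^sup>\<alpha> v\<close> the resolvent identity inside Balakrishnan's integral gives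
\<open>\<parallel>((z - A)\<^sup>-\<^sup>1 - 1/z) u\<parallel> \<le> C |z|\<^sup>-\<^sup>1\<^sup>-\<^sup>\<alpha> \<parallel>v\<parallel>\<close> (\<open>R_minus_inverse_decay_frac\<close>). Since \<open>z'\<close> and \<open>z\<close> grow like
\<open>exp |\<xi>|\<close>, the integrand is bounded on the strip by \<open>C exp (- \<alpha> |\<xi>|) \<parallel>v\<parallel>\<close>, uniformly in \<open>t \<ge> 0\<close>, with an additional
factor \<open>exp (- t \<rho>\<^sub>1 cosh \<xi>)\<close> (\<open>F_bound\<close>). A trapezoidal sum with step \<open>h\<close> and \<open>2N + 1\<close> nodes then differs from the
integral by a multiple of \<open>exp (- \<pi> d\<^sub>1 / h)\<close> plus the tail beyond \<open>(N + 1/2) h\<close> (\<open>sinc_quadrature_error\<close>). With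
the step of the first claim their exponents are \<open>X\<close> and, up to a bounded amount, \<open>2 X\<close> for
\<open>X = \<surd>(\<pi> d\<^sub>1 \<alpha> (N + 1) / 2)\<close>, so both are of order \<open>exp (- X)\<close> at most; with \<open>h = ln N / N\<close> and \<open>t > 0\<close> the tail is at most a multiple of
\<open>exp (- t \<rho>\<^sub>1 N / 2)\<close> and the discretization term alone decides.

It remains to see that the integral represents the solution (\<open>u_hom_eq_contour_sol\<close>). All integrands have the
form \<open>z'(w)\<close> times a function of \<open>cosh w\<close>, hence are odd on the lines \<open>Im w = 0\<close> and \<open>Im w = -\<pi>\<close>; moving
the contour there replaces closing it in the right or in the left half plane.
  \<^item> By Duhamel's formula \<open>S(t) (z - A)\<^sup>-\<^sup>1 - exp (- z t) (z - A)\<^sup>-\<^sup>1\<close> is a finite Laplace transform of the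
    semigroup and hence entire, so the contour integral at time \<open>t\<close> is \<open>S(t)\<close> applied to the one at time \<open>0\<close>
    (\<open>S_contour_sol_on_D\<close>).
  \<^item> \<open>B\<close> applied to the integral at time \<open>0\<close> cancels \<open>B\<^sup>-\<^sup>1(z)\<close> and leaves the integral of
    \<open>z' ((z - A)\<^sup>-\<^sup>1 - 1/z) u\<close>, which is \<open>2 \<pi> \<i> u\<close> (\<open>integral_G\<close>).
Both are shown for \<open>u\<close> in the domain of \<open>A\<close>; since \<open>A\<^sup>-\<^sup>1\<close> is injective and commutes with everything in
sight, they extend to all \<open>u\<close> with a decaying integrand, and they also show that \<open>B\<close> is injective.

Complex analysis of functions with values in a Banach space is needed only in a modest form: Cauchy's formula on a
rectangle for functions with a continuous complex derivative, proved by shrinking the rectangle to its centre.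
\<close>

section \<open>Continuously differentiable functions with values in a complex Banach space\<close>

lemma bounded_bilinear_scaleC:
  "bounded_bilinear ((*\<^sub>C) :: complex \<Rightarrow> 'a::complex_banach \<Rightarrow> 'a)"
proof
  show "\<exists>K. \<forall>(a::complex) (b::'a). norm (a *\<^sub>C b) \<le> norm a * norm b * K"
    by (rule exI[of _ 1]) (simp add: norm_scaleC)
next
  fix r :: real and a :: complex and b :: 'a
  show "(r *\<^sub>R a) *\<^sub>C b = r *\<^sub>R (a *\<^sub>C b)"
    by (simp add: scaleR_scaleC scaleC_scaleC scaleR_conv_of_real)
  show "a *\<^sub>C (r *\<^sub>R b) = r *\<^sub>R (a *\<^sub>C b)"
    by (simp add: scaleR_scaleC scaleC_scaleC mult.commute)
qed (simp_all add: scaleC_add_left scaleC_add_right)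

interpretation scaleC: bounded_bilinear "(*\<^sub>C) :: complex \<Rightarrow> 'a::complex_banach \<Rightarrow> 'a"
  by (rule bounded_bilinear_scaleC)

lemmas scaleC_continuous_on [continuous_intros] = scaleC.continuous_on

text \<open>Differentiability is required only within the set, so that closed strips and the closed region outside the
  spectral sector can be used without enlarging them; the continuity of the derivative is what makes
  differentiation under the integral sign available.\<close>
definition vholo :: "complex set \<Rightarrow> (complex \<Rightarrow> 'a::complex_banach) \<Rightarrow> bool" where
  "vholo S f \<longleftrightarrow> (\<exists>f'. continuous_on S f' \<and>
     (\<forall>w\<in>S. (f has_derivative (\<lambda>h. h *\<^sub>C f' w)) (at w within S)))"

definition sholo :: "complex set \<Rightarrow> (complex \<Rightarrow> complex) \<Rightarrow> bool" where
  "sholo S g \<longleftrightarrow> (\<exists>g'. continuous_on S g' \<and>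
     (\<forall>w\<in>S. (g has_field_derivative g' w) (at w within S)))"

lemma vholo_continuous_on: "vholo S f \<Longrightarrow> continuous_on S f"
  unfolding vholo_def continuous_on_eq_continuous_within
  by (blast intro: has_derivative_continuous)

lemma sholo_continuous_on: "sholo S f \<Longrightarrow> continuous_on S f"
  unfolding sholo_def continuous_on_eq_continuous_within
  by (blast intro: DERIV_continuous)

lemma vholo_subset: "vholo S f \<Longrightarrow> T \<subseteq> S \<Longrightarrow> vholo T f"
  unfolding vholo_def by (meson continuous_on_subset has_derivative_subset subsetD)

lemma sholo_subset: "sholo S f \<Longrightarrow> T \<subseteq> S \<Longrightarrow> sholo T f"
  unfolding sholo_def by (meson continuous_on_subset DERIV_subset subsetD)

lemma vholo_cong:
  assumes "vholo S f" "\<And>w. w \<in> S \<Longrightarrow> f w = g w"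
  shows "vholo S g"
proof -
  from assms(1) obtain f' where f': "continuous_on S f'"
    "\<And>w. w \<in> S \<Longrightarrow> (f has_derivative (\<lambda>h. h *\<^sub>C f' w)) (at w within S)"
    by (auto simp: vholo_def)
  have "(g has_derivative (\<lambda>h. h *\<^sub>C f' w)) (at w within S)" if "w \<in> S" for w
    using has_derivative_transform[OF that _ f'(2)[OF that], of g] assms(2) by auto
  with f'(1) show ?thesis unfolding vholo_def by blast
qed

lemma holomorphic_on_imp_sholo:
  assumes "g holomorphic_on U" "open U" "S \<subseteq> U"
  shows "sholo S g"
  unfolding sholo_def
proof (intro exI conjI ballI)
  show "continuous_on S (deriv g)"
    using holomorphic_on_imp_continuous_on[OF holomorphic_deriv[OF assms(1,2)]] assms(3)
    by (rule continuous_on_subset)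
  show "(g has_field_derivative deriv g w) (at w within S)" if "w \<in> S" for w
    using holomorphic_derivI[OF assms(1,2)] that assms(3) has_field_derivative_at_within by blast
qed

lemma vholo_scaleC:
  assumes "sholo S g" "vholo S f"
  shows "vholo S (\<lambda>w. g w *\<^sub>C f w)"
proof -
  from assms(1) obtain g' where g': "continuous_on S g'"
    "\<And>w. w \<in> S \<Longrightarrow> (g has_field_derivative g' w) (at w within S)" by (auto simp: sholo_def)
  from assms(2) obtain f' where f': "continuous_on S f'"
    "\<And>w. w \<in> S \<Longrightarrow> (f has_derivative (\<lambda>h. h *\<^sub>C f' w)) (at w within S)"
    by (auto simp: vholo_def)
  note cf = vholo_continuous_on[OF assms(2)] and cg = sholo_continuous_on[OF assms(1)]
  show ?thesis unfolding vholo_def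
  proof (intro exI[of _ "\<lambda>w. g' w *\<^sub>C f w + g w *\<^sub>C f' w"] conjI ballI)
    show "continuous_on S (\<lambda>w. g' w *\<^sub>C f w + g w *\<^sub>C f' w)"
      by (intro continuous_intros f' g' cf cg)
    fix w assume w: "w \<in> S"
    have *: "g w *\<^sub>C h *\<^sub>C f' w + (g' w * h) *\<^sub>C f w = h *\<^sub>C (g' w *\<^sub>C f w + g w *\<^sub>C f' w)" for h
      by (simp add: scaleC_add_right scaleC_scaleC mult.commute add.commute)
    show "((\<lambda>w. g w *\<^sub>C f w) has_derivative (\<lambda>h. h *\<^sub>C (g' w *\<^sub>C f w + g w *\<^sub>C f' w))) (at w within S)"
      using scaleC.FDERIV[OF g'(2)[OF w, unfolded has_field_derivative_def] f'(2)[OF w]]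
      by (simp add: *)
  qed
qed

lemma vholo_diff:
  assumes "vholo S f" "vholo S g"
  shows "vholo S (\<lambda>w. f w - g w)"
proof -
  from assms obtain f' g' where *: "continuous_on S f'" "continuous_on S g'"
    "\<And>w. w \<in> S \<Longrightarrow> (f has_derivative (\<lambda>h. h *\<^sub>C f' w)) (at w within S)"
    "\<And>w. w \<in> S \<Longrightarrow> (g has_derivative (\<lambda>h. h *\<^sub>C g' w)) (at w within S)"
    by (auto simp: vholo_def)
  show ?thesis unfolding vholo_def
  proof (intro exI[of _ "\<lambda>w. f' w - g' w"] conjI ballI)
    show "((\<lambda>w. f w - g w) has_derivative (\<lambda>h. h *\<^sub>C (f' w - g' w))) (at w within S)"
      if "w \<in> S" for w
      using has_derivative_diff[OF *(3)[OF that] *(4)[OF that]] by (simp add: scaleC.diff_right)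
  qed (intro continuous_intros *)
qed

lemma vholo_const: "vholo S (\<lambda>w. x)"
  unfolding vholo_def
  by (intro exI[of _ "\<lambda>w. 0"] conjI ballI) (auto simp: scaleC.zero_right)

lemma vholo_compose:
  assumes "vholo T f" "sholo S g" "g ` S \<subseteq> T"
  shows "vholo S (\<lambda>w. f (g w))"
proof -
  from assms(2) obtain g' where g': "continuous_on S g'"
    "\<And>w. w \<in> S \<Longrightarrow> (g has_field_derivative g' w) (at w within S)" by (auto simp: sholo_def)
  from assms(1) obtain f' where f': "continuous_on T f'"
    "\<And>w. w \<in> T \<Longrightarrow> (f has_derivative (\<lambda>h. h *\<^sub>C f' w)) (at w within T)"
    by (auto simp: vholo_def)
  show ?thesis unfolding vholo_def
  proof (intro exI[of _ "\<lambda>w. g' w *\<^sub>C f' (g w)"] conjI ballI)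
    show "continuous_on S (\<lambda>w. g' w *\<^sub>C f' (g w))"
      by (intro continuous_intros g' continuous_on_compose2[OF f'(1) sholo_continuous_on] assms)
    fix w assume w: "w \<in> S"
    have "((\<lambda>w. f (g w)) has_derivative (\<lambda>h. (g' w * h) *\<^sub>C f' (g w))) (at w within S)"
    proof (rule has_derivative_in_compose2[of T f _ g S w])
      show "(g has_derivative (*) (g' w)) (at w within S)"
        using g'(2)[OF w] by (simp add: has_field_derivative_def)
    qed (use w assms f'(2) in auto)
    then show "((\<lambda>w. f (g w)) has_derivative (\<lambda>h. h *\<^sub>C g' w *\<^sub>C f' (g w))) (at w within S)"
      by (simp add: scaleC_scaleC mult.commute)
  qed
qed

lemma sholo_compose:
  assumes "sholo T f" "sholo S g" "g ` S \<subseteq> T"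
  shows "sholo S (\<lambda>w. f (g w))"
proof -
  from assms(2) obtain g' where g': "continuous_on S g'"
    "\<And>w. w \<in> S \<Longrightarrow> (g has_field_derivative g' w) (at w within S)" by (auto simp: sholo_def)
  from assms(1) obtain f' where f': "continuous_on T f'"
    "\<And>w. w \<in> T \<Longrightarrow> (f has_field_derivative f' w) (at w within T)"
    by (auto simp: sholo_def)
  show ?thesis unfolding sholo_def
  proof (intro exI[of _ "\<lambda>w. f' (g w) * g' w"] conjI ballI)
    show "continuous_on S (\<lambda>w. f' (g w) * g' w)"
      by (intro continuous_intros g' continuous_on_compose2[OF f'(1) sholo_continuous_on] assms)
    show "((\<lambda>w. f (g w)) has_field_derivative f' (g w) * g' w) (at w within S)" if w: "w \<in> S" for w
      using DERIV_image_chain[of f "f' (g w)" g w S "g' w"] g'(2)[OF w] assms(3) w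
        DERIV_subset[OF f'(2)[of "g w"] assms(3)] by (auto simp: o_def)
  qed
qed

text \<open>Restricts a complex derivative to a straight line, as needed for integration by parts along the negative axis.\<close>
lemma vholo_line:
  assumes F: "vholo S F" and X: "\<And>s. s \<in> X \<Longrightarrow> q + of_real s * e \<in> S"
  obtains G' where "continuous_on X G'"
    "\<And>s. s \<in> X \<Longrightarrow> ((\<lambda>s. F (q + of_real s * e)) has_vector_derivative G' s) (at s within X)"
proof -
  from F obtain F' where F': "continuous_on S F'"
    "\<And>w. w \<in> S \<Longrightarrow> (F has_derivative (\<lambda>h. h *\<^sub>C F' w)) (at w within S)"
    by (auto simp: vholo_def)
  show ?thesis
  proof (rule that[of "\<lambda>s. e *\<^sub>C F' (q + of_real s * e)"])
    show "continuous_on X (\<lambda>s. e *\<^sub>C F' (q + of_real s * e))"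
      by (intro continuous_intros continuous_on_compose2[OF F'(1)]) (use X in auto)
    fix s assume s: "s \<in> X"
    have d: "((\<lambda>s. q + of_real s * e) has_derivative (\<lambda>h. of_real h * e)) (at s within X)"
      by (auto intro!: derivative_eq_intros)
    have "((\<lambda>s. F (q + of_real s * e)) has_derivative (\<lambda>h. (of_real h * e) *\<^sub>C F' (q + of_real s * e))) (at s within X)"
      by (rule has_derivative_in_compose2[OF F'(2) _ s d]) (use X in auto)
    then show "((\<lambda>s. F (q + of_real s * e)) has_vector_derivative e *\<^sub>C F' (q + of_real s * e)) (at s within X)"
      by (simp add: has_vector_derivative_def scaleR_scaleC scaleC_scaleC)
  qed
qed

section \<open>Cauchy theory on rectangles\<close>

text \<open>Differentiating the integral over one edge of a contour with respect to its dilation factor \<open>l\<close> about \<open>p\<close>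
  gives the integral of a derivative along the edge, so the result depends only on the two end points. Summed
  over a closed polygon these contributions cancel, which proves Cauchy's formula without any prior Cauchy theorem.\<close>
lemma edge_shrink:
  fixes G :: "complex \<Rightarrow> 'a::complex_banach" and q e :: complex
  defines "\<sigma> \<equiv> \<lambda>s::real. q + of_real s * e"
  assumes G': "continuous_on S G'"
    "\<And>w. w \<in> S \<Longrightarrow> (G has_derivative (\<lambda>h. h *\<^sub>C G' w)) (at w within S)"
    and S: "convex S" "p \<in> S" "\<And>s. s \<in> {a..b} \<Longrightarrow> \<sigma> s \<in> S \<and> \<sigma> s \<noteq> p" and ab: "a \<le> b"
    and l: "l \<in> {0..1}"
  defines "J \<equiv> \<lambda>w. if l = 0 then (w - p) *\<^sub>C G' p else (1 / l) *\<^sub>R G (p + of_real l * (w - p))"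
  shows "((\<lambda>l::real. integral {a..b} (\<lambda>s. (e / (\<sigma> s - p)) *\<^sub>C G (p + of_real l * (\<sigma> s - p))))
           has_vector_derivative J (\<sigma> b) - J (\<sigma> a)) (at l within {0..1})"
proof -
  have cG: "continuous_on S G"
    using G' vholo_continuous_on[of S G] by (auto simp: vholo_def)
  have inS: "p + of_real l * (\<sigma> s - p) \<in> S" if "l \<in> {0..1}" "s \<in> {a..b}" for l s
  proof -
    have "p + of_real l * (\<sigma> s - p) = (1 - l) *\<^sub>R p + l *\<^sub>R \<sigma> s"
      by (simp add: scaleR_conv_of_real algebra_simps)
    then show ?thesis using S that by (auto intro!: convexD)
  qed
  have c\<sigma>: "continuous_on X \<sigma>" for X unfolding \<sigma>_def by (intro continuous_intros)
  let ?D = "integral {a..b} (\<lambda>s. e *\<^sub>C G' (p + of_real l * (\<sigma> s - p)))"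
  have lam: "((\<lambda>l::real. integral {a..b} (\<lambda>s. (e / (\<sigma> s - p)) *\<^sub>C G (p + of_real l * (\<sigma> s - p))))
           has_vector_derivative ?D) (at l within {0..1})"
  proof (rule leibniz_rule_vector_derivative[where a=a and b=b, unfolded cbox_interval,
        where fx="\<lambda>l s. e *\<^sub>C G' (p + of_real l * (\<sigma> s - p))"])
    fix k s assume k: "k \<in> {0..1::real}" and s: "s \<in> {a..b}"
    have d1: "((\<lambda>k::real. p + of_real k * (\<sigma> s - p)) has_derivative (\<lambda>h. of_real h * (\<sigma> s - p)))
            (at k within {0..1})"
      by (auto intro!: derivative_eq_intros)
    have "((\<lambda>k::real. G (p + of_real k * (\<sigma> s - p))) has_derivative
            (\<lambda>h. (of_real h * (\<sigma> s - p)) *\<^sub>C G' (p + of_real k * (\<sigma> s - p)))) (at k within {0..1})"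
      by (rule has_derivative_in_compose2[OF G'(2) _ k d1]) (use inS s in auto)
    then have "((\<lambda>k::real. (e / (\<sigma> s - p)) *\<^sub>C G (p + of_real k * (\<sigma> s - p))) has_derivative
            (\<lambda>h. (e / (\<sigma> s - p)) *\<^sub>C (of_real h * (\<sigma> s - p)) *\<^sub>C G' (p + of_real k * (\<sigma> s - p)))) (at k within {0..1})"
      by (rule bounded_linear.has_derivative[OF scaleC.bounded_linear_right])
    moreover have "(e / (\<sigma> s - p)) *\<^sub>C (of_real h * (\<sigma> s - p)) *\<^sub>C x = h *\<^sub>R (e *\<^sub>C x)" for h :: real and x :: 'a
      using S(3)[OF s] by (simp add: scaleC_scaleC scaleR_scaleC mult.commute)
    ultimately show "((\<lambda>k::real. (e / (\<sigma> s - p)) *\<^sub>C G (p + of_real k * (\<sigma> s - p))) has_vector_derivative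
            e *\<^sub>C G' (p + of_real k * (\<sigma> s - p))) (at k within {0..1})"
      by (simp add: has_vector_derivative_def)
  next
    fix k assume k: "k \<in> {0..1::real}"
    show "(\<lambda>s. (e / (\<sigma> s - p)) *\<^sub>C G (p + of_real k * (\<sigma> s - p))) integrable_on {a..b}"
      by (intro integrable_continuous_interval continuous_intros c\<sigma> continuous_on_compose2[OF cG])
        (use S inS k in auto)
  next
    show "continuous_on ({0..1} \<times> {a..b}) (\<lambda>(l, s). e *\<^sub>C G' (p + of_real l * (\<sigma> s - p)))"
      unfolding split_beta
      by (intro continuous_intros continuous_on_compose2[OF G'(1)] continuous_on_compose2[OF c\<sigma>[of UNIV]])
        (use inS in auto)
  qed (use l in auto)
  have "?D = J (\<sigma> b) - J (\<sigma> a)"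
  proof (cases "l = 0")
    case True
    have "(\<sigma> b - p) *\<^sub>C G' p - (\<sigma> a - p) *\<^sub>C G' p = (of_real (b - a) * e) *\<^sub>C G' p"
      by (simp add: scaleC.diff_left[symmetric] \<sigma>_def algebra_simps)
    then show ?thesis using True ab
      by (simp add: J_def scaleR_scaleC scaleC_scaleC)
  next
    case False
    have "((\<lambda>s. e *\<^sub>C G' (p + of_real l * (\<sigma> s - p))) has_integral
        (1 / l) *\<^sub>R G (p + of_real l * (\<sigma> b - p)) - (1 / l) *\<^sub>R G (p + of_real l * (\<sigma> a - p))) {a..b}"
    proof (rule fundamental_theorem_of_calculus[OF ab])
      fix s assume s: "s \<in> {a..b}"
      have d1: "((\<lambda>s. p + of_real l * (\<sigma> s - p)) has_derivative (\<lambda>h. of_real l * (of_real h * e)))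
            (at s within {a..b})"
        unfolding \<sigma>_def by (auto intro!: derivative_eq_intros)
      have "((\<lambda>s. G (p + of_real l * (\<sigma> s - p))) has_derivative
            (\<lambda>h. (of_real l * (of_real h * e)) *\<^sub>C G' (p + of_real l * (\<sigma> s - p)))) (at s within {a..b})"
        by (rule has_derivative_in_compose2[OF G'(2) _ s d1]) (use inS l in auto)
      from has_derivative_scaleR_right[OF this, of "1 / l"]
      show "((\<lambda>s. (1 / l) *\<^sub>R G (p + of_real l * (\<sigma> s - p))) has_vector_derivative
            e *\<^sub>C G' (p + of_real l * (\<sigma> s - p))) (at s within {a..b})"
        using False by (simp add: has_vector_derivative_def scaleR_scaleC scaleC_scaleC)
    qed
    then show ?thesis using False by (simp add: J_def integral_unique)
  qed
  with lam show ?thesis by simp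
qed

definition hline :: "(complex \<Rightarrow> 'a::complex_banach) \<Rightarrow> real \<Rightarrow> real \<Rightarrow> real \<Rightarrow> 'a" where
  "hline f y a b = integral {a..b} (\<lambda>x. f (Complex x y))"

definition vline :: "(complex \<Rightarrow> 'a::complex_banach) \<Rightarrow> real \<Rightarrow> real \<Rightarrow> real \<Rightarrow> 'a" where
  "vline f x a b = integral {a..b} (\<lambda>y. \<i> *\<^sub>C f (Complex x y))"

abbreviation rectangle :: "real \<Rightarrow> real \<Rightarrow> real \<Rightarrow> real \<Rightarrow> complex set" where
  "rectangle x0 x1 y0 y1 \<equiv> {w. x0 \<le> Re w \<and> Re w \<le> x1 \<and> y0 \<le> Im w \<and> Im w \<le> y1}"

lemma convex_rectangle: "convex (rectangle x0 x1 y0 y1)"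
proof -
  have "rectangle x0 x1 y0 y1 = cbox (Complex x0 y0) (Complex x1 y1)"
    by (auto simp: in_cbox_complex_iff)
  then show ?thesis by (simp add: convex_box)
qed

text \<open>The two horizontal edges of a rectangle contribute an arc tangent to the winding number of its centre.\<close>
lemma integral_inverse_edges:
  fixes a c d :: real
  assumes "a > 0" "d > 0"
  shows "((\<lambda>x. 1 / Complex (x - c) (-d) - 1 / Complex (x - c) d) has_integral
           4 * \<i> * of_real (arctan (a / d))) {c - a..c + a}"
proof -
  have *: "1 / Complex x (-d) - 1 / Complex x d = of_real (2 * d / (d\<^sup>2 + x\<^sup>2)) * \<i>" for x
    using assms by (auto simp: complex_eq_iff Re_divide Im_divide power2_eq_square)
  have "((\<lambda>x. 2 * d / (d\<^sup>2 + (x - c)\<^sup>2)) has_integral 2 * arctan ((c + a - c) / d) - 2 * arctan ((c - a - c) / d)) {c - a..c + a}"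
  proof (rule fundamental_theorem_of_calculus)
    fix x :: real
    have "((\<lambda>x. 2 * arctan ((x - c) / d)) has_real_derivative 2 * (1 / d * inverse (1 + ((x - c) / d)\<^sup>2)))
            (at x within {c - a..c + a})"
      using assms by (auto intro!: derivative_eq_intros)
    moreover have "2 * (1 / d * inverse (1 + (y / d)\<^sup>2)) = 2 * d / (d\<^sup>2 + y\<^sup>2)" for y
      using assms by (simp add: field_simps power2_eq_square)
    ultimately show "((\<lambda>x. 2 * arctan ((x - c) / d)) has_vector_derivative 2 * d / (d\<^sup>2 + (x - c)\<^sup>2))
            (at x within {c - a..c + a})"
      by (simp add: has_real_derivative_iff_has_vector_derivative)
  qed (use assms in auto)
  then have "((\<lambda>x. complex_of_real (2 * d / (d\<^sup>2 + (x - c)\<^sup>2))) has_integral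
      of_real (2 * arctan ((c + a - c) / d) - 2 * arctan ((c - a - c) / d))) {c - a..c + a}"
    by (rule has_integral_of_real)
  from has_integral_mult_left[OF this, of \<i>]
  show ?thesis unfolding * by (simp add: arctan_minus algebra_simps)
qed

lemma winding_integral_rectangle:
  fixes p :: complex
  assumes "a > 0" "d > 0"
  defines "k \<equiv> \<lambda>w. 1 / (w - p)"
  shows "integral {Re p - a..Re p + a} (\<lambda>x. k (Complex x (Im p - d)))
       + integral {Im p - d..Im p + d} (\<lambda>y. \<i> * k (Complex (Re p + a) y))
       - integral {Re p - a..Re p + a} (\<lambda>x. k (Complex x (Im p + d)))
       - integral {Im p - d..Im p + d} (\<lambda>y. \<i> * k (Complex (Re p - a) y)) = 2 * of_real pi * \<i>"
proof -
  have ne: "Complex x y - p \<noteq> 0" if "x \<noteq> Re p \<or> y \<noteq> Im p" for x y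
    using that by (auto simp: complex_eq_iff)
  have int: "(\<lambda>x. k (Complex x y)) integrable_on X" if "y \<noteq> Im p" "X = {u..v}" for X u v y
    unfolding k_def that(2)
    by (intro integrable_continuous_interval continuous_intros)
      (use that ne in \<open>auto simp: Complex_eq continuous_intros intro!: continuous_intros\<close>)
  have int': "(\<lambda>y. \<i> * k (Complex x y)) integrable_on X" if "x \<noteq> Re p" "X = {u..v}" for X u v x
    unfolding k_def that(2)
    by (intro integrable_continuous_interval continuous_intros)
      (use that ne in \<open>auto simp: Complex_eq continuous_intros intro!: continuous_intros\<close>)
  have 1: "integral {Re p - a..Re p + a} (\<lambda>x. k (Complex x (Im p - d)))
         - integral {Re p - a..Re p + a} (\<lambda>x. k (Complex x (Im p + d))) = 4 * \<i> * of_real (arctan (a / d))"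
  proof (subst integral_diff[symmetric])
    have "k (Complex x (Im p - d)) - k (Complex x (Im p + d)) = 1 / Complex (x - Re p) (-d) - 1 / Complex (x - Re p) d" for x
    proof -
      have "Complex x (Im p - d) - p = Complex (x - Re p) (-d)" "Complex x (Im p + d) - p = Complex (x - Re p) d"
        by (auto simp: complex_eq_iff)
      then show ?thesis by (simp add: k_def)
    qed
    then show "integral {Re p - a..Re p + a} (\<lambda>x. k (Complex x (Im p - d)) - k (Complex x (Im p + d)))
        = 4 * \<i> * of_real (arctan (a / d))"
      using integral_inverse_edges[OF assms(1,2), of "Re p"] by (simp add: integral_unique)
  qed (use assms int in auto)
  have 2: "integral {Im p - d..Im p + d} (\<lambda>y. \<i> * k (Complex (Re p + a) y))
         - integral {Im p - d..Im p + d} (\<lambda>y. \<i> * k (Complex (Re p - a) y)) = 4 * \<i> * of_real (arctan (d / a))"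
  proof (subst integral_diff[symmetric])
    have "\<i> * k (Complex (Re p + a) y) - \<i> * k (Complex (Re p - a) y)
        = 1 / Complex (y - Im p) (-a) - 1 / Complex (y - Im p) a" for y
    proof -
      have "Complex (Re p + a) y - p = \<i> * Complex (y - Im p) (-a)"
        "Complex (Re p - a) y - p = \<i> * Complex (y - Im p) a"
        by (auto simp: complex_eq_iff)
      then show ?thesis by (simp add: k_def)
    qed
    then show "integral {Im p - d..Im p + d} (\<lambda>y. \<i> * k (Complex (Re p + a) y) - \<i> * k (Complex (Re p - a) y))
        = 4 * \<i> * of_real (arctan (d / a))"
      using integral_inverse_edges[OF assms(2,1), of "Im p"] by (simp add: integral_unique)
  qed (use assms int' in auto)
  have "arctan (d / a) = pi / 2 - arctan (a / d)"
    using arctan_inverse[of "a / d"] assms by (simp add: sgn_if)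
  then have "4 * \<i> * of_real (arctan (a / d)) + 4 * \<i> * of_real (arctan (d / a)) = 2 * of_real pi * \<i>"
    by (simp add: right_diff_distrib)
  with 1 2 show ?thesis by (simp add: algebra_simps)
qed

text \<open>Shrinking the rectangle to its centre does not change the integral; in the limit the function is the constant
  \<open>G p\<close> and only the scalar winding integral is left.\<close>
theorem cauchy_formula_rectangle:
  fixes G :: "complex \<Rightarrow> 'a::complex_banach"
  assumes G: "vholo (rectangle (Re p - a) (Re p + a) (Im p - d) (Im p + d)) G" and ad: "a > 0" "d > 0"
  defines "f \<equiv> \<lambda>w. (1 / (w - p)) *\<^sub>C G w"
  shows "hline f (Im p - d) (Re p - a) (Re p + a) + vline f (Re p + a) (Im p - d) (Im p + d)
       - hline f (Im p + d) (Re p - a) (Re p + a) - vline f (Re p - a) (Im p - d) (Im p + d)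
       = (2 * of_real pi * \<i>) *\<^sub>C G p"
proof -
  let ?S = "rectangle (Re p - a) (Re p + a) (Im p - d) (Im p + d)"
  from G obtain G' where G': "continuous_on ?S G'"
    "\<And>w. w \<in> ?S \<Longrightarrow> (G has_derivative (\<lambda>h. h *\<^sub>C G' w)) (at w within ?S)"
    by (auto simp: vholo_def)
  have pS: "p \<in> ?S" using ad by auto
  define I :: "complex \<Rightarrow> complex \<Rightarrow> real \<Rightarrow> real \<Rightarrow> real \<Rightarrow> 'a" where
    "I q e u v l = integral {u..v} (\<lambda>s. (e / (q + of_real s * e - p)) *\<^sub>C
        G (p + of_real l * (q + of_real s * e - p)))" for q e u v l
  define J where "J l w = (if l = 0 then (w - p) *\<^sub>C G' p else (1 / l) *\<^sub>R G (p + of_real l * (w - p)))"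
    for l :: real and w
  let ?x0 = "Re p - a" and ?x1 = "Re p + a" and ?y0 = "Im p - d" and ?y1 = "Im p + d"
  have H: "Complex x y = \<i> * of_real y + of_real x * 1" for x y by (simp add: complex_eq_iff)
  have V: "Complex x y = of_real x + of_real y * \<i>" for x y by (simp add: complex_eq_iff)
  have Hd: "(I (\<i> * of_real y) 1 ?x0 ?x1 has_vector_derivative J l (Complex ?x1 y) - J l (Complex ?x0 y))
      (at l within {0..1})" if "l \<in> {0..1}" "y = ?y0 \<or> y = ?y1" for l y
    unfolding I_def[abs_def] J_def H
    by (rule edge_shrink[OF G' convex_rectangle pS _ _ that(1)])
      (use ad that(2) in \<open>auto simp: complex_eq_iff\<close>)
  have Vd: "(I (of_real x) \<i> ?y0 ?y1 has_vector_derivative J l (Complex x ?y1) - J l (Complex x ?y0))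
      (at l within {0..1})" if "l \<in> {0..1}" "x = ?x0 \<or> x = ?x1" for l x
    unfolding I_def[abs_def] J_def V
    by (rule edge_shrink[OF G' convex_rectangle pS _ _ that(1)])
      (use ad that(2) in \<open>auto simp: complex_eq_iff\<close>)
  define \<Phi> where "\<Phi> l = I (\<i> * of_real ?y0) 1 ?x0 ?x1 l + I (of_real ?x1) \<i> ?y0 ?y1 l
      - I (\<i> * of_real ?y1) 1 ?x0 ?x1 l - I (of_real ?x0) \<i> ?y0 ?y1 l" for l
  (* the corner contributions of the four edges cancel, so shrinking the contour does not change the integral *)
  have "(\<Phi> has_vector_derivative 0) (at l within {0..1})" if l: "l \<in> {0..1}" for l
  proof -
    have "(\<Phi> has_vector_derivative
        (J l (Complex ?x1 ?y0) - J l (Complex ?x0 ?y0)) + (J l (Complex ?x1 ?y1) - J l (Complex ?x1 ?y0))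
        - (J l (Complex ?x1 ?y1) - J l (Complex ?x0 ?y1)) - (J l (Complex ?x0 ?y1) - J l (Complex ?x0 ?y0)))
        (at l within {0..1})"
      unfolding \<Phi>_def[abs_def]
      by (intro has_vector_derivative_add has_vector_derivative_diff Hd Vd l) auto
    then show ?thesis by simp
  qed
  then obtain c where c: "\<And>l. l \<in> {0..1} \<Longrightarrow> \<Phi> l = c"
    using has_vector_derivative_zero_constant[of "{0..1}" \<Phi>] by auto
  have "I (\<i> * of_real y) 1 u v 1 = hline f y u v" for y u v
    unfolding I_def hline_def f_def by (simp only: H[symmetric]) simp
  moreover have "I (of_real x) \<i> u v 1 = vline f x u v" for x u v
    unfolding I_def vline_def f_def by (simp only: V[symmetric]) (simp add: scaleC_scaleC)
  ultimately have "\<Phi> 1 = hline f ?y0 ?x0 ?x1 + vline f ?x1 ?y0 ?y1 - hline f ?y1 ?x0 ?x1 - vline f ?x0 ?y0 ?y1"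
    unfolding \<Phi>_def by (simp only:)
  moreover
  have ne: "Complex x y - p \<noteq> 0" if "x \<noteq> Re p \<or> y \<noteq> Im p" for x y
    using that by (auto simp: complex_eq_iff)
  have pull: "integral X (\<lambda>s. g s *\<^sub>C G p) = integral X g *\<^sub>C G p" if "g integrable_on X" for X :: "real set" and g
    using integral_linear[OF that scaleC.bounded_linear_left, of "G p"] by (simp add: o_def)
  have "\<Phi> 0 = (2 * of_real pi * \<i>) *\<^sub>C G p"
  proof -
    have H1: "I (\<i> * of_real y) 1 ?x0 ?x1 0 = integral {?x0..?x1} (\<lambda>x. 1 / (Complex x y - p)) *\<^sub>C G p"
      if "y \<noteq> Im p" for y
    proof -
      have "(\<lambda>x. 1 / (Complex x y - p)) integrable_on {?x0..?x1}"
        by (intro integrable_continuous_interval continuous_intros)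
          (use that ne in \<open>auto simp: Complex_eq intro!: continuous_intros\<close>)
      from pull[OF this] show ?thesis unfolding I_def by (simp add: H)
    qed
    have V1: "I (of_real x) \<i> ?y0 ?y1 0 = integral {?y0..?y1} (\<lambda>y. \<i> * (1 / (Complex x y - p))) *\<^sub>C G p"
      if "x \<noteq> Re p" for x
    proof -
      have "(\<lambda>y. \<i> * (1 / (Complex x y - p))) integrable_on {?y0..?y1}"
        by (intro integrable_continuous_interval continuous_intros)
          (use that ne in \<open>auto simp: Complex_eq intro!: continuous_intros\<close>)
      from pull[OF this] show ?thesis unfolding I_def by (simp add: V)
    qed
    have "\<Phi> 0 = (integral {?x0..?x1} (\<lambda>x. 1 / (Complex x ?y0 - p))
       + integral {?y0..?y1} (\<lambda>y. \<i> * (1 / (Complex ?x1 y - p)))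
       - integral {?x0..?x1} (\<lambda>x. 1 / (Complex x ?y1 - p))
       - integral {?y0..?y1} (\<lambda>y. \<i> * (1 / (Complex ?x0 y - p)))) *\<^sub>C G p"
      unfolding \<Phi>_def using ad H1[of ?y0] H1[of ?y1] V1[of ?x0] V1[of ?x1]
      by (simp add: scaleC.add_left scaleC.diff_left)
    also note winding_integral_rectangle[OF ad, of p]
    finally show ?thesis .
  qed
  ultimately show ?thesis using c[of 0] c[of 1] by simp
qed

text \<open>Cauchy's formula for \<open>(w - p) f(w)\<close>, which vanishes at the centre \<open>p\<close>.\<close>
corollary cauchy_rectangle:
  fixes f :: "complex \<Rightarrow> 'a::complex_banach"
  assumes f: "vholo (rectangle x0 x1 y0 y1) f" and xy: "x0 < x1" "y0 < y1"
  shows "hline f y0 x0 x1 + vline f x1 y0 y1 - hline f y1 x0 x1 - vline f x0 y0 y1 = 0"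
proof -
  define p where "p = Complex ((x0 + x1) / 2) ((y0 + y1) / 2)"
  define a where "a = (x1 - x0) / 2"
  define d where "d = (y1 - y0) / 2"
  have eq: "Re p - a = x0" "Re p + a = x1" "Im p - d = y0" "Im p + d = y1"
    by (auto simp: p_def a_def d_def field_simps)
  have "(\<lambda>w. w - p) holomorphic_on UNIV" by (intro holomorphic_intros)
  then have "vholo (rectangle x0 x1 y0 y1) (\<lambda>w. (w - p) *\<^sub>C f w)"
    by (intro vholo_scaleC f holomorphic_on_imp_sholo) auto
  then have "vholo (rectangle (Re p - a) (Re p + a) (Im p - d) (Im p + d)) (\<lambda>w. (w - p) *\<^sub>C f w)"
    by (simp only: eq)
  from cauchy_formula_rectangle[OF this] xy
  have main: "hline (\<lambda>w. (1 / (w - p)) *\<^sub>C (w - p) *\<^sub>C f w) y0 x0 x1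
      + vline (\<lambda>w. (1 / (w - p)) *\<^sub>C (w - p) *\<^sub>C f w) x1 y0 y1
      - hline (\<lambda>w. (1 / (w - p)) *\<^sub>C (w - p) *\<^sub>C f w) y1 x0 x1
      - vline (\<lambda>w. (1 / (w - p)) *\<^sub>C (w - p) *\<^sub>C f w) x0 y0 y1 = 0"
    unfolding eq by (simp add: a_def d_def scaleC.zero_left scaleC.zero_right)
  have ne: "(1 / (Complex x y - p)) *\<^sub>C (Complex x y - p) *\<^sub>C z = z" if "x \<noteq> Re p \<or> y \<noteq> Im p" for x y and z :: 'a
  proof -
    have "Complex x y - p \<noteq> 0" using that by (auto simp: complex_eq_iff)
    then show ?thesis by (simp add: scaleC_scaleC scaleC_one)
  qed
  have "Re p \<noteq> x0" "Re p \<noteq> x1" "Im p \<noteq> y0" "Im p \<noteq> y1" using xy by (auto simp: p_def)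
  with main ne show ?thesis by (simp add: hline_def vline_def)
qed

lemma continuous_Complex [continuous_intros]:
  "continuous_on X f \<Longrightarrow> continuous_on X g \<Longrightarrow> continuous_on X (\<lambda>x. Complex (f x) (g x))"
  unfolding Complex_eq by (intro continuous_intros)

lemma hline_combine:
  assumes "continuous_on {a..c} (\<lambda>x. f (Complex x y))" "a \<le> b" "b \<le> c"
  shows "hline f y a b + hline f y b c = hline f y a c"
  unfolding hline_def
  by (intro Henstock_Kurzweil_Integration.integral_combine integrable_continuous_interval assms)

lemma vline_norm_bound:
  assumes "continuous_on {y0..y1} (\<lambda>y. f (Complex x y))" "y0 \<le> y1"
    and "\<And>y. y \<in> {y0..y1} \<Longrightarrow> norm (f (Complex x y)) \<le> B"
  shows "norm (vline f x y0 y1) \<le> B * (y1 - y0)"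
  unfolding vline_def using assms
  by (intro integral_bound continuous_intros) (auto simp: norm_scaleC)

lemma vline_approx:
  assumes cont: "continuous_on {y0..y1} (\<lambda>y. f (Complex x y))" and y: "y0 \<le> y1"
    and bd: "\<And>y. y \<in> {y0..y1} \<Longrightarrow> norm (f (Complex x y) - v) \<le> B"
  shows "norm (vline f x y0 y1 - (\<i> * of_real (y1 - y0)) *\<^sub>C v) \<le> B * (y1 - y0)"
proof -
  have "((\<lambda>y. \<i> *\<^sub>C v) has_integral (y1 - y0) *\<^sub>R (\<i> *\<^sub>C v)) {y0..y1}"
    using has_integral_const_real[of "\<i> *\<^sub>C v" y0 y1] y by simp
  moreover have "((\<lambda>y. \<i> *\<^sub>C f (Complex x y)) has_integral vline f x y0 y1) {y0..y1}"
    unfolding vline_def by (intro integrable_integral integrable_continuous_interval continuous_intros cont)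
  ultimately have "((\<lambda>y. \<i> *\<^sub>C f (Complex x y) - \<i> *\<^sub>C v) has_integral vline f x y0 y1 - (y1 - y0) *\<^sub>R (\<i> *\<^sub>C v)) {y0..y1}"
    by (intro has_integral_diff)
  then have "vline (\<lambda>w. f w - v) x y0 y1 = vline f x y0 y1 - (y1 - y0) *\<^sub>R (\<i> *\<^sub>C v)"
    unfolding vline_def by (simp add: scaleC.diff_right integral_unique)
  moreover have "norm (vline (\<lambda>w. f w - v) x y0 y1) \<le> B * (y1 - y0)"
    by (rule vline_norm_bound) (use y bd in \<open>auto intro!: continuous_intros cont\<close>)
  ultimately show ?thesis by (simp add: scaleR_scaleC scaleC_scaleC mult.commute)
qed

lemma hline_odd:
  assumes "\<And>x. f (Complex (-x) y) = - f (Complex x y)"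
  shows "hline f y (-L) L = 0"
proof -
  have "hline f y (-L) L = integral {-L..L} (\<lambda>x. f (Complex (-x) y))"
    unfolding hline_def using Henstock_Kurzweil_Integration.integral_reflect_real[of L "-L" "\<lambda>x. f (Complex x y)"] by simp
  also have "\<dots> = - hline f y (-L) L" by (simp add: assms hline_def)
  finally have "2 *\<^sub>R hline f y (-L) L = 0" by (metis add.right_inverse add_left_cancel scaleR_2)
  then show ?thesis by simp
qed

lemma continuous_on_vline:
  assumes "continuous_on {w. y0 \<le> Im w \<and> Im w \<le> y1} f"
  shows "continuous_on {y0..y1} (\<lambda>y. f (Complex x y))"
  by (rule continuous_on_compose2[OF assms]) (auto intro!: continuous_intros)

lemma continuous_on_hline:
  assumes "continuous_on {w. y0 \<le> Im w \<and> Im w \<le> y1} f" "y \<in> {y0..y1}"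
  shows "continuous_on X (\<lambda>x. f (Complex x y))"
  by (rule continuous_on_compose2[OF assms(1)]) (use assms(2) in \<open>auto intro!: continuous_intros\<close>)

section \<open>Integrals of exponentially decaying functions\<close>

lemma exp_tail_left:
  assumes "\<beta> > 0"
  shows "(\<lambda>x::real. exp (\<beta> * x)) integrable_on {..-L}" (is ?A)
    and "integral {..-L} (\<lambda>x. exp (\<beta> * x)) = exp (-\<beta> * L) / \<beta>" (is ?B)
proof -
  note hi = has_integral_exp_minus_to_infinity[OF assms, of L]
  have "(\<lambda>x. exp (-\<beta> * x)) absolutely_integrable_on {L..}"
    using hi by (intro nonnegative_absolutely_integrable_1) auto
  moreover have "integral {L..} (\<lambda>x. exp (-\<beta> * x)) = exp (-\<beta> * L) / \<beta>"
    using hi by (rule integral_unique)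
  moreover have "uminus ` {L..} \<subseteq> {..-L}" "uminus ` {..-L} \<subseteq> {L..}" by auto
  ultimately have *: "(\<lambda>x. exp (\<beta> * x)) absolutely_integrable_on {..-L} \<and> integral {..-L} (\<lambda>x. exp (\<beta> * x)) = exp (-\<beta> * L) / \<beta>"
    using has_absolute_integral_reflect_real[of "{L..}" "{..-L}" "\<lambda>x. exp (\<beta> * x)" "exp (-\<beta> * L) / \<beta>"]
    by simp
  from conjunct1[OF *] show ?A by (rule set_lebesgue_integral_eq_integral(1))
  from conjunct2[OF *] show ?B .
qed

lemma
  fixes f :: "real \<Rightarrow> 'a::banach"
  assumes cont: "continuous_on UNIV f" and \<beta>: "\<beta> > 0"
    and bd: "\<And>x. \<bar>x\<bar> \<ge> L \<Longrightarrow> norm (f x) \<le> C * exp (- \<beta> * \<bar>x\<bar>)" and L: "L \<ge> 0"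
  shows exp_decay_integrable: "f integrable_on UNIV"
    and exp_decay_tail: "norm (integral UNIV f - integral {-L..L} f) \<le> 2 * C * exp (- \<beta> * L) / \<beta>"
proof -
  have int: "f integrable_on {a..b}" for a b
    using cont by (intro integrable_continuous_interval) (auto intro: continuous_on_subset)
  have int': "(\<lambda>x. if x \<in> X then f x else 0) integrable_on cbox a b" if X: "X = {L..} \<or> X = {..-L}" for X a b
  proof -
    have "{a..b} \<inter> X = {max a L..b} \<or> {a..b} \<inter> X = {a..min b (-L)}" using X by auto
    then have "f integrable_on {a..b} \<inter> X" using int by metis
    then show ?thesis by (simp add: integrable_restrict_Int Int_commute)
  qed
  have tail: "f integrable_on X \<and> norm (integral X f) \<le> C * exp (- \<beta> * L) / \<beta>"
    if g: "g integrable_on X" "integral X g = exp (-\<beta> * L) / \<beta>"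
      and X: "X = {L..} \<or> X = {..-L}" and gx: "\<And>x. x \<in> X \<Longrightarrow> g x = exp (-\<beta> * \<bar>x\<bar>)" for X g
  proof -
    have Cg: "(\<lambda>x. C * g x) integrable_on X" using integrable_on_cmult_left[OF g(1)] by simp
    have nf: "norm (f x) \<le> C * g x" if "x \<in> X" for x
    proof -
      have "\<bar>x\<bar> \<ge> L" using that X by auto
      then show ?thesis using bd[of x] gx[OF that] by simp
    qed
    have "f integrable_on X"
      by (rule integrable_on_all_intervals_integrable_bound[OF int'[OF X] nf Cg])
    moreover have "norm (integral X f) \<le> integral X (\<lambda>x. C * g x)"
      by (rule integral_norm_bound_integral[OF calculation Cg nf])
    ultimately show ?thesis using g by simp
  qed
  have R: "f integrable_on {L..} \<and> norm (integral {L..} f) \<le> C * exp (- \<beta> * L) / \<beta>"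
  proof (rule tail)
    show "(\<lambda>x. exp (-\<beta> * x)) integrable_on {L..}" "integral {L..} (\<lambda>x. exp (-\<beta> * x)) = exp (-\<beta> * L) / \<beta>"
      using has_integral_exp_minus_to_infinity[OF \<beta>, of L] integral_unique by blast+
  qed (use L in auto)
  have Lf: "f integrable_on {..-L} \<and> norm (integral {..-L} f) \<le> C * exp (- \<beta> * L) / \<beta>"
  proof (rule tail)
    show "(\<lambda>x. exp (\<beta> * x)) integrable_on {..-L}" "integral {..-L} (\<lambda>x. exp (\<beta> * x)) = exp (-\<beta> * L) / \<beta>"
      using exp_tail_left[OF \<beta>, of L] by blast+
  qed (use L in auto)
  have "({..-L} \<inter> {-L..L}) \<subseteq> {L, -L}" "(({..-L} \<union> {-L..L}) \<inter> {L..}) \<subseteq> {L, -L}" using L by auto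
  then have n1: "negligible ({..-L} \<inter> {-L..L})" "negligible (({..-L} \<union> {-L..L}) \<inter> {L..})"
    by (auto intro: negligible_subset[of "{L, -L}"])
  have U: "UNIV = ({..-L} \<union> {-L..L}) \<union> {L..}" using L by auto
  have h1: "(f has_integral (integral {..-L} f + integral {-L..L} f)) ({..-L} \<union> {-L..L})"
    using has_integral_Un[OF integrable_integral integrable_integral n1(1)] Lf int by blast
  have H: "(f has_integral (integral {..-L} f + integral {-L..L} f + integral {L..} f)) UNIV"
    unfolding U using has_integral_Un[OF h1 integrable_integral n1(2)] R by blast
  then show "f integrable_on UNIV" by blast
  have "integral UNIV f - integral {-L..L} f = integral {..-L} f + integral {L..} f"
    using integral_unique[OF H] by simp
  then show "norm (integral UNIV f - integral {-L..L} f) \<le> 2 * C * exp (- \<beta> * L) / \<beta>"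
    using R Lf norm_triangle_ineq[of "integral {..-L} f" "integral {L..} f"] by simp
qed

lemma exp_decay_integral_bound:
  fixes f :: "real \<Rightarrow> 'a::banach"
  assumes cont: "continuous_on {-L..L} f" and \<beta>: "\<beta> > 0" and C: "C \<ge> 0"
    and bd: "\<And>x. \<bar>x\<bar> \<le> L \<Longrightarrow> norm (f x) \<le> C * exp (- \<beta> * \<bar>x\<bar>)" and L: "L \<ge> 0"
  shows "norm (integral {-L..L} f) \<le> 2 * C / \<beta>"
proof -
  have int: "f integrable_on {-L..L}"
    by (rule integrable_continuous_interval[OF cont])
  have ig: "(\<lambda>x. C * exp (- \<beta> * \<bar>x\<bar>)) integrable_on X" if "X = {-L..0} \<or> X = {0..L} \<or> X = {-L..L}" for X
    using that by (auto intro!: integrable_continuous_interval continuous_intros)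
  have "norm (integral {-L..L} f) \<le> integral {-L..L} (\<lambda>x. C * exp (- \<beta> * \<bar>x\<bar>))"
    by (rule integral_norm_bound_integral[OF int ig]) (use bd in auto)
  also have "\<dots> = integral {-L..0} (\<lambda>x. C * exp (- \<beta> * \<bar>x\<bar>)) + integral {0..L} (\<lambda>x. C * exp (- \<beta> * \<bar>x\<bar>))"
    using L by (intro Henstock_Kurzweil_Integration.integral_combine[symmetric] ig) auto
  also have "integral {-L..0} (\<lambda>x. C * exp (- \<beta> * \<bar>x\<bar>)) = integral {0..L} (\<lambda>x. C * exp (- \<beta> * \<bar>x\<bar>))"
    using Henstock_Kurzweil_Integration.integral_reflect_real[of L 0 "\<lambda>x. C * exp (- \<beta> * \<bar>x\<bar>)"] by simp
  also have "integral {0..L} (\<lambda>x. C * exp (- \<beta> * \<bar>x\<bar>)) \<le> C / \<beta>"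
  proof -
    have "((\<lambda>x. C * exp (- \<beta> * x)) has_integral (- C / \<beta> * exp (- \<beta> * L) - (- C / \<beta> * exp (- \<beta> * 0)))) {0..L}"
      using \<beta> by (intro fundamental_theorem_of_calculus L)
        (auto intro!: derivative_eq_intros simp: has_real_derivative_iff_has_vector_derivative[symmetric])
    then have "integral {0..L} (\<lambda>x. C * exp (- \<beta> * x)) = - C / \<beta> * exp (- \<beta> * L) - (- C / \<beta> * exp (- \<beta> * 0))"
      by (rule integral_unique)
    moreover have "integral {0..L} (\<lambda>x. C * exp (- \<beta> * x)) = integral {0..L} (\<lambda>x. C * exp (- \<beta> * \<bar>x\<bar>))"
      by (intro integral_cong) auto
    moreover have "0 \<le> C / \<beta> * exp (- \<beta> * L)" using C \<beta> by simp
    ultimately show ?thesis by simp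
  qed
  finally show ?thesis by simp
qed

text \<open>Contour identities are obtained with a truncation at \<open>\<plusminus>L\<close> that leaves an exponentially small
  remainder; this lemma removes it.\<close>
lemma eq_zero_if_exp_bound:
  fixes x :: "'a::real_normed_vector"
  assumes "\<And>L. L \<ge> 1 \<Longrightarrow> norm x \<le> C * exp (- \<beta> * L)" "\<beta> > 0"
  shows "x = 0"
proof -
  have "filterlim (\<lambda>L::real. \<beta> * L) at_top at_top"
    by (rule filterlim_tendsto_pos_mult_at_top[OF tendsto_const assms(2) filterlim_ident])
  then have "((\<lambda>L::real. exp (- (\<beta> * L))) \<longlongrightarrow> 0) at_top"
    by (intro filterlim_compose[OF exp_at_bot] filterlim_uminus_at_bot_at_top[THEN filterlim_compose])
  then have "((\<lambda>L::real. C * exp (- \<beta> * L)) \<longlongrightarrow> C * 0) at_top" by (intro tendsto_mult) simp_all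
  moreover have "eventually (\<lambda>L. norm x \<le> C * exp (- \<beta> * L)) at_top"
    using assms(1) by (auto simp: eventually_at_top_linorder)
  ultimately have "norm x \<le> C * 0" by (rule tendsto_lowerbound) simp
  then show ?thesis by simp
qed

text \<open>Move the line of integration to the edge of the strip on which the function is odd. For
  functions of \<open>z = cosh w\<close> that edge is a half line in the plane of \<open>z\<close>, run through back and forth, so this
  plays the role of closing the contour at infinity.\<close>
lemma contour_integral_zero_if_odd:
  fixes f :: "complex \<Rightarrow> 'a::complex_banach"
  assumes f: "vholo {w. y0 \<le> Im w \<and> Im w \<le> y1} f" and y: "y0 < y1" and \<beta>: "\<beta> > 0"
    and bd: "\<And>w. y0 \<le> Im w \<Longrightarrow> Im w \<le> y1 \<Longrightarrow> norm (f w) \<le> C * exp (- \<beta> * \<bar>Re w\<bar>)"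
    and odd: "\<And>x. f (Complex (-x) y1) = - f (Complex x y1)"
  shows "integral UNIV (\<lambda>x. f (Complex x y0)) = 0"
proof (rule eq_zero_if_exp_bound[OF _ \<beta>])
  fix L :: real assume L: "L \<ge> 1"
  note cont = vholo_continuous_on[OF f]
  have "vholo (rectangle (-L) L y0 y1) f" by (rule vholo_subset[OF f]) auto
  from cauchy_rectangle[OF this] L y hline_odd[of f y1 L, OF odd]
  have eq: "hline f y0 (-L) L = vline f (-L) y0 y1 - vline f L y0 y1" by (simp add: algebra_simps)
  have v: "norm (vline f x y0 y1) \<le> C * exp (- \<beta> * L) * (y1 - y0)" if "\<bar>x\<bar> = L" for x
    by (rule vline_norm_bound[OF continuous_on_vline[OF cont]]) (use y bd[of "Complex x _"] that in auto)
  have tail: "norm (integral UNIV (\<lambda>x. f (Complex x y0)) - hline f y0 (-L) L) \<le> 2 * C * exp (- \<beta> * L) / \<beta>"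
    unfolding hline_def
  proof (rule exp_decay_tail[OF _ \<beta>])
    show "norm (f (Complex x y0)) \<le> C * exp (- \<beta> * \<bar>x\<bar>)" for x using bd[of "Complex x y0"] y by simp
  qed (use y L continuous_on_hline[OF cont] in auto)
  have "norm (hline f y0 (-L) L) \<le> C * exp (- \<beta> * L) * (y1 - y0) + C * exp (- \<beta> * L) * (y1 - y0)"
    unfolding eq by (rule order_trans[OF norm_triangle_ineq4 add_mono[OF v v]]) (use L in auto)
  then have "norm (integral UNIV (\<lambda>x. f (Complex x y0)))
      \<le> 2 * C * exp (- \<beta> * L) / \<beta> + (C * exp (- \<beta> * L) * (y1 - y0) + C * exp (- \<beta> * L) * (y1 - y0))"
    using tail norm_triangle_sub[of "integral UNIV (\<lambda>x. f (Complex x y0))" "hline f y0 (-L) L"] by linarith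
  also have "\<dots> = (2 * C / \<beta> + 2 * C * (y1 - y0)) * exp (- \<beta> * L)" by (simp add: algebra_simps)
  finally show "norm (integral UNIV (\<lambda>x. f (Complex x y0))) \<le> (2 * C / \<beta> + 2 * C * (y1 - y0)) * exp (- \<beta> * L)" .
qed

section \<open>The trapezoidal rule on a strip\<close>

text \<open>The meromorphic function with period \<open>h\<close> whose only poles are the nodes \<open>k h\<close>, with residue
  \<open>- h / (2 \<pi> \<i>)\<close>. It is exponentially small above the real axis, and so is its sum with \<open>1\<close> below: the nodes
  turn the integral over the lower line into the trapezoidal sum up to exponentially small terms.\<close>
definition sinc_kernel :: "real \<Rightarrow> complex \<Rightarrow> complex" where
  "sinc_kernel h w = (let E = exp (2 * of_real pi * \<i> * w / of_real h) in E / (1 - E))"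

lemma sinc_kernel_periodic:
  assumes "h \<noteq> 0"
  shows "sinc_kernel h (w - of_real (of_int k * h)) = sinc_kernel h w"
proof -
  have *: "2 * of_real pi * \<i> * (w - of_real (of_int k * h)) / of_real h
      = 2 * of_real pi * \<i> * w / of_real h + of_int (-k) * (of_real (2 * pi) * \<i>)"
    using assms by (simp add: field_simps)
  have "exp (of_int (-k) * (of_real (2 * pi) * \<i>)) = 1"
    by (subst exp_eq_1) (auto intro!: exI[of _ "-k"])
  then show ?thesis unfolding sinc_kernel_def * exp_add by simp
qed

text \<open>Multiplication by \<open>u\<close> removes the pole at the origin, and no other node lies within \<open>|Re u| \<le> h / 2\<close>. Write the
  product as \<open>e\<^sup>v / g(v)\<close>, up to a constant, with the entire function \<open>g(v) = (e\<^sup>v - 1) / v\<close>.\<close>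
lemma sinc_kernel_removable:
  assumes h: "h > 0"
  shows "sholo {u. \<bar>Re u\<bar> \<le> h / 2} (\<lambda>u. if u = 0 then - of_real h / (2 * of_real pi * \<i>) else u * sinc_kernel h u)"
proof -
  define g where "g v = (if v = 0 then deriv exp 0 else (exp v - exp 0) / (v - 0))" for v :: complex
  define s where "s u = 2 * of_real pi * \<i> * u / of_real h" for u
  have s0: "s u = 0 \<longleftrightarrow> u = 0" for u using h by (auto simp: s_def)
  have g: "g holomorphic_on UNIV" unfolding g_def[abs_def]
    by (rule pole_lemma) (auto intro: holomorphic_intros)
  have s: "s holomorphic_on UNIV" unfolding s_def[abs_def] using h by (intro holomorphic_intros) auto
  have gs: "(\<lambda>u. g (s u)) holomorphic_on UNIV"
    using holomorphic_on_compose[OF s, of g] holomorphic_on_subset[OF g] by (simp add: o_def)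
  have deriv_exp: "deriv exp 0 = (1::complex)" by (rule DERIV_imp_deriv) (auto intro!: derivative_eq_intros)
  let ?U = "{u. g (s u) \<noteq> 0}"
  have U: "open ?U"
    using holomorphic_on_imp_continuous_on[OF gs] by (rule open_Collect_neq) auto
  have SU: "{u. \<bar>Re u\<bar> \<le> h / 2} \<subseteq> ?U"
  proof clarify
    fix u assume u: "\<bar>Re u\<bar> \<le> h / 2" and z: "g (s u) = 0"
    then have ne: "s u \<noteq> 0" and "exp (s u) = 1" by (auto simp: g_def deriv_exp split: if_splits)
    then obtain n :: int where n: "Re (s u) = 0" "Im (s u) = of_int (2 * n) * pi"
      unfolding exp_eq_1 by blast
    from n(2) have "Re u = of_int n * h" using h by (simp add: s_def field_simps)
    with u h have "\<bar>real_of_int n\<bar> * h \<le> 1 / 2 * h" by (simp add: abs_mult)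
    then have "\<bar>real_of_int n\<bar> \<le> 1 / 2" using h by (simp only: mult_le_cancel_right_pos)
    then have "n = 0" by linarith
    with n ne show False by (simp add: complex_eq_iff)
  qed
  have "(\<lambda>u. - of_real h / (2 * of_real pi * \<i>) * (exp (s u) / g (s u))) holomorphic_on ?U"
    by (intro holomorphic_intros holomorphic_on_subset[OF s] holomorphic_on_subset[OF gs]) auto
  then have "sholo {u. \<bar>Re u\<bar> \<le> h / 2} (\<lambda>u. - of_real h / (2 * of_real pi * \<i>) * (exp (s u) / g (s u)))"
    using U SU by (rule holomorphic_on_imp_sholo)
  moreover have "- of_real h / (2 * of_real pi * \<i>) * (exp (s u) / g (s u))
      = (if u = 0 then - of_real h / (2 * of_real pi * \<i>) else u * sinc_kernel h u)" for u
  proof (cases "u = 0")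
    case False
    then have "exp (s u) / g (s u) = exp (s u) * s u / (exp (s u) - 1)" using s0 by (simp add: g_def)
    also have "\<dots> = - s u * sinc_kernel h u"
    proof -
      have "a * b / (a - 1) = - b * (a / (1 - a))" for a b :: complex
        by (cases "a = 1") (auto simp: field_simps)
      then show ?thesis by (simp only: sinc_kernel_def s_def[symmetric] Let_def)
    qed
    finally show ?thesis using False h by (simp add: s_def)
  qed (simp add: s_def g_def deriv_exp)
  ultimately show ?thesis by simp
qed

lemma sinc_kernel_continuous_on:
  assumes "\<And>w. w \<in> S \<Longrightarrow> exp (2 * of_real pi * \<i> * w / of_real h) \<noteq> 1" "h \<noteq> 0"
  shows "continuous_on S (sinc_kernel h)"
  unfolding sinc_kernel_def[abs_def] Let_def using assms by (intro continuous_intros) auto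

lemma norm_sinc_exponential:
  "norm (exp (2 * of_real pi * \<i> * w / of_real h)) = exp (- 2 * pi * Im w / h)"
  by (simp add: norm_exp_eq_Re)

lemma sinc_kernel_upper:
  assumes "h > 0" "d > 0"
  shows "norm (sinc_kernel h (Complex x d)) \<le> exp (- 2 * pi * d / h) / (1 - exp (- 2 * pi * d / h))"
proof -
  define E where "E = exp (2 * of_real pi * \<i> * Complex x d / of_real h)"
  have n: "norm E = exp (- 2 * pi * d / h)" unfolding E_def by (subst norm_sinc_exponential) simp
  have lt: "exp (- 2 * pi * d / h) < 1" using assms by simp
  have "1 - norm E \<le> norm (1 - E)" using norm_triangle_ineq2[of 1 E] by simp
  then show ?thesis using lt n
    by (simp add: sinc_kernel_def E_def[symmetric] Let_def norm_divide divide_left_mono frac_le)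
qed

lemma sinc_kernel_lower:
  assumes "h > 0" "d > 0"
  shows "norm (1 + sinc_kernel h (Complex x (-d))) \<le> exp (- 2 * pi * d / h) / (1 - exp (- 2 * pi * d / h))"
proof -
  define E where "E = exp (2 * of_real pi * \<i> * Complex x (-d) / of_real h)"
  define q where "q = exp (- 2 * pi * d / h)"
  have n: "norm E = inverse q" unfolding E_def q_def by (subst norm_sinc_exponential) (simp add: exp_minus)
  have q: "0 < q" "q < 1" using assms by (auto simp: q_def)
  then have "inverse q > 1" by (simp add: one_less_inverse)
  then have "E \<noteq> 1" using n by auto
  then have "1 + E / (1 - E) = 1 / (1 - E)" by (simp add: field_simps)
  then have "1 + sinc_kernel h (Complex x (-d)) = 1 / (1 - E)"
    by (simp only: sinc_kernel_def E_def[symmetric] Let_def)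
  moreover have "inverse q - 1 \<le> norm (1 - E)" using norm_triangle_ineq2[of E 1] n by (simp add: norm_minus_commute)
  ultimately have "norm (1 + sinc_kernel h (Complex x (-d))) \<le> 1 / (inverse q - 1)"
    using \<open>inverse q > 1\<close> by (simp add: norm_divide frac_le)
  also have "1 / (inverse q - 1) = q / (1 - q)" using q by (simp add: field_simps)
  finally show ?thesis by (simp add: q_def)
qed

lemma sinc_exponential_half:
  assumes "h \<noteq> 0"
  shows "exp (2 * of_real pi * \<i> * Complex ((of_int j - 1 / 2) * h) y / of_real h) = - of_real (exp (- 2 * pi * y / h))"
proof -
  have "2 * of_real pi * \<i> * Complex ((of_int j - 1 / 2) * h) y / of_real h
      = of_real (- 2 * pi * y / h) + (of_int j * (of_real (2 * pi) * \<i>) - of_real pi * \<i>)"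
    using assms by (auto simp: complex_eq_iff field_simps)
  moreover have "exp (of_int j * (of_real (2 * pi) * \<i>)) = 1"
    by (subst exp_eq_1) auto
  ultimately show ?thesis
    by (simp only: exp_add exp_diff exp_of_real) (simp add: exp_pi_i mult.commute[of _ \<i>])
qed

text \<open>Half-way between two nodes the exponential is a negative real, so its distance from the pole value \<open>1\<close> exceeds
  its modulus.\<close>
lemma sinc_kernel_half:
  assumes "h \<noteq> 0"
  shows "norm (sinc_kernel h (Complex ((of_int j - 1 / 2) * h) y)) \<le> 1"
proof -
  define r where "r = exp (- 2 * pi * y / h)"
  have "r > 0" by (simp add: r_def)
  have "1 - - complex_of_real r = of_real (1 + r)" by simp
  then have "norm (1 - - complex_of_real r) = 1 + r" using \<open>r > 0\<close> by (metis abs_of_pos add_pos_pos norm_of_real zero_less_one)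
  then show ?thesis using \<open>r > 0\<close>
    unfolding sinc_kernel_def sinc_exponential_half[OF assms] Let_def r_def[symmetric]
    by (simp add: norm_divide)
qed


text \<open>The residue at one node: Cauchy's formula on the rectangle around it that reaches half-way to its
  neighbours. Since the sides of neighbouring rectangles coincide, they cancel when the cells are added.\<close>
lemma sinc_cell:
  fixes F :: "complex \<Rightarrow> 'a::complex_banach" and k :: int
  assumes F: "vholo {w. \<bar>Im w\<bar> \<le> d} F" and hd: "h > 0" "d > 0"
  defines "f \<equiv> \<lambda>w. sinc_kernel h w *\<^sub>C F w" and "l \<equiv> (of_int k - 1/2) * h" and "r \<equiv> (of_int (k + 1) - 1/2) * h"
  shows "hline f (-d) l r + vline f r (-d) d - hline f d l r - vline f l (-d) d
     = - (h *\<^sub>R F (of_real (of_int k * h)))"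
proof -
  define p where "p = complex_of_real (of_int k * h)"
  define m where "m u = (if u = 0 then - of_real h / (2 * of_real pi * \<i>) else u * sinc_kernel h u)" for u
  have eq: "Re p - h/2 = l" "Re p + h/2 = r" "Im p - d = -d" "Im p + d = d"
    by (auto simp: p_def l_def r_def field_simps)
  have hol: "vholo (rectangle l r (-d) d) (\<lambda>w. m (w - p) *\<^sub>C F w)"
  proof (rule vholo_scaleC)
    have "sholo (rectangle l r (-d) d) (\<lambda>w. w - p)"
      by (rule holomorphic_on_imp_sholo[of _ UNIV]) (auto intro!: holomorphic_intros)
    moreover have "(\<lambda>w. w - p) ` rectangle l r (-d) d \<subseteq> {u. \<bar>Re u\<bar> \<le> h / 2}"
    proof (rule image_subsetI)
      fix w assume "w \<in> rectangle l r (-d) d"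
      then have "Re p - h / 2 \<le> Re w" "Re w \<le> Re p + h / 2" by (simp_all add: eq)
      then have "\<bar>Re w - Re p\<bar> \<le> h / 2" by linarith
      then show "w - p \<in> {u. \<bar>Re u\<bar> \<le> h / 2}" by simp
    qed
    ultimately show "sholo (rectangle l r (-d) d) (\<lambda>w. m (w - p))"
      unfolding m_def by (rule sholo_compose[OF sinc_kernel_removable[OF hd(1)]])
    show "vholo (rectangle l r (-d) d) F" by (rule vholo_subset[OF F]) auto
  qed
  have val: "(1 / (w - p)) *\<^sub>C m (w - p) *\<^sub>C F w = f w" if "w \<noteq> p" for w
    using that sinc_kernel_periodic[of h w k] hd by (simp add: m_def scaleC_scaleC p_def f_def)
  have ne: "Complex x y \<noteq> p" if "x = l \<or> x = r \<or> y = d \<or> y = -d" for x y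
    using that hd by (auto simp: p_def l_def r_def complex_eq_iff algebra_simps)
  have "hline f (-d) l r + vline f r (-d) d - hline f d l r - vline f l (-d) d
      = (2 * of_real pi * \<i>) *\<^sub>C m (p - p) *\<^sub>C F p"
    using cauchy_formula_rectangle[of p "h/2" d "\<lambda>w. m (w - p) *\<^sub>C F w"] hol hd
    unfolding eq by (simp add: hline_def vline_def val ne)
  also have "\<dots> = - (h *\<^sub>R F p)"
    by (simp add: m_def scaleC_scaleC scaleR_scaleC scaleC.minus_left scaleC.minus_right)
  finally show ?thesis by (simp add: p_def)
qed

lemma sinc_cells:
  fixes F :: "complex \<Rightarrow> 'a::complex_banach" and k :: int
  assumes F: "vholo {w. \<bar>Im w\<bar> \<le> d} F" and hd: "h > 0" "d > 0"
  defines "f \<equiv> \<lambda>w. sinc_kernel h w *\<^sub>C F w" and "e \<equiv> \<lambda>n. (of_int (k + int n) - 1/2) * h"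
  shows "hline f (-d) (e 0) (e n) + vline f (e n) (-d) d - hline f d (e 0) (e n) - vline f (e 0) (-d) d
     = - (h *\<^sub>R (\<Sum>j<n. F (of_real (of_int (k + int j) * h))))"
proof (induction n)
  case 0
  then show ?case by (simp add: hline_def)
next
  case (Suc n)
  have cont: "continuous_on X (\<lambda>x. f (Complex x y))" if "y = d \<or> y = -d" for X y
  proof -
    have *: "exp (2 * of_real pi * \<i> * w / of_real h) \<noteq> 1" if "Im w = d \<or> Im w = -d" for w
      using norm_sinc_exponential[of w h] that hd by (metis divide_eq_0_iff exp_eq_one_iff less_irrefl
          mult_eq_0_iff neg_equal_0_iff_equal norm_one pi_neq_zero zero_neq_numeral)
    have "continuous_on {w. Im w = d \<or> Im w = -d} f"
      unfolding f_def using hd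
      by (intro continuous_intros sinc_kernel_continuous_on * continuous_on_subset[OF vholo_continuous_on[OF F]]) auto
    then show ?thesis
      by (rule continuous_on_compose2) (use that in \<open>auto intro!: continuous_intros\<close>)
  qed
  have le: "e 0 \<le> e n" "e n \<le> e (Suc n)" using hd by (auto simp: e_def intro!: mult_right_mono)
  have comb: "hline f y (e 0) (e (Suc n)) = hline f y (e 0) (e n) + hline f y (e n) (e (Suc n))" if "y = d \<or> y = -d" for y
    using hline_combine[OF cont[OF that] le] by simp
  have cell: "hline f (-d) (e n) (e (Suc n)) + vline f (e (Suc n)) (-d) d - hline f d (e n) (e (Suc n))
       - vline f (e n) (-d) d = - (h *\<^sub>R F (of_real (of_int (k + int n) * h)))"
    using sinc_cell[OF F hd, of "k + int n", folded f_def] by (simp add: e_def add.assoc add.commute)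
  have "hline f (-d) (e 0) (e (Suc n)) + vline f (e (Suc n)) (-d) d - hline f d (e 0) (e (Suc n)) - vline f (e 0) (-d) d
    = (hline f (-d) (e 0) (e n) + vline f (e n) (-d) d - hline f d (e 0) (e n) - vline f (e 0) (-d) d)
     + (hline f (-d) (e n) (e (Suc n)) + vline f (e (Suc n)) (-d) d - hline f d (e n) (e (Suc n))
       - vline f (e n) (-d) d)"
    by (simp add: comb)
  also have "\<dots> = - (h *\<^sub>R (\<Sum>j<n. F (of_real (of_int (k + int j) * h)))) - h *\<^sub>R F (of_real (of_int (k + int n) * h))"
    unfolding Suc.IH cell by simp
  finally show ?case by (simp add: scaleR_add_right)
qed

text \<open>The trapezoidal rule converges like \<open>exp (- 2 \<pi> d / h)\<close> on a strip of half-width \<open>d\<close>. Cells around the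
  nodes \<open>-N, \<dots>, N\<close> fill the rectangle up to \<open>L = (N + 1/2) h\<close>, so truncating the sum costs only the tails of the
  integral and the two vertical sides at \<open>\<plusminus>L\<close>; there the bound with the constant \<open>C'\<close> is used, which may be
  much smaller than the global \<open>C\<close>.\<close>
theorem sinc_quadrature_error:
  fixes F :: "complex \<Rightarrow> 'a::complex_banach"
  assumes F: "vholo {w. \<bar>Im w\<bar> \<le> d} F" and pos: "h > 0" "d > 0" "\<beta> > 0"
    and bd: "\<And>w. \<bar>Im w\<bar> \<le> d \<Longrightarrow> norm (F w) \<le> C * exp (- \<beta> * \<bar>Re w\<bar>)"
    and L: "L = (real N + 1/2) * h"
    and bd': "\<And>w. \<bar>Im w\<bar> \<le> d \<Longrightarrow> \<bar>Re w\<bar> \<ge> L \<Longrightarrow> norm (F w) \<le> C' * exp (- \<beta> * \<bar>Re w\<bar>)"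
  defines "q \<equiv> exp (- 2 * pi * d / h)"
  shows "norm (integral UNIV (\<lambda>x. F (of_real x)) - h *\<^sub>R (\<Sum>k\<in>{- int N..int N}. F (of_real (of_int k * h))))
     \<le> 4 * C / \<beta> * (q / (1 - q)) + (2 / \<beta> + 6 * d) * C' * exp (- \<beta> * L)"
proof -
  define f where "f w = sinc_kernel h w *\<^sub>C F w" for w
  define g where "g w = (1 + sinc_kernel h w) *\<^sub>C F w" for w
  have L0: "L > 0" using L pos by simp
  have qlt: "0 < q" "q < 1" using pos by (auto simp: q_def)
  have C: "C \<ge> 0" using order_trans[OF norm_ge_zero bd[of 0]] pos by simp
  have "0 \<le> C' * exp (- \<beta> * \<bar>L\<bar>)"
    using order_trans[OF norm_ge_zero bd'[of "of_real L"]] pos L0 by simp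
  then have C': "C' \<ge> 0" by (simp add: zero_le_mult_iff)
  have cF: "continuous_on X (\<lambda>x. F (Complex (a x) (b x)))"
    if "continuous_on X a" "continuous_on X b" "\<And>x. x \<in> X \<Longrightarrow> \<bar>b x\<bar> \<le> d" for X :: "real set" and a b
    by (rule continuous_on_compose2[OF vholo_continuous_on[OF F]])
      (use that in \<open>auto intro!: continuous_intros\<close>)
  have E1: "exp (2 * of_real pi * \<i> * w / of_real h) \<noteq> 1" if "Im w = d \<or> Im w = -d" for w
    using norm_sinc_exponential[of w h] that pos by (metis divide_eq_0_iff exp_eq_one_iff less_irrefl
        mult_eq_0_iff neg_equal_0_iff_equal norm_one pi_neq_zero zero_neq_numeral)
  have csh: "continuous_on X (\<lambda>x. sinc_kernel h (Complex x y))" if "y = d \<or> y = -d" for X y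
    by (rule continuous_on_compose2[of "{w. Im w = d \<or> Im w = -d}" "sinc_kernel h"])
      (use that pos E1 in \<open>auto intro!: continuous_intros sinc_kernel_continuous_on\<close>)
  have csv: "continuous_on X (\<lambda>y. sinc_kernel h (Complex ((of_int j - 1/2) * h) y))" for X j
  proof (rule continuous_on_compose2[of "{w. Re w = (of_int j - 1/2) * h}" "sinc_kernel h"])
    have "exp (2 * of_real pi * \<i> * w / of_real h) \<noteq> 1" if "Re w = (of_int j - 1/2) * h" for w
    proof -
      have w: "w = Complex ((of_int j - 1/2) * h) (Im w)" using that by (simp add: complex_eq_iff)
      have "exp (2 * of_real pi * \<i> * w / of_real h) = of_real (- exp (- 2 * pi * Im w / h))"
        using sinc_exponential_half[of h j "Im w"] pos w by simp
      moreover have "- exp (- 2 * pi * Im w / h) \<noteq> 1" using exp_gt_zero[of "- 2 * pi * Im w / h"] by linarith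
      ultimately show ?thesis by (simp only: of_real_eq_1_iff simp_thms)
    qed
    then show "continuous_on {w. Re w = (of_int j - 1/2) * h} (sinc_kernel h)"
      using pos by (intro sinc_kernel_continuous_on) auto
  qed (auto intro!: continuous_intros)
  have Lj: "L = (of_int (int N + 1) - 1/2) * h" "- L = (of_int (- int N) - 1/2) * h"
    using L by (auto simp: algebra_simps)
  have sum_eq: "(\<Sum>j<2*N+1. F (of_real (of_int (- int N + int j) * h))) = (\<Sum>k\<in>{- int N..int N}. F (of_real (of_int k * h)))"
    by (rule sum.reindex_bij_witness[of _ "\<lambda>k. nat (k + int N)" "\<lambda>j. - int N + int j"]) auto
  have "hline f (-d) (-L) L + vline f L (-d) d - hline f d (-L) L - vline f (-L) (-d) d
     = - (h *\<^sub>R (\<Sum>k\<in>{- int N..int N}. F (of_real (of_int k * h))))"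
    using sinc_cells[OF F pos(1,2), of "- int N" "2 * N + 1", folded f_def, unfolded sum_eq]
    by (simp add: Lj algebra_simps)
  then have S: "h *\<^sub>R (\<Sum>k\<in>{- int N..int N}. F (of_real (of_int k * h)))
     = hline f d (-L) L - hline f (-d) (-L) L - vline f L (-d) d + vline f (-L) (-d) d"
    by (simp add: algebra_simps)
  have fg: "hline f (-d) (-L) L = hline g (-d) (-L) L - hline F (-d) (-L) L"
    unfolding hline_def f_def g_def
    by (subst Henstock_Kurzweil_Integration.integral_diff[symmetric])
      (use pos in \<open>auto simp: scaleC.add_left scaleC_one intro!: integrable_continuous_interval continuous_intros csh cF\<close>)
  have shift: "hline F (-d) (-L) L = hline F 0 (-L) L - vline F L (-d) 0 + vline F (-L) (-d) 0"
  proof -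
    have "vholo (rectangle (-L) L (-d) 0) F" by (rule vholo_subset[OF F]) auto
    from cauchy_rectangle[OF this] show ?thesis using L0 pos by (simp add: algebra_simps)
  qed
  have decay: "norm (sinc_kernel h (Complex x d)) * norm (F (Complex x d)) \<le> q / (1 - q) * C * exp (- \<beta> * \<bar>x\<bar>)"
    "norm (1 + sinc_kernel h (Complex x (-d))) * norm (F (Complex x (-d))) \<le> q / (1 - q) * C * exp (- \<beta> * \<bar>x\<bar>)" for x
    using mult_mono[OF sinc_kernel_upper[OF pos(1,2), of x] bd[of "Complex x d"]]
      mult_mono[OF sinc_kernel_lower[OF pos(1,2), of x] bd[of "Complex x (-d)"]] pos qlt
    by (simp_all add: q_def mult.assoc)
  have h1: "norm (hline f d (-L) L) \<le> 2 * (q / (1 - q) * C) / \<beta>"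
    unfolding hline_def f_def
    by (rule exp_decay_integral_bound)
      (use pos C qlt L0 decay in \<open>auto simp: norm_scaleC intro!: continuous_intros csh cF\<close>)
  have h2: "norm (hline g (-d) (-L) L) \<le> 2 * (q / (1 - q) * C) / \<beta>"
    unfolding hline_def g_def
    by (rule exp_decay_integral_bound)
      (use pos C qlt L0 decay in \<open>auto simp: norm_scaleC intro!: continuous_intros csh cF\<close>)
  have tail: "norm (integral UNIV (\<lambda>x. F (of_real x)) - hline F 0 (-L) L) \<le> 2 * C' * exp (- \<beta> * L) / \<beta>"
    unfolding hline_def complex_of_real_def
  proof (rule exp_decay_tail)
    show "norm (F (Complex x 0)) \<le> C' * exp (- \<beta> * \<bar>x\<bar>)" if "\<bar>x\<bar> \<ge> L" for x
      using bd'[of "Complex x 0"] that pos by simp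
  qed (use pos L0 in \<open>auto intro!: continuous_intros cF\<close>)
  have vF: "norm (vline F x (-d) 0) \<le> C' * exp (- \<beta> * L) * (0 - -d)" if x: "\<bar>x\<bar> = L" for x
  proof (rule vline_norm_bound)
    show "continuous_on {-d..0} (\<lambda>y. F (Complex x y))" by (intro continuous_intros cF) auto
    show "norm (F (Complex x y)) \<le> C' * exp (- \<beta> * L)" if "y \<in> {-d..0}" for y
      using bd'[of "Complex x y"] that pos x by simp
  qed (use pos in simp)
  have vf: "norm (vline f x (-d) d) \<le> C' * exp (- \<beta> * L) * (d - -d)"
    if x: "x = (of_int j - 1/2) * h" "\<bar>x\<bar> = L" for x j
  proof (rule vline_norm_bound)
    show "continuous_on {-d..d} (\<lambda>y. f (Complex x y))" unfolding f_def x
      by (intro continuous_intros csv cF) auto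
    show "norm (f (Complex x y)) \<le> C' * exp (- \<beta> * L)" if "y \<in> {-d..d}" for y
      using mult_mono[OF sinc_kernel_half[of h j y] bd'[of "Complex x y"]] that pos x(2) C'
      unfolding x(1)[symmetric] by (simp add: f_def norm_scaleC abs_le_iff)
  qed (use pos in simp)
  have "integral UNIV (\<lambda>x. F (of_real x)) - h *\<^sub>R (\<Sum>k\<in>{- int N..int N}. F (of_real (of_int k * h)))
    = (integral UNIV (\<lambda>x. F (of_real x)) - hline F 0 (-L) L) - hline f d (-L) L + hline g (-d) (-L) L
      + vline F L (-d) 0 - vline F (-L) (-d) 0 + vline f L (-d) d - vline f (-L) (-d) d"
    unfolding S fg shift by simp
  also have "norm \<dots> \<le> 2 * C' * exp (- \<beta> * L) / \<beta> + 2 * (q / (1 - q) * C) / \<beta> + 2 * (q / (1 - q) * C) / \<beta>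
      + C' * exp (- \<beta> * L) * (0 - -d) + C' * exp (- \<beta> * L) * (0 - -d) + C' * exp (- \<beta> * L) * (d - -d) + C' * exp (- \<beta> * L) * (d - -d)"
  proof -
    have tri: "norm (a - b + c + u - v + x - y) \<le> norm a + norm b + norm c + norm u + norm v + norm x + norm y"
      for a b c u v x y :: 'a
      by (smt (verit) norm_triangle_ineq norm_triangle_ineq4)
    show ?thesis
      using tri[of "integral UNIV (\<lambda>x. F (of_real x)) - hline F 0 (-L) L" "hline f d (-L) L" "hline g (-d) (-L) L"
          "vline F L (-d) 0" "vline F (-L) (-d) 0" "vline f L (-d) d" "vline f (-L) (-d) d"]
        tail h1 h2 vF[of L] vF[of "-L"] vf[OF Lj(1)] vf[OF Lj(2)] L0 by linarith
  qed
  also have "\<dots> = 4 * C / \<beta> * (q / (1 - q)) + (2 / \<beta> + 6 * d) * C' * exp (- \<beta> * L)"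
    by (simp add: algebra_simps add_divide_distrib)
  finally show ?thesis .
qed

section \<open>Resolvents of a sectorial operator\<close>

text \<open>The region \<open>tan \<phi> (Re z - \<rho>\<^sub>0) \<le> |Im z|\<close> is the closed complement of the open sector; it contains the
  vertex \<open>\<rho>\<^sub>0\<close>.\<close>
locale sectorial_operator =
  fixes D :: "'a::complex_banach set" and A :: "'a \<Rightarrow> 'a" and \<rho>\<^sub>0 \<phi> M :: real
  assumes lin: "linear_operator D A" and \<rho>\<^sub>0: "0 < \<rho>\<^sub>0" and \<phi>: "0 < \<phi>" "\<phi> < pi / 2" and M: "0 < M"
    and resolvent_region: "tan \<phi> * (Re z - \<rho>\<^sub>0) \<le> \<bar>Im z\<bar> \<Longrightarrow> z \<in> resolvent_set D A"
    and resolvent_bound: "tan \<phi> * (Re z - \<rho>\<^sub>0) \<le> \<bar>Im z\<bar> \<Longrightarrow>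
           norm (resolvent D A z x) \<le> M / (1 + cmod z) * norm x"
begin

definition \<Omega> :: "complex set" where "\<Omega> = {z. tan \<phi> * (Re z - \<rho>\<^sub>0) \<le> \<bar>Im z\<bar>}"

abbreviation R :: "complex \<Rightarrow> 'a \<Rightarrow> 'a" where "R \<equiv> resolvent D A"

lemma tan_pos: "tan \<phi> > 0" using \<phi> by (rule tan_gt_zero)

lemma left_half_plane_subset: "Re z \<le> \<rho>\<^sub>0 \<Longrightarrow> z \<in> \<Omega>"
  unfolding \<Omega>_def using tan_pos by (simp add: order_trans[OF mult_nonneg_nonpos])

lemma zero_in_\<Omega>: "0 \<in> \<Omega>" using \<rho>\<^sub>0 by (intro left_half_plane_subset) auto

lemma A_zero: "A 0 = 0"
  using lin scaleC.zero_left[of "A 0"] unfolding linear_operator_def by (metis scaleC.zero_left)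

lemma R_bij: "z \<in> \<Omega> \<Longrightarrow> bij_betw (\<lambda>x. z *\<^sub>C x - A x) D UNIV"
  using resolvent_region[of z] by (auto simp: \<Omega>_def resolvent_set_def)

lemma R_in_D: "z \<in> \<Omega> \<Longrightarrow> R z x \<in> D"
  using R_bij[of z] unfolding resolvent_def by (simp add: bij_betw_def inv_into_into)

lemma R_right: "z \<in> \<Omega> \<Longrightarrow> z *\<^sub>C R z x - A (R z x) = x"
  using R_bij[of z] unfolding resolvent_def bij_betw_def
  by (metis (mono_tags, lifting) UNIV_I f_inv_into_f)

lemma R_left: "z \<in> \<Omega> \<Longrightarrow> x \<in> D \<Longrightarrow> R z (z *\<^sub>C x - A x) = x"
  using R_bij[of z] unfolding resolvent_def bij_betw_def
  by (metis (mono_tags, lifting) inv_into_f_f)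

lemma R_bounded_clinear: "z \<in> \<Omega> \<Longrightarrow> bounded_clinear (R z)"
  using resolvent_region[of z] by (simp add: \<Omega>_def resolvent_set_def)

lemma R_bounded_linear: "z \<in> \<Omega> \<Longrightarrow> bounded_linear (R z)"
  using R_bounded_clinear by (simp add: bounded_clinear_def)

lemma R_scaleC: "z \<in> \<Omega> \<Longrightarrow> R z (c *\<^sub>C x) = c *\<^sub>C R z x"
  using R_bounded_clinear by (simp add: bounded_clinear_def)


lemma R_bound: "z \<in> \<Omega> \<Longrightarrow> norm (R z x) \<le> M / (1 + cmod z) * norm x"
  using resolvent_bound by (simp add: \<Omega>_def)

lemma R_bound': assumes "z \<in> \<Omega>" shows "norm (R z x) \<le> M * norm x"
proof -
  have "M / (1 + cmod z) \<le> M / 1" using M by (intro divide_left_mono) (auto intro: add_pos_nonneg)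
  then have "M / (1 + cmod z) \<le> M" by simp
  then show ?thesis using R_bound[OF assms, of x] by (meson mult_right_mono norm_ge_zero order_trans)
qed

lemma norm_scaleC_R: assumes "z \<in> \<Omega>" shows "norm (z *\<^sub>C R z x) \<le> M * norm x"
proof -
  have "cmod z * norm (R z x) \<le> cmod z * (M / (1 + cmod z) * norm x)"
    by (intro mult_left_mono R_bound assms) auto
  also have "\<dots> = (cmod z / (1 + cmod z)) * (M * norm x)" by simp
  also have "\<dots> \<le> 1 * (M * norm x)"
    using M norm_ge_zero[of z] by (intro mult_right_mono divide_le_eq_1_pos[THEN iffD2]) (linarith, linarith, simp)
  finally show ?thesis by (simp add: norm_scaleC)
qed

lemma R_inj: "z \<in> \<Omega> \<Longrightarrow> R z x = 0 \<Longrightarrow> x = 0"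
  using R_right[of z x] by (simp add: A_zero scaleC.zero_right)

lemma resolvent_identity:
  assumes "z \<in> \<Omega>" "w \<in> \<Omega>"
  shows "R z x - R w x = (w - z) *\<^sub>C R z (R w x)"
proof -
  let ?y = "R w x"
  have "x = (z *\<^sub>C ?y - A ?y) + (w - z) *\<^sub>C ?y"
    using R_right[OF assms(2), of x] by (simp add: scaleC.diff_left)
  then have "R z x = R z ((z *\<^sub>C ?y - A ?y) + (w - z) *\<^sub>C ?y)" by simp
  also have "\<dots> = ?y + (w - z) *\<^sub>C R z ?y"
    by (simp add: linear_simps(1)[OF R_bounded_linear[OF assms(1)]] R_left R_scaleC assms R_in_D)
  finally show ?thesis by simp
qed

lemma R_commute:
  assumes "z \<in> \<Omega>" "w \<in> \<Omega>"
  shows "R z (R w x) = R w (R z x)"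
proof (cases "z = w")
  case False
  have "(w - z) *\<^sub>C R z (R w x) = (w - z) *\<^sub>C R w (R z x)"
    using resolvent_identity[OF assms, of x] resolvent_identity[OF assms(2,1), of x]
    by (metis minus_diff_eq scaleC.minus_left)
  then have "(1 / (w - z)) *\<^sub>C (w - z) *\<^sub>C R z (R w x) = (1 / (w - z)) *\<^sub>C (w - z) *\<^sub>C R w (R z x)" by simp
  then show ?thesis using False by (simp add: scaleC_scaleC scaleC_one)
qed simp

lemma R_Lipschitz:
  assumes "z \<in> \<Omega>" "w \<in> \<Omega>"
  shows "norm (R z x - R w x) \<le> M\<^sup>2 * norm x * cmod (z - w)"
proof -
  have "norm (R z (R w x)) \<le> M * (M * norm x)"
    using R_bound'[OF assms(1), of "R w x"] R_bound'[OF assms(2), of x] M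
    by (meson mult_left_mono less_imp_le order_trans)
  then have "cmod (w - z) * norm (R z (R w x)) \<le> cmod (w - z) * (M * (M * norm x))"
    by (rule mult_left_mono) simp
  then show ?thesis unfolding resolvent_identity[OF assms] norm_scaleC
    by (simp add: power2_eq_square norm_minus_commute mult_ac)
qed

text \<open>By the resolvent identity the derivative is \<open>- R(z)\<^sup>2\<close>, with a quadratic remainder; the uniform
  bound on the resolvent makes this work at the boundary points of \<open>\<Omega>\<close> too.\<close>
lemma vholo_R: "vholo \<Omega> (\<lambda>z. R z x)"
  unfolding vholo_def
proof (intro exI[of _ "\<lambda>z. - R z (R z x)"] conjI ballI)
  have "(2 * M ^ 3 * norm x)-lipschitz_on \<Omega> (\<lambda>z. - R z (R z x))"
  proof (rule lipschitz_onI)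
    fix z w assume zw: "z \<in> \<Omega>" "w \<in> \<Omega>"
    have "R z (R z x) - R w (R w x) = R z (R z x - R w x) + (R z (R w x) - R w (R w x))"
      by (simp add: linear_simps(2)[OF R_bounded_linear[OF zw(1)]])
    then have "norm (R z (R z x) - R w (R w x)) \<le> norm (R z (R z x - R w x)) + norm (R z (R w x) - R w (R w x))"
      using norm_triangle_ineq by metis
    also have "norm (R z (R z x - R w x)) \<le> M * (M\<^sup>2 * norm x * cmod (z - w))"
      using R_bound'[OF zw(1), of "R z x - R w x"] mult_left_mono[OF R_Lipschitz[OF zw, of x], of M] M by linarith
    also have "norm (R z (R w x) - R w (R w x)) \<le> M\<^sup>2 * (M * norm x) * cmod (z - w)"
      using R_Lipschitz[OF zw, of "R w x"] R_bound'[OF zw(2), of x]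
      by (meson mult_left_mono mult_right_mono norm_ge_zero order_trans zero_le_power2)
    finally show "dist (- R z (R z x)) (- R w (R w x)) \<le> 2 * M ^ 3 * norm x * dist z w"
      by (simp add: dist_norm norm_minus_commute power2_eq_square power3_eq_cube algebra_simps)
  qed (use M in auto)
  then show "continuous_on \<Omega> (\<lambda>z. - R z (R z x))" by (rule lipschitz_on_continuous_on)
  fix z assume z: "z \<in> \<Omega>"
  show "((\<lambda>z. R z x) has_derivative (\<lambda>h. h *\<^sub>C - R z (R z x))) (at z within \<Omega>)"
  proof (rule has_derivativeI_sandwich[where e=1 and H="\<lambda>w. M ^ 3 * norm x * cmod (w - z)"])
    show "bounded_linear (\<lambda>h. h *\<^sub>C - R z (R z x))" by (rule scaleC.bounded_linear_left)
    fix w assume w: "w \<in> \<Omega>" "w \<noteq> z"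
    have "R w x - R z x - (w - z) *\<^sub>C - R z (R z x) = (z - w) *\<^sub>C (R w (R z x) - R z (R z x))"
    proof -
      have "R w x - R z x = (z - w) *\<^sub>C R w (R z x)" by (rule resolvent_identity[OF w(1) z])
      moreover have "(w - z) *\<^sub>C - R z (R z x) = (z - w) *\<^sub>C R z (R z x)"
        by (simp add: scaleC.diff_left scaleC.minus_right)
      ultimately show ?thesis by (simp only: scaleC.diff_right)
    qed
    then have "norm (R w x - R z x - (w - z) *\<^sub>C - R z (R z x)) = cmod (w - z) * norm (R w (R z x) - R z (R z x))"
      by (simp add: norm_scaleC norm_minus_commute)
    then have "norm (R w x - R z x - (w - z) *\<^sub>C - R z (R z x)) / norm (w - z) = norm (R w (R z x) - R z (R z x))"
      using w by simp
    also have "\<dots> \<le> M\<^sup>2 * (M * norm x) * cmod (w - z)"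
      using R_Lipschitz[OF w(1) z, of "R z x"] R_bound'[OF z, of x]
      by (meson mult_left_mono mult_right_mono norm_ge_zero order_trans zero_le_power2)
    finally show "norm (R w x - R z x - (w - z) *\<^sub>C - R z (R z x)) / norm (w - z) \<le> M ^ 3 * norm x * cmod (w - z)"
      by (simp add: power2_eq_square power3_eq_cube mult.assoc)
  next
    have "((\<lambda>w. M ^ 3 * norm x * cmod (w - z)) \<longlongrightarrow> M ^ 3 * norm x * cmod (z - z)) (at z within \<Omega>)"
      by (intro tendsto_intros)
    then show "((\<lambda>w. M ^ 3 * norm x * cmod (w - z)) \<longlongrightarrow> 0) (at z within \<Omega>)" by simp
  qed simp
qed

text \<open>Subtracting \<open>1/z\<close> gains one power of \<open>z\<close> on the domain of \<open>A\<close>, which makes the contour integrals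
  converge absolutely.\<close>
lemma R_minus_inverse_on_D:
  assumes "z \<in> \<Omega>" "z \<noteq> 0" "x \<in> D"
  shows "R z x - (1 / z) *\<^sub>C x = (1 / z) *\<^sub>C R z (A x)"
proof -
  have "x = R z (z *\<^sub>C x - A x)" using R_left assms by simp
  also have "\<dots> = z *\<^sub>C R z x - R z (A x)"
    using assms by (simp add: linear_simps(2)[OF R_bounded_linear] R_scaleC)
  finally have "(1 / z) *\<^sub>C x = (1 / z) *\<^sub>C (z *\<^sub>C R z x - R z (A x))" by simp
  also have "\<dots> = R z x - (1 / z) *\<^sub>C R z (A x)"
    using assms by (simp add: scaleC.diff_right scaleC_scaleC scaleC_one)
  finally show ?thesis by simp
qed

lemma R_minus_inverse_decay_on_D:
  assumes "z \<in> \<Omega>" "z \<noteq> 0" "x \<in> D"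
  shows "norm (R z x - (1 / z) *\<^sub>C x) \<le> M * norm (A x) / (cmod z)\<^sup>2"
proof -
  have "norm (R z x - (1 / z) *\<^sub>C x) = norm (z *\<^sub>C R z (A x)) / (cmod z)\<^sup>2"
    unfolding R_minus_inverse_on_D[OF assms] using assms(2)
    by (simp add: norm_scaleC norm_divide power2_eq_square)
  also have "\<dots> \<le> M * norm (A x) / (cmod z)\<^sup>2"
    by (intro divide_right_mono norm_scaleC_R assms) auto
  finally show ?thesis .
qed

lemma neg_real_in_\<Omega>: "s \<ge> 0 \<Longrightarrow> of_real (- s) \<in> \<Omega>"
  using \<rho>\<^sub>0 by (intro left_half_plane_subset) auto

text \<open>The resolvent identity turns \<open>A R(z) R(-s) v\<close> into \<open>(- s R(-s) v - z R(z) v) / (z + s)\<close>, whose numerator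
  is bounded, and \<open>|z + s| \<ge> max |z| s\<close> in the right half plane.\<close>
lemma R_minus_inverse_of_R:
  assumes z: "z \<in> \<Omega>" "z \<noteq> 0" "Re z \<ge> 0" and s: "s > 0"
  shows "norm (R z (R (of_real (- s)) v) - (1 / z) *\<^sub>C R (of_real (- s)) v)
    \<le> 2 * M * norm v / cmod z * (1 / max (cmod z) s)"
proof -
  define w where "w = complex_of_real (- s)"
  have w: "w \<in> \<Omega>" unfolding w_def using s by (intro neg_real_in_\<Omega>) simp
  have le: "max (cmod z) s \<le> cmod (z + of_real s)"
  proof -
    have "(Re z)\<^sup>2 \<le> (Re z + s)\<^sup>2" using z s by (intro power_mono) auto
    then have "cmod z \<le> cmod (z + of_real s)" by (simp add: cmod_def)
    moreover have "s \<le> cmod (z + of_real s)" using complex_Re_le_cmod[of "z + of_real s"] z by simp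
    ultimately show ?thesis by simp
  qed
  have mx: "max (cmod z) s > 0" using s by simp
  then have ne: "z + of_real s \<noteq> 0" using le by auto
  have RR: "(z + of_real s) *\<^sub>C R z (R w v) = R w v - R z v"
    using resolvent_identity[OF z(1) w, of v] by (simp add: w_def scaleC.add_left scaleC.diff_left
        scaleC.minus_left algebra_simps)
  have "(z + of_real s) *\<^sub>C R z (A (R w v)) = - (of_real s *\<^sub>C R w v) - z *\<^sub>C R z v"
  proof -
    have "A (R w v) = w *\<^sub>C R w v - v" using R_right[OF w, of v] by (simp add: algebra_simps)
    then have "R z (A (R w v)) = w *\<^sub>C R z (R w v) - R z v"
      by (simp add: linear_simps(2)[OF R_bounded_linear[OF z(1)]] R_scaleC z)
    then have "(z + of_real s) *\<^sub>C R z (A (R w v)) = w *\<^sub>C ((z + of_real s) *\<^sub>C R z (R w v)) - (z + of_real s) *\<^sub>C R z v"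
      by (simp add: scaleC.diff_right scaleC_scaleC mult.commute)
    then show ?thesis unfolding RR
      by (simp add: w_def scaleC.diff_right scaleC.add_left scaleC.minus_left)
  qed
  then have "cmod (z + of_real s) * norm (R z (A (R w v))) = norm (w *\<^sub>C R w v - z *\<^sub>C R z v)"
    by (metis (no_types) norm_scaleC of_real_minus scaleC.minus_left w_def)
  also have "\<dots> \<le> M * norm v + M * norm v"
    by (rule order_trans[OF norm_triangle_ineq4 add_mono[OF norm_scaleC_R[OF w] norm_scaleC_R[OF z(1)]]])
  finally have "norm (R z (A (R w v))) \<le> 2 * M * norm v / cmod (z + of_real s)"
    using ne by (simp add: field_simps)
  also have "\<dots> \<le> 2 * M * norm v / max (cmod z) s"
    using le mx M less_le_trans[OF mx le] by (intro divide_left_mono) (auto intro!: mult_pos_pos)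
  finally have "norm (R z (A (R w v))) / cmod z \<le> 2 * M * norm v / max (cmod z) s / cmod z"
    by (rule divide_right_mono) simp
  moreover have "norm (R z (R w v) - (1 / z) *\<^sub>C R w v) = norm (R z (A (R w v))) / cmod z"
    by (simp add: R_minus_inverse_on_D[OF z(1,2) R_in_D[OF w]] norm_scaleC norm_divide)
  ultimately show ?thesis unfolding w_def by (simp add: mult_ac)
qed

end

text \<open>The only point of the sector that satisfies the defining inequality of the region is the vertex, where the
  resolvent estimate is available because the vertex is a frontier point.\<close>
lemma strongly_positive_imp_sectorial:
  assumes "strongly_positive D A \<rho>\<^sub>0 \<phi>"
  obtains M where "sectorial_operator D A \<rho>\<^sub>0 \<phi> M"
proof -
  from assms obtain M where cd: "closed_densely_defined D A" and pos: "0 < \<rho>\<^sub>0" "0 < \<phi>" "\<phi> < pi / 2" and M: "M > 0"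
    and res: "\<And>z. z \<in> - sector \<rho>\<^sub>0 \<phi> \<union> frontier (sector \<rho>\<^sub>0 \<phi>) \<Longrightarrow>
        z \<in> resolvent_set D A \<and> onorm (resolvent D A z) \<le> M / (1 + cmod z)"
    unfolding strongly_positive_def by blast
  have cos: "cos \<phi> > 0" using pos by (intro cos_gt_zero_pi) auto
  have sin: "sin \<phi> > 0" using pos by (intro sin_gt_zero) auto
  have outside: "r = 0" if le: "tan \<phi> * (r * cos \<theta>) \<le> \<bar>r * sin \<theta>\<bar>" and r: "0 \<le> r" "\<bar>\<theta>\<bar> < \<phi>" for r \<theta>
  proof (rule ccontr)
    assume "r \<noteq> 0"
    then have rp: "r > 0" using r by simp
    have c: "cos \<theta> > 0" using r pos by (intro cos_gt_zero_pi) auto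
    have "r * (tan \<phi> * cos \<theta>) \<le> r * \<bar>sin \<theta>\<bar>" using le rp by (simp add: abs_mult mult_ac)
    then have "tan \<phi> * cos \<theta> \<le> \<bar>sin \<theta>\<bar>" using rp by simp
    then have "sin \<phi> * cos \<theta> \<le> cos \<phi> * \<bar>sin \<theta>\<bar>" using cos by (simp add: tan_def field_simps)
    moreover have "cos \<phi> * \<bar>sin \<theta>\<bar> < sin \<phi> * cos \<theta>"
    proof -
      have "0 < sin (\<phi> - \<bar>\<theta>\<bar>)" using r pos by (intro sin_gt_zero) auto
      then have "cos \<phi> * sin \<bar>\<theta>\<bar> < sin \<phi> * cos \<theta>" by (simp add: sin_diff)
      moreover have "\<bar>sin \<theta>\<bar> = sin \<bar>\<theta>\<bar>"
      proof -
        have "sin \<bar>\<theta>\<bar> \<ge> 0" using r pos by (intro sin_ge_zero) auto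
        then show ?thesis by (cases "\<theta> \<ge> 0") auto
      qed
      ultimately show ?thesis by simp
    qed
    ultimately show False by simp
  qed
  have reg: "z \<in> - sector \<rho>\<^sub>0 \<phi> \<union> frontier (sector \<rho>\<^sub>0 \<phi>)" if z: "tan \<phi> * (Re z - \<rho>\<^sub>0) \<le> \<bar>Im z\<bar>" for z
  proof (cases "z \<in> sector \<rho>\<^sub>0 \<phi>")
    case True
    then obtain r \<theta> where zr: "z = of_real \<rho>\<^sub>0 + of_real r * cis \<theta>" "0 \<le> r" "\<bar>\<theta>\<bar> < \<phi>" by (auto simp: sector_def)
    have "r = 0" using outside[of r \<theta>] z zr by simp
    then have z0: "z = of_real \<rho>\<^sub>0" using zr by simp
    have "z \<notin> interior (sector \<rho>\<^sub>0 \<phi>)"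
    proof
      assume "z \<in> interior (sector \<rho>\<^sub>0 \<phi>)"
      then obtain e where e: "e > 0" "cball z e \<subseteq> sector \<rho>\<^sub>0 \<phi>" by (meson mem_interior_cball)
      have "z - of_real e \<in> cball z e" using e(1) by (simp add: dist_norm)
      then have "z - of_real e \<in> sector \<rho>\<^sub>0 \<phi>" using e(2) by blast
      then obtain r' \<theta>' where zr': "z - of_real e = of_real \<rho>\<^sub>0 + of_real r' * cis \<theta>'" "0 \<le> r'" "\<bar>\<theta>'\<bar> < \<phi>"
        unfolding sector_def by blast
      then have "Re (z - of_real e) = \<rho>\<^sub>0 + r' * cos \<theta>'" by simp
      moreover have "cos \<theta>' > 0" using zr' pos by (intro cos_gt_zero_pi) auto
      then have "r' * cos \<theta>' \<ge> 0" using zr'(2) by simp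
      ultimately show False using z0 e(1) by simp
    qed
    then show ?thesis using True closure_subset by (auto simp: frontier_def)
  qed simp
  show ?thesis
  proof (rule that[of M], unfold_locales)
    show "linear_operator D A" using cd by (simp add: closed_densely_defined_def)
    fix z x assume z: "tan \<phi> * (Re z - \<rho>\<^sub>0) \<le> \<bar>Im z\<bar>"
    show rs: "z \<in> resolvent_set D A" using res[OF reg[OF z]] by simp
    have "bounded_linear (resolvent D A z)" using rs by (simp add: resolvent_set_def bounded_clinear_def)
    then have "norm (resolvent D A z x) \<le> onorm (resolvent D A z) * norm x" by (rule onorm)
    also have "\<dots> \<le> M / (1 + cmod z) * norm x" using res[OF reg[OF z]] by (intro mult_right_mono) auto
    finally show "norm (resolvent D A z x) \<le> M / (1 + cmod z) * norm x" .
  qed (use pos M in auto)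
qed

section \<open>Fractional powers\<close>

text \<open>The integral behind the estimate for fractional powers: by homogeneity it produces the gain \<open>a\<^sup>-\<^sup>\<alpha>\<close>.\<close>
lemma has_integral_powr_div_max:
  fixes a \<alpha> :: real
  assumes a: "a > 0" and \<alpha>: "0 < \<alpha>" "\<alpha> < 1"
  shows "((\<lambda>s. s powr (-\<alpha>) * (1 / max a s)) has_integral a powr (-\<alpha>) * (1 / (1 - \<alpha>) + 1 / \<alpha>)) {0<..}"
proof -
  have "((\<lambda>s. s powr (-\<alpha>) * (1 / a)) has_integral a powr (-\<alpha> + 1) / (-\<alpha> + 1) * (1 / a)) {0..a}"
    by (intro has_integral_mult_left has_integral_powr_from_0) (use a \<alpha> in auto)
  then have 1: "((\<lambda>s. s powr (-\<alpha>) * (1 / max a s)) has_integral a powr (-\<alpha> + 1) / (-\<alpha> + 1) * (1 / a)) {0..a}"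
    by (rule has_integral_eq[rotated]) (auto simp: max_def)
  have "((\<lambda>s. s powr (-\<alpha> - 1)) has_integral - (a powr (-\<alpha> - 1 + 1)) / (-\<alpha> - 1 + 1)) {a..}"
    by (rule has_integral_powr_to_inf) (use a \<alpha> in auto)
  then have 2: "((\<lambda>s. s powr (-\<alpha>) * (1 / max a s)) has_integral - (a powr (-\<alpha> - 1 + 1)) / (-\<alpha> - 1 + 1)) {a..}"
    by (rule has_integral_eq[rotated]) (use a in \<open>auto simp: max_def powr_diff\<close>)
  have "negligible ({0..a} \<inter> {a..})" by (rule negligible_subset[of "{a}"]) auto
  from has_integral_Un[OF 1 2 this]
  have "((\<lambda>s. s powr (-\<alpha>) * (1 / max a s)) has_integral
      a powr (-\<alpha> + 1) / (-\<alpha> + 1) * (1 / a) + - (a powr (-\<alpha> - 1 + 1)) / (-\<alpha> - 1 + 1)) ({0..a} \<union> {a..})" .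
  moreover have "a powr (-\<alpha> + 1) / (-\<alpha> + 1) * (1 / a) + - (a powr (-\<alpha> - 1 + 1)) / (-\<alpha> - 1 + 1)
      = a powr (-\<alpha>) * (1 / (1 - \<alpha>) + 1 / \<alpha>)"
  proof -
    have "a powr (-\<alpha> + 1) = a powr (-\<alpha>) * a" using powr_add[of a "-\<alpha>" 1] a by simp
    then show ?thesis using a \<alpha> by (simp add: distrib_left)
  qed
  moreover have "{0..a} \<union> {a..} = {0..}" using a by auto
  ultimately have *: "((\<lambda>s. s powr (-\<alpha>) * (1 / max a s)) has_integral a powr (-\<alpha>) * (1 / (1 - \<alpha>) + 1 / \<alpha>)) {0..}"
    by simp
  have "negligible {x \<in> {0..} - {0<..}. x powr (-\<alpha>) * (1 / max a x) \<noteq> 0}"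
    "negligible {x \<in> {0<..} - {0..}. x powr (-\<alpha>) * (1 / max a x) \<noteq> 0}"
    by (rule negligible_subset[of "{0}"]; auto)+
  from has_integral_spike_set_eq[OF this] * show ?thesis by blast
qed

context sectorial_operator
begin

text \<open>The integrand is singular at \<open>0\<close>, but the resolvent is continuously differentiable up to \<open>0\<close>, so an
  integration by parts trades \<open>s\<^sup>-\<^sup>\<alpha>\<close> for the continuous function \<open>s\<^sup>1\<^sup>-\<^sup>\<alpha>\<close>. At infinity a dominating function suffices.\<close>
lemma neg_frac_integrable:
  assumes \<alpha>: "0 < \<alpha>" "\<alpha> < 1"
  shows "(\<lambda>s::real. (s powr - \<alpha>) *\<^sub>R (- R (of_real (- s)) v)) integrable_on {0<..}" (is "?f integrable_on _")
proof (rule integrable_on_all_intervals_integrable_bound)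
  show "(\<lambda>s. (M * norm v) * (s powr (-\<alpha>) * (1 / max 1 s))) integrable_on {0<..}"
    using has_integral_powr_div_max[of 1 \<alpha>] \<alpha> by (intro integrable_on_mult_right) auto
  show "norm (?f s) \<le> (M * norm v) * (s powr (-\<alpha>) * (1 / max 1 s))" if "s \<in> {0<..}" for s
  proof -
    have "norm (R (of_real (- s)) v) \<le> M / (1 + s) * norm v"
      using R_bound[OF neg_real_in_\<Omega>[of s]] that by simp
    also have "\<dots> \<le> M / max 1 s * norm v"
      using that M by (intro mult_right_mono divide_left_mono) (auto simp: max_def)
    finally have "s powr (-\<alpha>) * norm (R (of_real (- s)) v) \<le> s powr (-\<alpha>) * (M / max 1 s * norm v)"
      by (rule mult_left_mono) simp
    then show ?thesis by (simp add: mult_ac)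
  qed
  fix a b :: real
  have "?f integrable_on {0..c}" if c: "c \<ge> 0" for c
  proof -
    have "0 + of_real s * (-1) \<in> \<Omega>" if "s \<in> {0..c}" for s
      using neg_real_in_\<Omega>[of s] that by simp
    from vholo_line[OF vholo_R[of v], of "{0..c}" 0 "-1", OF this]
    obtain G' where G': "continuous_on {0..c} G'"
      "\<And>s. s \<in> {0..c} \<Longrightarrow> ((\<lambda>s. R (0 + of_real s * (-1)) v) has_vector_derivative G' s) (at s within {0..c})"
      by blast
    have d: "((\<lambda>s. - R (of_real (- s)) v) has_vector_derivative - G' s) (at s within {0..c})" if "s \<in> {0..c}" for s
      using has_vector_derivative_minus[OF G'(2)[OF that]] by simp
    show ?thesis
    proof (rule integrable_by_parts_interior[OF bounded_bilinear_scaleR c,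
          where f="\<lambda>s. s powr (1 - \<alpha>) / (1 - \<alpha>)" and g'="\<lambda>s. - G' s"])
      show "continuous_on {0..c} (\<lambda>s. s powr (1 - \<alpha>) / (1 - \<alpha>))"
        by (intro continuous_intros continuous_on_powr') (use \<alpha> in auto)
      show "continuous_on {0..c} (\<lambda>s. - R (of_real (- s)) v)"
        unfolding continuous_on_eq_continuous_within
        by (intro ballI has_vector_derivative_continuous[OF d])
      show "(\<lambda>s. (s powr (1 - \<alpha>) / (1 - \<alpha>)) *\<^sub>R - G' s) integrable_on {0..c}"
        by (intro integrable_continuous_interval continuous_intros continuous_on_powr' G') (use \<alpha> in auto)
      fix s assume s: "s \<in> {0<..<c}"
      show "((\<lambda>s. - R (of_real (- s)) v) has_vector_derivative - G' s) (at s)"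
        using d[of s] s at_within_Icc_at[of 0 s c] by simp
      have "((\<lambda>s. s powr (1 - \<alpha>) / (1 - \<alpha>)) has_real_derivative s powr - \<alpha>) (at s)"
        using DERIV_cdivide[OF has_real_derivative_powr[of s "1 - \<alpha>"], of "1 - \<alpha>"] s \<alpha> by simp
      then show "((\<lambda>s. s powr (1 - \<alpha>) / (1 - \<alpha>)) has_vector_derivative s powr - \<alpha>) (at s)"
        by (simp add: has_real_derivative_iff_has_vector_derivative)
    qed
  qed
  from this[of "max b 0"] have "?f integrable_on {max a 0..b}"
    by (rule integrable_on_subinterval) auto
  then have "?f integrable_on {a..b} \<inter> {0<..}"
    by (rule integrable_spike_set) (rule negligible_subset[of "{0}"]; auto)+
  then show "(\<lambda>s. if s \<in> {0<..} then ?f s else 0) integrable_on cbox a b"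
    by (simp only: integrable_restrict_Int cbox_interval Int_commute)
qed

text \<open>Apply the bounded operator \<open>R(z) - 1/z\<close> under Balakrishnan's integral.\<close>
lemma R_minus_inverse_decay_frac:
  assumes \<alpha>: "0 < \<alpha>" "\<alpha> < 1"
  obtains C where "C > 0"
    "\<And>z v. z \<in> \<Omega> \<Longrightarrow> z \<noteq> 0 \<Longrightarrow> Re z \<ge> 0 \<Longrightarrow>
       norm (R z (neg_frac_power D A \<alpha> v) - (1 / z) *\<^sub>C neg_frac_power D A \<alpha> v)
         \<le> C * norm v * (cmod z) powr (-1 - \<alpha>)"
proof -
  define c where "c = \<bar>sin (pi * \<alpha>) / pi\<bar>"
  define K where "K = 1 / (1 - \<alpha>) + 1 / \<alpha>"
  have K: "K > 0" using \<alpha> by (simp add: K_def add_pos_pos)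
  show ?thesis
  proof (rule that[of "(c + 1) * (2 * M * K)"])
    show "(c + 1) * (2 * M * K) > 0" using M K by (simp add: c_def add_nonneg_pos)
    fix z v assume z: "z \<in> \<Omega>" "z \<noteq> 0" "Re z \<ge> 0"
    let ?f = "\<lambda>s::real. (s powr - \<alpha>) *\<^sub>R (- R (of_real (- s)) v)"
    let ?P = "\<lambda>x. R z x - (1 / z) *\<^sub>C x"
    let ?g = "\<lambda>s::real. (2 * M * norm v / cmod z) * (s powr (-\<alpha>) * (1 / max (cmod z) s))"
    have P: "bounded_linear ?P"
      by (intro bounded_linear_sub R_bounded_linear[OF z(1)] scaleC.bounded_linear_right)
    have int: "?f integrable_on {0<..}" by (rule neg_frac_integrable[OF \<alpha>])
    have hi: "(?g has_integral (2 * M * norm v / cmod z) * ((cmod z) powr (-\<alpha>) * K)) {0<..}"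
      unfolding K_def using z \<alpha> by (intro has_integral_mult_right has_integral_powr_div_max) auto
    have Pf: "norm (?P (?f s)) \<le> ?g s" if "s \<in> {0<..}" for s
    proof -
      have "?P (?f s) = - ((s powr - \<alpha>) *\<^sub>R ?P (R (of_real (- s)) v))"
        using linear_simps(5)[OF P, of "s powr - \<alpha>" "- R (of_real (- s)) v"]
          linear_simps(4)[OF P, of "R (of_real (- s)) v"] by (simp only: scaleR_minus_right)
      then have "norm (?P (?f s)) = s powr - \<alpha> * norm (?P (R (of_real (- s)) v))"
        by (simp only: norm_minus_cancel norm_scaleR) simp
      also have "\<dots> \<le> s powr - \<alpha> * (2 * M * norm v / cmod z * (1 / max (cmod z) s))"
        using that by (intro mult_left_mono R_minus_inverse_of_R z) auto
      finally show ?thesis by (simp add: mult_ac)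
    qed
    have "?P (neg_frac_power D A \<alpha> v) = (sin (pi * \<alpha>) / pi) *\<^sub>R ?P (integral {0<..} ?f)"
      unfolding neg_frac_power_def by (rule linear_simps(5)[OF P])
    also have "?P (integral {0<..} ?f) = integral {0<..} (\<lambda>s. ?P (?f s))"
      using integral_linear[OF int P] by (simp add: o_def)
    finally have "norm (?P (neg_frac_power D A \<alpha> v)) = c * norm (integral {0<..} (\<lambda>s. ?P (?f s)))"
      by (simp only: norm_scaleR c_def)
    also have "\<dots> \<le> c * ((2 * M * norm v / cmod z) * ((cmod z) powr (-\<alpha>) * K))"
    proof (rule mult_left_mono)
      have "norm (integral {0<..} (\<lambda>s. ?P (?f s))) \<le> integral {0<..} ?g"
        using integrable_linear[OF int P] hi Pf by (intro integral_norm_bound_integral) (auto simp: o_def)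
      then show "norm (integral {0<..} (\<lambda>s. ?P (?f s))) \<le> (2 * M * norm v / cmod z) * ((cmod z) powr (-\<alpha>) * K)"
        using integral_unique[OF hi] by simp
    qed (simp add: c_def)
    also have "\<dots> = c * (2 * M * K * norm v * (cmod z) powr (-1 - \<alpha>))"
    proof -
      have "(cmod z) powr (-1 - \<alpha>) = (cmod z) powr (-\<alpha>) / cmod z"
        using z by (simp add: powr_diff powr_minus field_simps)
      then show ?thesis by simp
    qed
    also have "\<dots> \<le> (c + 1) * (2 * M * K * norm v * (cmod z) powr (-1 - \<alpha>))"
      using M K by (intro mult_right_mono) auto
    finally show "norm (?P (neg_frac_power D A \<alpha> v)) \<le> (c + 1) * (2 * M * K) * norm v * (cmod z) powr (-1 - \<alpha>)"
      by (simp add: mult.assoc)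
  qed
qed

end

section \<open>The semigroup\<close>

text \<open>A uniform boundedness principle for families indexed by a time that may have to be shortened: the closed sets of
  vectors on which the bound \<open>n\<close> holds up to time \<open>1/(n+1)\<close> cover the space, so by Baire's theorem one of
  them contains a ball.\<close>
lemma uniform_bound_near_zero:
  fixes T :: "real \<Rightarrow> 'a::banach \<Rightarrow> 'b::real_normed_vector"
  assumes bl: "\<And>t. t \<ge> 0 \<Longrightarrow> bounded_linear (T t)"
    and loc: "\<And>x. \<exists>n::nat. \<forall>t\<in>{0..1 / (real n + 1)}. norm (T t x) \<le> real n"
  obtains \<delta> K where "\<delta> > 0" "\<And>t x. t \<in> {0..\<delta>} \<Longrightarrow> norm (T t x) \<le> K * norm x"
proof -
  define E where "E n = {x. \<forall>t\<in>{0..1 / (real n + 1)}. norm (T t x) \<le> real n}" for n :: nat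
  have closed_E: "closed (E n)" for n
  proof -
    have "E n = (\<Inter>t\<in>{0..1 / (real n + 1)}. {x. norm (T t x) \<le> real n})" by (auto simp: E_def)
    moreover have "closed {x. norm (T t x) \<le> real n}" if "t \<in> {0..1 / (real n + 1)}" for t
      using that by (intro closed_Collect_le continuous_intros
          bounded_linear.continuous_on[OF bl]) auto
    ultimately show ?thesis by auto
  qed
  have "\<exists>n. interior (E n) \<noteq> {}"
  proof (rule ccontr)
    assume "\<not> (\<exists>n. interior (E n) \<noteq> {})"
    then have "(euclidean :: 'a topology) interior_of \<Union>(range E) = {}"
      by (intro Baire_category_alt) (auto simp: completely_metrizable_space_euclidean closed_E)
    moreover have "\<Union>(range E) = UNIV" using loc by (auto simp: E_def)
    ultimately show False by simp
  qed
  then obtain n x0 where "x0 \<in> interior (E n)" by blast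
  then obtain r where r: "r > 0" "cball x0 r \<subseteq> E n"
    by (meson mem_interior_cball)
  define \<delta> where "\<delta> = 1 / (real n + 1)"
  show ?thesis
  proof (rule that[of \<delta> "2 * real n / r"])
    show "\<delta> > 0" by (simp add: \<delta>_def)
    fix t x assume t: "t \<in> {0..\<delta>}"
    have T: "bounded_linear (T t)" using bl t by auto
    show "norm (T t x) \<le> 2 * real n / r * norm x"
    proof (cases "x = 0")
      case True then show ?thesis using linear_simps(3)[OF T] by simp
    next
      case False
      define y where "y = (r / norm x) *\<^sub>R x"
      have "norm y = r" using False r by (simp add: y_def)
      then have "x0 + y \<in> E n" "x0 \<in> E n" using r by (auto simp: dist_norm)
      then have "norm (T t (x0 + y)) \<le> real n" "norm (T t x0) \<le> real n" using t by (auto simp: E_def \<delta>_def)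
      then have "norm (T t y) \<le> 2 * real n"
        using norm_triangle_ineq4[of "T t (x0 + y)" "T t x0"] linear_simps(1)[OF T, of x0 y] by simp
      moreover have "x = (norm x / r) *\<^sub>R y" using False r by (simp add: y_def)
      then have "norm (T t x) = norm x / r * norm (T t y)"
        using linear_simps(5)[OF T, of "norm x / r" y] r by simp
      ultimately show ?thesis using r mult_left_mono[of "norm (T t y)" "2 * real n" "norm x / r"] by (simp add: mult.commute)
    qed
  qed
qed

locale sectorial_semigroup = sectorial_operator +
  fixes S :: "real \<Rightarrow> 'a \<Rightarrow> 'a"
  assumes gen: "semigroup_generated_by S D (\<lambda>x. - A x)"
begin

lemma S_bounded_clinear: "t \<ge> 0 \<Longrightarrow> bounded_clinear (S t)"
  and S_zero: "S 0 x = x"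
  and S_add: "s \<ge> 0 \<Longrightarrow> t \<ge> 0 \<Longrightarrow> S (s + t) x = S s (S t x)"
  and S_tendsto: "((\<lambda>t. S t x) \<longlongrightarrow> x) (at_right 0)"
  and S_generator: "((\<lambda>t. (1 / t) *\<^sub>R (S t x - x)) \<longlongrightarrow> y) (at_right 0) \<longleftrightarrow> x \<in> D \<and> y = - A x"
  using gen unfolding semigroup_generated_by_def C0_semigroup_def by auto

lemma S_bounded_linear: "t \<ge> 0 \<Longrightarrow> bounded_linear (S t)"
  and S_scaleC: "t \<ge> 0 \<Longrightarrow> S t (c *\<^sub>C x) = c *\<^sub>C S t x"
  using S_bounded_clinear by (auto simp: bounded_clinear_def)

lemma S_bound_near_zero:
  obtains \<delta> K where "\<delta> > 0" "\<And>t x. t \<in> {0..\<delta>} \<Longrightarrow> norm (S t x) \<le> K * norm x"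
proof (rule uniform_bound_near_zero[of S])
  fix x
  have "eventually (\<lambda>t. dist (S t x) x < 1) (at_right 0)" using S_tendsto by (rule tendstoD) simp
  then obtain b where b: "b > 0" "\<And>t. 0 < t \<Longrightarrow> t < b \<Longrightarrow> dist (S t x) x < 1"
    by (auto simp: eventually_at_right_field)
  obtain n :: nat where n: "real n > 1 / b + norm x + 1" using reals_Archimedean2 by blast
  have "real n + 1 > 1 / b" using n norm_ge_zero[of x] by linarith
  then have nb: "1 / (real n + 1) < b" using b(1) by (simp add: field_simps)
  have "norm (S t x) \<le> real n" if t: "t \<in> {0..1 / (real n + 1)}" for t
  proof -
    have "dist (S t x) x < 1"
    proof (cases "t = 0")
      case False with t nb b(2)[of t] show ?thesis by auto
    qed (simp add: S_zero)
    then have "norm (S t x) \<le> norm x + 1" using norm_triangle_sub[of "S t x" x] by (simp add: dist_norm)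
    moreover have "1 / b > 0" using b by simp
    ultimately show ?thesis using n by linarith
  qed
  then show "\<exists>n::nat. \<forall>t\<in>{0..1 / (real n + 1)}. norm (S t x) \<le> real n" by blast
qed (use S_bounded_linear in auto)

text \<open>The bound near zero extends to any bounded time interval by the semigroup law.\<close>
lemma S_local_bound:
  obtains K where "K > 0" "\<And>s x. s \<in> {0..t} \<Longrightarrow> norm (S s x) \<le> K * norm x"
proof -
  obtain \<delta> K0 where d: "\<delta> > 0" "\<And>t x. t \<in> {0..\<delta>} \<Longrightarrow> norm (S t x) \<le> K0 * norm x"
    using S_bound_near_zero by blast
  define K where "K = max 1 K0"
  have K: "K \<ge> 1" "norm (S t x) \<le> K * norm x" if "t \<in> {0..\<delta>}" for t x
    using d(2)[OF that, of x] mult_right_mono[of K0 K "norm x"] by (auto simp: K_def)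
  have step: "norm (S s x) \<le> K ^ n * norm x" if "s \<in> {0..real n * \<delta>}" for n s x
    using that
  proof (induction n arbitrary: s)
    case 0 then show ?case by (simp add: S_zero)
  next
    case (Suc n)
    show ?case
    proof (cases "s \<le> \<delta>")
      case True
      have "K * norm x \<le> K ^ Suc n * norm x" unfolding K_def
        by (intro mult_right_mono self_le_power) auto
      then show ?thesis using K(2)[of s x] Suc.prems True by (meson atLeastAtMost_iff order_trans)
    next
      case False
      have "S s x = S \<delta> (S (s - \<delta>) x)" using S_add[of \<delta> "s - \<delta>" x] False d(1) by simp
      moreover have "norm (S \<delta> (S (s - \<delta>) x)) \<le> K * norm (S (s - \<delta>) x)" using K(2) d(1) by simp
      moreover have "norm (S (s - \<delta>) x) \<le> K ^ n * norm x"
        using Suc.prems False by (intro Suc.IH) (auto simp: algebra_simps)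
      then have "K * norm (S (s - \<delta>) x) \<le> K * (K ^ n * norm x)"
        by (intro mult_left_mono) (auto simp: K_def)
      ultimately show ?thesis by simp
    qed
  qed
  obtain n :: nat where "t / \<delta> < real n" using reals_Archimedean2 by blast
  then have n: "t \<le> real n * \<delta>" using d(1) by (simp add: field_simps)
  show ?thesis
    by (rule that[of "K ^ n"]) (use n step in \<open>auto simp: K_def\<close>)
qed

lemma S_continuous_on: "continuous_on {0..t} (\<lambda>s. S s x)"
proof -
  obtain K where K: "K > 0" "\<And>s x. s \<in> {0..t} \<Longrightarrow> norm (S s x) \<le> K * norm x"
    using S_local_bound by blast
  have le: "norm (S v x - S u x) \<le> K * norm (S (v - u) x - x)" if "0 \<le> u" "u \<le> v" "v \<le> t" for u v
  proof -
    have "S v x - S u x = S u (S (v - u) x - x)"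
      using S_add[of u "v - u" x] that linear_simps(2)[OF S_bounded_linear[OF that(1)]] by simp
    then show ?thesis using K(2)[of u] that by simp
  qed
  show ?thesis unfolding continuous_on_iff
  proof (intro ballI allI impI)
    fix s e :: real assume s: "s \<in> {0..t}" and e: "e > 0"
    have "eventually (\<lambda>h. dist (S h x) x < e / K) (at_right 0)"
      using S_tendsto e K by (intro tendstoD) auto
    then obtain b where b: "b > 0" "\<And>h. 0 < h \<Longrightarrow> h < b \<Longrightarrow> dist (S h x) x < e / K"
      by (auto simp: eventually_at_right_field)
    have "dist (S u x) (S s x) < e" if u: "u \<in> {0..t}" "dist u s < b" for u
    proof (cases "u = s")
      case False
      define a where "a = min u s"
      define c where "c = max u s"
      have ac: "0 \<le> a" "a < c" "c \<le> t" "c - a < b"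
        using u s False by (auto simp: a_def c_def dist_real_def)
      have "dist (S u x) (S s x) = norm (S c x - S a x)"
        by (auto simp: a_def c_def dist_norm norm_minus_commute max_def min_def)
      also have "\<dots> \<le> K * norm (S (c - a) x - x)" using ac by (intro le) auto
      also have "\<dots> < e" using b(2)[of "c - a"] ac K by (simp add: dist_norm field_simps)
      finally show ?thesis .
    qed (use e in simp)
    then show "\<exists>d>0. \<forall>x'\<in>{0..t}. dist x' s < d \<longrightarrow> dist (S x' x) (S s x) < e"
      using b(1) by blast
  qed
qed

lemma
  assumes x: "x \<in> D" and t: "t \<ge> 0"
  shows S_in_D: "S t x \<in> D" and A_S: "A (S t x) = S t (A x)"
proof -
  have "((\<lambda>h. (1 / h) *\<^sub>R (S h x - x)) \<longlongrightarrow> - A x) (at_right 0)" using S_generator x by blast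
  from bounded_linear.tendsto[OF S_bounded_linear[OF t] this]
  have "((\<lambda>h. S t ((1 / h) *\<^sub>R (S h x - x))) \<longlongrightarrow> S t (- A x)) (at_right 0)" .
  moreover have "eventually (\<lambda>h. S t ((1 / h) *\<^sub>R (S h x - x)) = (1 / h) *\<^sub>R (S h (S t x) - S t x)) (at_right 0)"
    unfolding eventually_at_right_field
  proof (intro exI[of _ 1] conjI allI impI)
    fix h :: real assume h: "0 < h"
    have "S t (S h x) = S h (S t x)" using S_add[of t h x] S_add[of h t x] t h by (simp add: add.commute)
    then show "S t ((1 / h) *\<^sub>R (S h x - x)) = (1 / h) *\<^sub>R (S h (S t x) - S t x)"
      by (simp add: linear_simps(2,5)[OF S_bounded_linear[OF t]])
  qed simp
  ultimately have "((\<lambda>h. (1 / h) *\<^sub>R (S h (S t x) - S t x)) \<longlongrightarrow> S t (- A x)) (at_right 0)"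
    by (rule Lim_transform_eventually)
  then have "S t x \<in> D \<and> S t (- A x) = - A (S t x)" using S_generator by blast
  then show "S t x \<in> D" "A (S t x) = S t (A x)"
    by (auto simp: linear_simps(4)[OF S_bounded_linear[OF t]])
qed

lemma S_R_commute:
  assumes z: "z \<in> \<Omega>" and t: "t \<ge> 0"
  shows "S t (R z x) = R z (S t x)"
proof -
  let ?y = "R z x"
  have "S t x = S t (z *\<^sub>C ?y - A ?y)" using R_right[OF z] by simp
  also have "\<dots> = z *\<^sub>C S t ?y - A (S t ?y)"
    by (simp add: linear_simps(2)[OF S_bounded_linear[OF t]] S_scaleC t A_S R_in_D z)
  finally show ?thesis using R_left[OF z S_in_D[OF R_in_D[OF z] t]] by simp
qed

text \<open>The generator controls only the right derivative at \<open>0\<close>. For a left difference quotient, start the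
  semigroup at the earlier time and compare \<open>S u y\<close> with \<open>S s y\<close> by strong continuity.\<close>
lemma S_has_vector_derivative:
  assumes x: "x \<in> D" and s: "s \<in> {0..t}"
  shows "((\<lambda>s. S s x) has_vector_derivative - S s (A x)) (at s within {0..t})"
proof -
  obtain K where K: "K > 0" "\<And>s x. s \<in> {0..t} \<Longrightarrow> norm (S s x) \<le> K * norm x"
    using S_local_bound by blast
  define y where "y = - A x"
  define r where "r h = (1 / h) *\<^sub>R (S h x - x) - y" for h
  have r0: "(r \<longlongrightarrow> 0) (at_right 0)"
    using S_generator[of x y] x unfolding r_def by (auto intro: tendsto_eq_intros simp: y_def)
  have le: "norm (S v x - S u x - (v - u) *\<^sub>R S u y) \<le> (v - u) * (K * norm (r (v - u)))"
    if uv: "0 \<le> u" "u < v" "v \<le> t" for u v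
  proof -
    note bl = S_bounded_linear[OF uv(1)]
    have "S v x - S u x - (v - u) *\<^sub>R S u y = S u (S (v - u) x - x - (v - u) *\<^sub>R y)"
      using S_add[of u "v - u" x] uv by (simp add: linear_simps[OF bl])
    also have "S (v - u) x - x - (v - u) *\<^sub>R y = (v - u) *\<^sub>R r (v - u)"
      using uv by (simp add: r_def scaleR_diff_right)
    finally have "norm (S v x - S u x - (v - u) *\<^sub>R S u y) = (v - u) * norm (S u (r (v - u)))"
      using uv by (simp add: linear_simps[OF bl])
    then show ?thesis using K(2)[of u] uv by (simp add: mult_left_mono)
  qed
  have "((\<lambda>s. S s x) has_derivative (\<lambda>h. h *\<^sub>R S s y)) (at s within {0..t})"
  proof (rule has_derivativeI_sandwich[where e=1 and H="\<lambda>u. K * norm (r \<bar>u - s\<bar>) + norm (S s y - S u y)"])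
    show "bounded_linear (\<lambda>h. h *\<^sub>R S s y)" by (rule bounded_linear_scaleR_left)
    have "((\<lambda>u. \<bar>u - s\<bar>) \<longlongrightarrow> \<bar>s - s\<bar>) (at s within {0..t})" by (intro tendsto_intros)
    then have "filterlim (\<lambda>u. \<bar>u - s\<bar>) (at_right 0) (at s within {0..t})"
      unfolding filterlim_at by (auto simp: eventually_at_filter)
    then have "((\<lambda>u. r \<bar>u - s\<bar>) \<longlongrightarrow> 0) (at s within {0..t})" by (rule filterlim_compose[OF r0])
    moreover have "((\<lambda>u. S u y) \<longlongrightarrow> S s y) (at s within {0..t})"
      using S_continuous_on[of t y] s by (auto simp: continuous_on_def)
    ultimately show "((\<lambda>u. K * norm (r \<bar>u - s\<bar>) + norm (S s y - S u y)) \<longlongrightarrow> 0) (at s within {0..t})"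
      by (auto intro!: tendsto_eq_intros)
    fix u assume u: "u \<in> {0..t}" "u \<noteq> s"
    show "norm (S u x - S s x - (u - s) *\<^sub>R S s y) / norm (u - s) \<le> K * norm (r \<bar>u - s\<bar>) + norm (S s y - S u y)"
    proof (cases "u > s")
      case True
      moreover have "0 \<le> (u - s) * norm (S s y - S u y)" using True by simp
      ultimately show ?thesis using le[of s u] u s by (simp add: divide_le_eq algebra_simps)
    next
      case False
      then have us: "u < s" using u by simp
      have "S u x - S s x - (u - s) *\<^sub>R S s y = (s - u) *\<^sub>R (S s y - S u y) - (S s x - S u x - (s - u) *\<^sub>R S u y)"
        by (simp add: algebra_simps)
      then have "norm (S u x - S s x - (u - s) *\<^sub>R S s y)
          \<le> norm ((s - u) *\<^sub>R (S s y - S u y)) + norm (S s x - S u x - (s - u) *\<^sub>R S u y)"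
        using norm_triangle_ineq4 by metis
      also have "\<dots> \<le> (s - u) * norm (S s y - S u y) + (s - u) * (K * norm (r (s - u)))"
        using le[of u s] u s us by simp
      finally show ?thesis using us by (simp add: divide_le_eq abs_minus_commute algebra_simps)
    qed
  qed simp
  then show ?thesis
    by (simp add: has_vector_derivative_def y_def linear_simps(4)[OF S_bounded_linear] atLeastAtMost_iff[THEN iffD1, OF s])
qed

text \<open>The right-hand side is defined for every \<open>z\<close>, also inside the spectral sector: it is the entire continuation
  that allows the contour to be moved to the right across the spectrum.\<close>
lemma S_R_Duhamel:
  assumes z: "z \<in> \<Omega>" and t: "t \<ge> 0"
  shows "S t (R z y) - exp (- z * of_real t) *\<^sub>C R z y = integral {0..t} (\<lambda>s. exp (- z * of_real (t - s)) *\<^sub>C S s y)"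
proof -
  let ?x = "R z y"
  have xD: "?x \<in> D" by (rule R_in_D[OF z])
  have "((\<lambda>s. exp (- z * of_real (t - s)) *\<^sub>C S s y) has_integral
      exp (- z * of_real (t - t)) *\<^sub>C S t ?x - exp (- z * of_real (t - 0)) *\<^sub>C S 0 ?x) {0..t}"
  proof (rule fundamental_theorem_of_calculus[OF t])
    fix s assume s: "s \<in> {0..t}"
    have e: "((\<lambda>s. exp (- z * of_real (t - s))) has_vector_derivative z * exp (- z * of_real (t - s))) (at s within {0..t})"
      unfolding of_real_diff
      by (rule has_vector_derivative_real_field) (auto intro!: derivative_eq_intros)
    have *: "S s (z *\<^sub>C ?x - A ?x) = S s y" using R_right[OF z] by simp
    have "exp (- z * of_real (t - s)) *\<^sub>C - S s (A ?x) + (z * exp (- z * of_real (t - s))) *\<^sub>C S s ?x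
        = exp (- z * of_real (t - s)) *\<^sub>C S s (z *\<^sub>C ?x - A ?x)"
      using s by (simp add: linear_simps(2)[OF S_bounded_linear] S_scaleC scaleC_scaleC
          scaleC.minus_right scaleC.diff_right mult.commute)
    with scaleC.has_vector_derivative[OF e S_has_vector_derivative[OF xD s]]
    show "((\<lambda>s. exp (- z * of_real (t - s)) *\<^sub>C S s ?x) has_vector_derivative
        exp (- z * of_real (t - s)) *\<^sub>C S s y) (at s within {0..t})"
      by (simp add: *)
  qed
  from integral_unique[OF this] show ?thesis by (simp add: S_zero scaleC_one)
qed

end

text \<open>The remainder of the first-order Taylor expansion of the exponential is quadratic, uniformly in \<open>s\<close>. The derivative
  is again a transform of the same kind, which gives its continuity.\<close>
lemma vholo_finite_Laplace:
  fixes g :: "real \<Rightarrow> 'a::complex_banach"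
  assumes g: "continuous_on {0..t} g" and t: "t \<ge> 0"
  shows "vholo UNIV (\<lambda>z. integral {0..t} (\<lambda>s. exp (- z * of_real (t - s)) *\<^sub>C g s))"
proof -
  define \<Theta> where "\<Theta> g z = integral {0..t} (\<lambda>s. exp (- z * of_real (t - s)) *\<^sub>C g s)"
    for z and g :: "real \<Rightarrow> 'a"
  define g' where "g' g s = - ((t - s) *\<^sub>R g s)" for s and g :: "real \<Rightarrow> 'a"
  have cont: "continuous_on {0..t} (\<lambda>s. exp (- z * of_real (t - s)) *\<^sub>C g s)"
    if "continuous_on {0..t} g" for z and g :: "real \<Rightarrow> 'a"
    by (intro continuous_intros that)
  have g'cont: "continuous_on {0..t} (g' g)" if "continuous_on {0..t} g" for g
    unfolding g'_def[abs_def] by (intro continuous_intros that)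
  have der: "(\<Theta> g has_derivative (\<lambda>h. h *\<^sub>C \<Theta> (g' g) z)) (at z)" if g: "continuous_on {0..t} g" for g z
  proof -
    have "bounded (g ` {0..t})" by (intro compact_imp_bounded compact_continuous_image g compact_Icc)
    then obtain B where B: "B > 0" "\<And>s. s \<in> {0..t} \<Longrightarrow> norm (g s) \<le> B" by (auto simp: bounded_pos)
    define C where "C = exp (cmod z * t) * (exp t * t\<^sup>2) * B * t"
    show ?thesis
    proof (rule has_derivativeI_sandwich[where e=1 and H="\<lambda>w. C * cmod (w - z)"])
      show "bounded_linear (\<lambda>h. h *\<^sub>C \<Theta> (g' g) z)" by (rule scaleC.bounded_linear_left)
      have "((\<lambda>w. C * cmod (w - z)) \<longlongrightarrow> C * cmod (z - z)) (at z)" by (intro tendsto_intros)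
      then show "((\<lambda>w. C * cmod (w - z)) \<longlongrightarrow> 0) (at z)" by simp
      fix w assume w: "w \<noteq> z" "dist w z < 1"
      let ?d = "\<lambda>s. exp (- w * of_real (t - s)) *\<^sub>C g s - exp (- z * of_real (t - s)) *\<^sub>C g s
                 - (w - z) *\<^sub>C (exp (- z * of_real (t - s)) *\<^sub>C g' g s)"
      have "\<Theta> g w - \<Theta> g z - (w - z) *\<^sub>C \<Theta> (g' g) z = integral {0..t} ?d"
      proof -
        have "((\<lambda>s. (w - z) *\<^sub>C (exp (- z * of_real (t - s)) *\<^sub>C g' g s)) has_integral (w - z) *\<^sub>C \<Theta> (g' g) z) {0..t}"
          using has_integral_linear[OF integrable_integral[OF integrable_continuous_interval[OF cont[OF g'cont[OF g], of z]]]
              scaleC.bounded_linear_right[of "w - z"]] unfolding \<Theta>_def by (simp add: o_def)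
        moreover have "((\<lambda>s. exp (- v * of_real (t - s)) *\<^sub>C g s) has_integral \<Theta> g v) {0..t}" for v
          unfolding \<Theta>_def by (intro integrable_integral integrable_continuous_interval cont g)
        ultimately have "(?d has_integral (\<Theta> g w - \<Theta> g z - (w - z) *\<^sub>C \<Theta> (g' g) z)) {0..t}"
          by (intro has_integral_diff)
        then show ?thesis by (simp add: integral_unique)
      qed
      also have "norm \<dots> \<le> (exp (cmod z * t) * (exp t * t\<^sup>2) * B * (cmod (w - z))\<^sup>2) * (t - 0)"
      proof (rule integral_bound[OF t])
        show "continuous_on {0..t} ?d" by (intro continuous_intros cont g g'cont)
        fix s assume s: "s \<in> {0..t}"
        define u where "u = - (w - z) * of_real (t - s)"
        have "exp (- w * of_real (t - s)) = exp (- z * of_real (t - s)) * exp u"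
          by (simp add: u_def exp_add[symmetric] algebra_simps)
        moreover have "(w - z) *\<^sub>C (c *\<^sub>C g' g s) = (c * u) *\<^sub>C g s" for c
        proof -
          have "(w - z) *\<^sub>C (c *\<^sub>C g' g s) = ((w - z) * c * - of_real (t - s)) *\<^sub>C g s"
            by (simp only: g'_def scaleC_scaleC scaleR_scaleC scaleC.minus_right scaleC.minus_left mult_minus_right mult.assoc)
          also have "(w - z) * c * - of_real (t - s) = c * u" by (simp add: u_def algebra_simps)
          finally show ?thesis .
        qed
        ultimately have "?d s = (exp (- z * of_real (t - s)) * (exp u - 1 - u)) *\<^sub>C g s"
          by (simp add: scaleC.diff_left scaleC.add_left algebra_simps)
        then have nd: "norm (?d s) = cmod (exp (- z * of_real (t - s))) * cmod (exp u - 1 - u) * norm (g s)"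
          by (simp add: norm_scaleC norm_mult)
        have nu: "cmod u \<le> cmod (w - z) * t" "cmod u \<le> t"
        proof -
          have "cmod u = cmod (w - z) * (t - s)" 
            unfolding u_def norm_mult norm_minus_cancel norm_of_real using s by simp
          also have "\<dots> \<le> cmod (w - z) * t" using s by (intro mult_left_mono) auto
          finally show "cmod u \<le> cmod (w - z) * t" .
          also have "\<dots> \<le> 1 * t" using w t by (intro mult_right_mono) (auto simp: dist_norm)
          finally show "cmod u \<le> t" by simp
        qed
        have "cmod (exp u - 1 - u) \<le> exp \<bar>Re u\<bar> * (cmod u)\<^sup>2"
          using Taylor_exp[of u 1] by (simp add: power2_eq_square diff_diff_eq add.commute)
        also have "\<dots> \<le> exp t * (cmod (w - z) * t)\<^sup>2"
          using nu abs_Re_le_cmod[of u] by (intro mult_mono power_mono) auto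
        finally have eu: "cmod (exp u - 1 - u) \<le> exp t * t\<^sup>2 * (cmod (w - z))\<^sup>2"
          by (simp add: power_mult_distrib mult_ac)
        have "Re (- z * of_real (t - s)) \<le> cmod z * t"
        proof -
          have "Re (- z * of_real (t - s)) \<le> cmod (- z * of_real (t - s))" by (rule complex_Re_le_cmod)
          also have "\<dots> = cmod z * (t - s)"
            unfolding norm_mult norm_minus_cancel norm_of_real using s by simp
          also have "\<dots> \<le> cmod z * t" using s by (intro mult_left_mono) auto
          finally show ?thesis .
        qed
        then have ez: "cmod (exp (- z * of_real (t - s))) \<le> exp (cmod z * t)" by (simp add: norm_exp_eq_Re)
        have "norm (?d s) \<le> exp (cmod z * t) * (exp t * t\<^sup>2 * (cmod (w - z))\<^sup>2) * B"
          unfolding nd by (intro mult_mono ez eu B s) auto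
        then show "norm (?d s) \<le> exp (cmod z * t) * (exp t * t\<^sup>2) * B * (cmod (w - z))\<^sup>2"
          by (simp add: mult_ac)
      qed
      also have "\<dots> = C * (cmod (w - z))\<^sup>2" by (simp add: C_def)
      finally show "norm (\<Theta> g w - \<Theta> g z - (w - z) *\<^sub>C \<Theta> (g' g) z) / norm (w - z) \<le> C * cmod (w - z)"
        using w by (simp add: divide_le_eq power2_eq_square mult.assoc)
    qed simp
  qed
  show ?thesis unfolding vholo_def
  proof (intro exI[of _ "\<Theta> (g' g)"] conjI ballI)
    show "continuous_on UNIV (\<Theta> (g' g))"
      unfolding continuous_on_eq_continuous_within
      by (intro ballI has_derivative_continuous[OF der[OF g'cont[OF g]]])
    show "((\<lambda>z. integral {0..t} (\<lambda>s. exp (- z * of_real (t - s)) *\<^sub>C g s)) has_derivative (\<lambda>h. h *\<^sub>C \<Theta> (g' g) w)) (at w)" for w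
      using der[OF g, of w] by (simp add: \<Theta>_def[abs_def])
  qed
qed

context sectorial_semigroup
begin

text \<open>The gain \<open>1 / Re z\<close> is what makes the shifted contour integral converge.\<close>
lemma S_Laplace_bound:
  assumes t: "t \<ge> 0"
  obtains K where "K > 0" "\<And>z y. Re z > 0 \<Longrightarrow>
    norm (integral {0..t} (\<lambda>s. exp (- z * of_real (t - s)) *\<^sub>C S s y)) \<le> K * norm y / Re z"
proof -
  obtain K where K: "K > 0" "\<And>s x. s \<in> {0..t} \<Longrightarrow> norm (S s x) \<le> K * norm x"
    using S_local_bound by blast
  show ?thesis
  proof (rule that[OF K(1)])
    fix z :: complex and y :: 'a assume z: "Re z > 0"
    have i: "((\<lambda>s. exp (- Re z * (t - s)) * (K * norm y)) has_integral
       (exp (- Re z * (t - t)) / Re z - exp (- Re z * (t - 0)) / Re z) * (K * norm y)) {0..t}"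
      by (intro has_integral_mult_left fundamental_theorem_of_calculus t)
        (use z in \<open>auto intro!: derivative_eq_intros simp: has_real_derivative_iff_has_vector_derivative[symmetric]\<close>)
    have "norm (integral {0..t} (\<lambda>s. exp (- z * of_real (t - s)) *\<^sub>C S s y))
        \<le> integral {0..t} (\<lambda>s. exp (- Re z * (t - s)) * (K * norm y))"
    proof (rule integral_norm_bound_integral)
      show "(\<lambda>s. exp (- z * of_real (t - s)) *\<^sub>C S s y) integrable_on {0..t}"
        by (intro integrable_continuous_interval continuous_intros S_continuous_on)
      show "norm (exp (- z * of_real (t - s)) *\<^sub>C S s y) \<le> exp (- Re z * (t - s)) * (K * norm y)"
        if "s \<in> {0..t}" for s
        using K(2)[OF that, of y] by (simp add: norm_scaleC norm_exp_eq_Re mult_left_mono)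
    qed (use i in blast)
    also have "\<dots> = (1 - exp (- Re z * t)) / Re z * (K * norm y)"
      using integral_unique[OF i] by (simp add: diff_divide_distrib)
    also have "\<dots> \<le> 1 / Re z * (K * norm y)"
      using z K by (intro mult_right_mono divide_right_mono) auto
    finally show "norm (integral {0..t} (\<lambda>s. exp (- z * of_real (t - s)) *\<^sub>C S s y)) \<le> K * norm y / Re z"
      by simp
  qed
qed

end

section \<open>The integration hyperbola\<close>

text \<open>Horizontal lines in the plane of \<open>w\<close> are mapped by \<open>cosh\<close> to confocal hyperbolas; all geometry of the
  contours is read off from the real and imaginary parts below.\<close>
lemma Re_cosh_complex: "Re (cosh w) = cosh (Re w) * cos (Im w)"
  and Im_cosh_complex: "Im (cosh w) = sinh (Re w) * sin (Im w)"
  and Re_sinh_complex: "Re (sinh w) = sinh (Re w) * cos (Im w)"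
  and Im_sinh_complex: "Im (sinh w) = cosh (Re w) * sin (Im w)"
  by (simp_all add: cosh_field_def sinh_field_def Re_exp Im_exp field_simps)

lemma cmod_cosh_squared: "(cmod (cosh w))\<^sup>2 = (sinh (Re w))\<^sup>2 + (cos (Im w))\<^sup>2"
proof -
  have "(cmod (cosh w))\<^sup>2 = (cosh (Re w))\<^sup>2 * (cos (Im w))\<^sup>2 + (sinh (Re w))\<^sup>2 * (sin (Im w))\<^sup>2"
    by (simp add: cmod_power2 Re_cosh_complex Im_cosh_complex power_mult_distrib)
  also have "\<dots> = ((sinh (Re w))\<^sup>2 + 1) * (cos (Im w))\<^sup>2 + (sinh (Re w))\<^sup>2 * (1 - (cos (Im w))\<^sup>2)"
    by (simp add: cosh_square_eq sin_squared_eq)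
  also have "\<dots> = (sinh (Re w))\<^sup>2 + (cos (Im w))\<^sup>2" by (simp add: algebra_simps)
  finally show ?thesis .
qed

lemma abs_sinh_le_cmod_cosh: "\<bar>sinh (Re w)\<bar> \<le> cmod (cosh w)"
  using cmod_cosh_squared[of w] by (simp add: abs_le_square_iff[of "sinh (Re w)" "cmod (cosh w)", simplified])

lemma cmod_sinh_le: "cmod (sinh w) \<le> cosh (Re w)"
proof -
  have "(cmod (sinh w))\<^sup>2 = (sinh (Re w))\<^sup>2 * (cos (Im w))\<^sup>2 + (cosh (Re w))\<^sup>2 * (sin (Im w))\<^sup>2"
    by (simp add: cmod_power2 Re_sinh_complex Im_sinh_complex power_mult_distrib)
  also have "\<dots> \<le> (cosh (Re w))\<^sup>2 * (cos (Im w))\<^sup>2 + (cosh (Re w))\<^sup>2 * (sin (Im w))\<^sup>2"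
    by (intro add_mono mult_right_mono) (auto simp: cosh_square_eq)
  also have "\<dots> = (cosh (Re w))\<^sup>2" by (simp add: distrib_left[symmetric])
  finally show ?thesis by (rule power2_le_imp_le) simp
qed

lemma exp_abs_le_cosh: "exp \<bar>x\<bar> / 2 \<le> cosh (x::real)"
  by (cases "x \<ge> 0") (simp_all add: cosh_field_def)

text \<open>In this locale \<open>focus\<close> is half the distance of the foci of the hyperbolas, and the lines \<open>Im w = -\<phi>\<close>,
  \<open>Im w = -\<psi>\<close> and \<open>Im w = -\<theta>\<close> are the boundary touching the spectral sector, the integration hyperbola and
  the boundary through \<open>\<rho>\<^sub>1\<close>.\<close>
locale nonlocal_problem = sectorial_semigroup +
  fixes \<rho>\<^sub>1 :: real and m :: nat and al tt :: "nat \<Rightarrow> real"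
  assumes tt_nonneg: "i \<in> {1..m} \<Longrightarrow> tt i \<ge> 0"
    and \<rho>\<^sub>1: "0 < \<rho>\<^sub>1" "\<rho>\<^sub>1 < \<rho>\<^sub>0" and small: "(\<Sum>i=1..m. \<bar>al i\<bar> * exp (- \<rho>\<^sub>1 * tt i)) < 1"
begin

definition focus :: real where "focus = sqrt (\<rho>\<^sub>0\<^sup>2 + (b0 \<rho>\<^sub>0 \<phi>)\<^sup>2)"
definition \<delta> :: real where "\<delta> = d1 \<rho>\<^sub>0 \<phi> \<rho>\<^sub>1"
definition \<psi> :: real where "\<psi> = \<delta> / 2 + \<phi>"
definition \<theta> :: real where "\<theta> = \<phi> + \<delta>"

lemma cos_\<phi>: "cos \<phi> > 0" using \<phi> by (intro cos_gt_zero_pi) auto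
lemma sin_\<phi>: "sin \<phi> > 0" using \<phi> by (intro sin_gt_zero) auto

lemma focus_cos: "focus * cos \<phi> = \<rho>\<^sub>0"
proof -
  have "\<rho>\<^sub>0\<^sup>2 + (b0 \<rho>\<^sub>0 \<phi>)\<^sup>2 = (\<rho>\<^sub>0 / cos \<phi>)\<^sup>2"
  proof -
    have "\<rho>\<^sub>0\<^sup>2 + (b0 \<rho>\<^sub>0 \<phi>)\<^sup>2 = (\<rho>\<^sub>0\<^sup>2 * (cos \<phi>)\<^sup>2 + \<rho>\<^sub>0\<^sup>2 * (sin \<phi>)\<^sup>2) / (cos \<phi>)\<^sup>2"
      using cos_\<phi> by (simp add: b0_def tan_def power_divide power_mult_distrib field_simps)
    also have "\<rho>\<^sub>0\<^sup>2 * (cos \<phi>)\<^sup>2 + \<rho>\<^sub>0\<^sup>2 * (sin \<phi>)\<^sup>2 = \<rho>\<^sub>0\<^sup>2" by (simp add: distrib_left[symmetric])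
    finally show ?thesis by (simp add: power_divide)
  qed
  then have "focus = \<rho>\<^sub>0 / cos \<phi>" unfolding focus_def using \<rho>\<^sub>0 cos_\<phi> by simp
  then show ?thesis using cos_\<phi> by simp
qed

lemma focus_pos: "focus > 0" using focus_cos \<rho>\<^sub>0 cos_\<phi> by (metis zero_less_mult_pos2)

lemma angles: "0 < \<delta>" "\<theta> < pi / 2" "focus * cos \<theta> = \<rho>\<^sub>1" "0 < \<psi>" "\<phi> < \<psi>" "\<psi> < \<theta>" "\<phi> < \<theta>" "\<psi> < pi"
proof -
  have th: "\<theta> = arccos (\<rho>\<^sub>1 / focus)" by (simp add: \<theta>_def \<delta>_def d1_def focus_def)
  have r: "0 < \<rho>\<^sub>1 / focus" "\<rho>\<^sub>1 / focus < cos \<phi>" using \<rho>\<^sub>1 focus_pos focus_cos by (auto simp: divide_less_eq mult.commute)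
  have r1: "\<rho>\<^sub>1 / focus < 1" using r(2) cos_le_one[of \<phi>] by linarith
  have ct: "cos \<theta> = \<rho>\<^sub>1 / focus" unfolding th using r r1 by (intro cos_arccos) auto
  have "0 \<le> \<theta>" "\<theta> \<le> pi" unfolding th using r r1 by (auto intro: arccos_lbound arccos_ubound)
  then have "\<phi> < \<theta>" using cos_mono_less_eq[of \<theta> \<phi>] ct r \<phi> by auto
  moreover have "\<theta> < pi / 2"
    using arccos_less_arccos[of 0 "\<rho>\<^sub>1 / focus"] r r1 by (simp add: th)
  ultimately show "0 < \<delta>" "\<theta> < pi / 2" "focus * cos \<theta> = \<rho>\<^sub>1" "0 < \<psi>" "\<phi> < \<psi>" "\<psi> < \<theta>" "\<phi> < \<theta>" "\<psi> < pi"
    using ct focus_pos \<phi> by (auto simp: \<theta>_def \<psi>_def)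
qed

definition zeta :: "complex \<Rightarrow> complex" where "zeta w = of_real focus * cosh w"
definition zeta' :: "complex \<Rightarrow> complex" where "zeta' w = of_real focus * sinh w"

lemma hyp_z_eq: "hyp_z \<rho>\<^sub>0 \<phi> \<rho>\<^sub>1 \<xi> = zeta (Complex \<xi> (-\<psi>))"
  and hyp_z'_eq: "hyp_z' \<rho>\<^sub>0 \<phi> \<rho>\<^sub>1 \<xi> = zeta' (Complex \<xi> (-\<psi>))"
  by (simp_all add: hyp_z_def hyp_z'_def zeta_def zeta'_def complex_eq_iff Re_cosh_complex Im_cosh_complex
      Re_sinh_complex Im_sinh_complex a_I_def b_I_def focus_def[symmetric] \<delta>_def[symmetric] \<psi>_def[symmetric])

lemma zeta_holomorphic: "zeta holomorphic_on X" and zeta'_holomorphic: "zeta' holomorphic_on X"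
  unfolding zeta_def[abs_def] zeta'_def[abs_def] cosh_field_def sinh_field_def
  by (intro holomorphic_intros; simp)+

lemma sholo_zeta: "sholo X zeta" and sholo_zeta': "sholo X zeta'"
  using holomorphic_on_imp_sholo[OF zeta_holomorphic open_UNIV] holomorphic_on_imp_sholo[OF zeta'_holomorphic open_UNIV]
  by auto

lemma cmod_zeta_ge: "focus * \<bar>sinh (Re w)\<bar> \<le> cmod (zeta w)"
  using abs_sinh_le_cmod_cosh[of w] focus_pos by (simp add: zeta_def norm_mult)

lemma cmod_zeta'_le: "cmod (zeta' w) \<le> focus * cosh (Re w)"
  using cmod_sinh_le[of w] focus_pos by (simp add: zeta'_def norm_mult)

text \<open>Up to a positive factor the claim is \<open>sin \<phi> (cosh x cos s - cos \<phi>) \<le> cos \<phi> sinh |x| sin s\<close> with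
  \<open>s = - Im w\<close>. For \<open>\<phi> \<le> s \<le> \<pi>/2\<close> it follows from \<open>sin (s - \<phi>) \<ge> 0\<close> and \<open>cosh x - sinh |x| \<le> 1\<close>; for
  larger \<open>s\<close> the left-hand side is negative.\<close>
lemma zeta_in_\<Omega>:
  assumes "- pi \<le> Im w" "Im w \<le> - \<phi>"
  shows "zeta w \<in> \<Omega>"
proof -
  define s where "s = - Im w"
  define x where "x = Re w"
  have s: "\<phi> \<le> s" "s \<le> pi" using assms by (auto simp: s_def)
  have Re: "Re (zeta w) = focus * (cosh x * cos s)" and Im: "\<bar>Im (zeta w)\<bar> = focus * (sinh \<bar>x\<bar> * sin s)"
  proof -
    have "sin s \<ge> 0" using s \<phi> by (intro sin_ge_zero) auto
    then show "\<bar>Im (zeta w)\<bar> = focus * (sinh \<bar>x\<bar> * sin s)"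
      using focus_pos by (simp add: zeta_def Im_cosh_complex s_def x_def abs_mult)
  qed (simp add: zeta_def Re_cosh_complex s_def x_def)
  have sins: "sin s \<ge> 0" using s \<phi> by (intro sin_ge_zero) auto
  have key: "sin \<phi> * (cosh x * cos s - cos \<phi>) \<le> cos \<phi> * (sinh \<bar>x\<bar> * sin s)"
  proof (cases "cos s \<le> 0")
    case True
    then have "cosh x * cos s \<le> 0" by (simp add: mult_nonneg_nonpos)
    then have "cosh x * cos s - cos \<phi> \<le> 0" using cos_\<phi> by linarith
    then have "sin \<phi> * (cosh x * cos s - cos \<phi>) \<le> 0" using sin_\<phi> by (simp add: mult_nonneg_nonpos)
    also have "0 \<le> cos \<phi> * (sinh \<bar>x\<bar> * sin s)" using cos_\<phi> sins by simp
    finally show ?thesis .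
  next
    case False
    have "s < pi / 2"
    proof (rule ccontr)
      assume "\<not> s < pi / 2"
      then have "cos s \<le> cos (pi / 2)" using s by (intro cos_monotone_0_pi_le) auto
      with False show False by simp
    qed
    have ge: "sin \<phi> * cos s \<le> cos \<phi> * sin s"
    proof -
      have "0 \<le> sin (s - \<phi>)" using s \<phi> by (intro sin_ge_zero) auto
      then show ?thesis by (simp add: sin_diff mult.commute)
    qed
    have "cosh x - sinh \<bar>x\<bar> \<le> 1" by (cases "x \<ge> 0") (simp_all add: cosh_minus_sinh cosh_plus_sinh)
    moreover have "cos s \<le> cos \<phi>" using s \<phi> by (intro cos_monotone_0_pi_le) auto
    ultimately have "(cosh x - sinh \<bar>x\<bar>) * cos s \<le> 1 * cos \<phi>" using False by (intro mult_mono) auto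
    then have "sin \<phi> * (cosh x * cos s - cos \<phi>) \<le> sin \<phi> * (sinh \<bar>x\<bar> * cos s)"
      using sin_\<phi> by (intro mult_left_mono) (auto simp: algebra_simps)
    also have "\<dots> = sinh \<bar>x\<bar> * (sin \<phi> * cos s)" by simp
    also have "\<dots> \<le> sinh \<bar>x\<bar> * (cos \<phi> * sin s)" using ge by (intro mult_left_mono) auto
    finally show ?thesis by (simp add: mult_ac)
  qed
  have "tan \<phi> * (Re (zeta w) - focus * cos \<phi>) = focus * (sin \<phi> * (cosh x * cos s - cos \<phi>)) / cos \<phi>"
    unfolding Re tan_def using cos_\<phi> by (simp add: field_simps)
  then have "tan \<phi> * (Re (zeta w) - \<rho>\<^sub>0) = focus * (sin \<phi> * (cosh x * cos s - cos \<phi>)) / cos \<phi>"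
    unfolding focus_cos .
  also have "\<dots> \<le> focus * (cos \<phi> * (sinh \<bar>x\<bar> * sin s)) / cos \<phi>"
    using key focus_pos cos_\<phi> by (intro divide_right_mono mult_left_mono) auto
  also have "\<dots> = \<bar>Im (zeta w)\<bar>" unfolding Im using cos_\<phi> by simp
  finally show ?thesis by (simp add: \<Omega>_def)
qed

lemma Re_zeta_ge:
  assumes "- \<theta> \<le> Im w" "Im w \<le> \<theta>"
  shows "\<rho>\<^sub>1 * cosh (Re w) \<le> Re (zeta w)"
proof -
  have "cos \<theta> \<le> cos \<bar>Im w\<bar>" using assms angles by (intro cos_monotone_0_pi_le) auto
  then have "focus * cos \<theta> * cosh (Re w) \<le> focus * cos (Im w) * cosh (Re w)"
    using focus_pos by (intro mult_right_mono mult_left_mono) auto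
  then show ?thesis by (simp add: angles(3) zeta_def Re_cosh_complex mult_ac)
qed

lemma
  assumes "- \<theta> \<le> Im w" "Im w \<le> \<theta>"
  shows Re_zeta_ge_\<rho>\<^sub>1: "\<rho>\<^sub>1 \<le> Re (zeta w)" and zeta_nonzero: "zeta w \<noteq> 0"
    and cmod_zeta_ge_cosh: "\<rho>\<^sub>1 * cosh (Re w) \<le> cmod (zeta w)"
proof -
  have "\<rho>\<^sub>1 * 1 \<le> \<rho>\<^sub>1 * cosh (Re w)" using \<rho>\<^sub>1 by (intro mult_left_mono cosh_real_ge_1) auto
  then show 1: "\<rho>\<^sub>1 \<le> Re (zeta w)" using Re_zeta_ge[OF assms] by linarith
  then show "zeta w \<noteq> 0" using \<rho>\<^sub>1 by auto
  show "\<rho>\<^sub>1 * cosh (Re w) \<le> cmod (zeta w)"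
    using Re_zeta_ge[OF assms] complex_Re_le_cmod order_trans by blast
qed

definition q1 :: real where "q1 = (\<Sum>i=1..m. \<bar>al i\<bar> * exp (- \<rho>\<^sub>1 * tt i))"

abbreviation Binv :: "complex \<Rightarrow> complex" where "Binv \<equiv> B_inv_symbol m al tt"

lemma symbol_bound:
  assumes "\<rho>\<^sub>1 \<le> Re z"
  shows "1 - q1 \<le> cmod (1 + (\<Sum>i=1..m. of_real (al i) * exp (- z * of_real (tt i))))"
proof -
  let ?s = "\<Sum>i=1..m. of_real (al i) * exp (- z * of_real (tt i))"
  have "cmod ?s \<le> q1" unfolding q1_def
  proof (rule sum_norm_le)
    fix i assume i: "i \<in> {1..m}"
    have "\<rho>\<^sub>1 * tt i \<le> Re z * tt i" using assms tt_nonneg[OF i] by (rule mult_right_mono)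
    then show "cmod (of_real (al i) * exp (- z * of_real (tt i))) \<le> \<bar>al i\<bar> * exp (- \<rho>\<^sub>1 * tt i)"
      by (simp add: norm_mult norm_exp_eq_Re mult_left_mono)
  qed
  moreover have "1 - cmod ?s \<le> cmod (1 + ?s)" using norm_triangle_ineq2[of 1 "- ?s"] by simp
  ultimately show ?thesis by linarith
qed

lemma q1: "q1 < 1" using small by (simp add: q1_def)

lemma symbol_nonzero: "\<rho>\<^sub>1 \<le> Re z \<Longrightarrow> 1 + (\<Sum>i=1..m. of_real (al i) * exp (- z * of_real (tt i))) \<noteq> 0"
  using symbol_bound[of z] q1 by auto

lemma cmod_Binv_le: "\<rho>\<^sub>1 \<le> Re z \<Longrightarrow> cmod (Binv z) \<le> 1 / (1 - q1)"
  using symbol_bound[of z] q1 unfolding B_inv_symbol_def norm_inverse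
  by (simp add: inverse_eq_divide frac_le)

lemma sholo_Binv: "sholo {z. \<rho>\<^sub>1 \<le> Re z} Binv"
proof -
  define s where "s z = 1 + (\<Sum>i=1..m. of_real (al i) * exp (- z * of_real (tt i)))" for z :: complex
  have s: "s holomorphic_on X" for X unfolding s_def[abs_def] by (intro holomorphic_intros)
  have op: "open {z. s z \<noteq> 0}"
    using holomorphic_on_imp_continuous_on[OF s[of UNIV]] by (intro open_Collect_neq) auto
  have "Binv = (\<lambda>z. inverse (s z))" by (simp add: B_inv_symbol_def[abs_def] s_def[abs_def])
  then have hol: "Binv holomorphic_on {z. s z \<noteq> 0}" by (auto intro!: holomorphic_intros s)
  have "{z. \<rho>\<^sub>1 \<le> Re z} \<subseteq> {z. s z \<noteq> 0}"
    by (intro subsetI CollectI) (simp only: mem_Collect_eq s_def symbol_nonzero not_False_eq_True)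
  then show ?thesis by (rule holomorphic_on_imp_sholo[OF hol op])
qed

lemma sholo_Binv_zeta: "sholo {w. - \<theta> \<le> Im w \<and> Im w \<le> 0} (\<lambda>w. Binv (zeta w))"
proof (rule sholo_compose[OF sholo_Binv sholo_zeta])
  have "0 \<le> \<theta>" using angles(7) \<phi>(1) by linarith
  then show "zeta ` {w. - \<theta> \<le> Im w \<and> Im w \<le> 0} \<subseteq> {z. \<rho>\<^sub>1 \<le> Re z}"
    by (intro image_subsetI CollectI Re_zeta_ge_\<rho>\<^sub>1) (simp_all add: order_trans[of "Im _" 0 \<theta>])
qed

lemma sholo_inverse_zeta: "sholo {w. - \<theta> \<le> Im w \<and> Im w \<le> 0} (\<lambda>w. 1 / zeta w)"
proof (rule holomorphic_on_imp_sholo)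
  show "(\<lambda>w. 1 / zeta w) holomorphic_on {w. zeta w \<noteq> 0}" by (intro holomorphic_intros zeta_holomorphic) auto
  show "open {w. zeta w \<noteq> 0}"
    using holomorphic_on_imp_continuous_on[OF zeta_holomorphic[of UNIV]] by (intro open_Collect_neq) auto
  have "0 \<le> \<theta>" using angles(7) \<phi>(1) by linarith
  then show "{w. - \<theta> \<le> Im w \<and> Im w \<le> 0} \<subseteq> {w. zeta w \<noteq> 0}"
    by (intro subsetI CollectI zeta_nonzero) (simp_all add: order_trans[of "Im _" 0 \<theta>])
qed

text \<open>The integrand of the quadrature as a function of the complex variable \<open>w\<close>; the integration line is
  \<open>Im w = -\<psi>\<close>.\<close>
definition F :: "'a \<Rightarrow> real \<Rightarrow> complex \<Rightarrow> 'a" where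
  "F u t w = (exp (- zeta w * of_real t) * zeta' w * Binv (zeta w)) *\<^sub>C (R (zeta w) u - (1 / zeta w) *\<^sub>C u)"

lemma integrand_eq: "integrand D A \<rho>\<^sub>0 \<phi> \<rho>\<^sub>1 m al tt u t \<xi> = F u t (Complex \<xi> (-\<psi>))"
  by (simp add: integrand_def F_def hyp_z_eq hyp_z'_eq Let_def)

lemma vholo_F: "vholo {w. - \<theta> \<le> Im w \<and> Im w \<le> - \<phi>} (F u t)"
proof -
  let ?X = "{w. - \<theta> \<le> Im w \<and> Im w \<le> - \<phi>}"
  have sub: "?X \<subseteq> {w. - \<theta> \<le> Im w \<and> Im w \<le> 0}" using \<phi> by auto
  have e: "sholo ?X (\<lambda>w. exp (- zeta w * of_real t) * zeta' w)"
  proof (rule holomorphic_on_imp_sholo[of _ UNIV])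
    show "(\<lambda>w. exp (- zeta w * of_real t) * zeta' w) holomorphic_on UNIV"
      unfolding zeta_def zeta'_def cosh_field_def sinh_field_def by (intro holomorphic_intros; simp)
  qed simp_all
  have r: "vholo ?X (\<lambda>w. R (zeta w) u)"
  proof (rule vholo_compose[OF vholo_R sholo_zeta])
    have "\<theta> \<le> pi" using angles(2) pi_gt_zero by linarith
    then show "zeta ` ?X \<subseteq> \<Omega>" by (intro image_subsetI zeta_in_\<Omega>) simp_all
  qed
  have i: "vholo ?X (\<lambda>w. (1 / zeta w) *\<^sub>C u)"
    by (rule vholo_subset[OF vholo_scaleC[OF sholo_inverse_zeta vholo_const] sub])
  have b: "vholo ?X (\<lambda>w. Binv (zeta w) *\<^sub>C (R (zeta w) u - (1 / zeta w) *\<^sub>C u))"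
    by (rule vholo_scaleC[OF sholo_subset[OF sholo_Binv_zeta sub] vholo_diff[OF r i]])
  show ?thesis
    by (rule vholo_cong[OF vholo_scaleC[OF e b]]) (simp only: F_def scaleC_scaleC)
qed

text \<open>The property of the initial value on which everything below depends: vectors in the domain of \<open>A\<close> have it with
  \<open>\<beta> = 1\<close>, vectors in the domain of \<open>A\<^sup>\<alpha>\<close> with \<open>\<beta> = \<alpha>\<close>.\<close>
definition resolvent_decay :: "'a \<Rightarrow> real \<Rightarrow> real \<Rightarrow> bool" where
  "resolvent_decay u C \<beta> \<longleftrightarrow> \<beta> > 0 \<and> C \<ge> 0 \<and>
     (\<forall>z\<in>\<Omega>. \<rho>\<^sub>1 \<le> Re z \<longrightarrow> norm (R z u - (1 / z) *\<^sub>C u) \<le> C * (cmod z) powr (-1 - \<beta>))"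

lemma resolvent_decayD:
  assumes "resolvent_decay u C \<beta>"
  shows "\<beta> > 0" "C \<ge> 0"
    "z \<in> \<Omega> \<Longrightarrow> \<rho>\<^sub>1 \<le> Re z \<Longrightarrow> norm (R z u - (1 / z) *\<^sub>C u) \<le> C * (cmod z) powr (-1 - \<beta>)"
  using assms unfolding resolvent_decay_def by blast+

lemma resolvent_decay_on_D: "u \<in> D \<Longrightarrow> resolvent_decay u (M * norm (A u)) 1"
proof -
  assume u: "u \<in> D"
  have "norm (R z u - (1 / z) *\<^sub>C u) \<le> M * norm (A u) * (cmod z) powr (-1 - 1)" if "z \<in> \<Omega>" "\<rho>\<^sub>1 \<le> Re z" for z
  proof -
    have z: "z \<noteq> 0" using that \<rho>\<^sub>1 by auto
    then have "(cmod z) powr (-1 - 1) = 1 / (cmod z)\<^sup>2"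
      using powr_minus_divide[of "cmod z" 2] powr_numeral[of "cmod z" "Num.Bit0 Num.One"] by simp
    then show ?thesis using R_minus_inverse_decay_on_D[OF that(1) z u] by simp
  qed
  moreover have "0 \<le> M * norm (A u)" using M by simp
  ultimately show ?thesis unfolding resolvent_decay_def using zero_less_one by blast
qed

definition decay_const :: "real \<Rightarrow> real" where
  "decay_const \<beta> = focus / \<rho>\<^sub>1 * (\<rho>\<^sub>1 / 2) powr (-\<beta>) / (1 - q1)"

lemma decay_const_pos: "decay_const \<beta> > 0"
  using focus_pos \<rho>\<^sub>1 q1 by (simp add: decay_const_def)

text \<open>The modulus of \<open>z'\<close> is at most \<open>focus * cosh x\<close>, while \<open>|z| \<ge> Re z \<ge> \<rho>\<^sub>1 cosh x\<close> throughout the strip.\<close>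
lemma F_bound:
  assumes u: "resolvent_decay u C \<beta>" and w: "- \<theta> \<le> Im w" "Im w \<le> - \<phi>" and t: "t \<ge> 0"
  shows "norm (F u t w) \<le> decay_const \<beta> * C * exp (- t * \<rho>\<^sub>1 * cosh (Re w)) * exp (- \<beta> * \<bar>Re w\<bar>)"
proof -
  let ?z = "zeta w" and ?x = "Re w"
  have w': "- \<theta> \<le> Im w" "Im w \<le> \<theta>" "- pi \<le> Im w"
    using w angles(2,7) \<phi> pi_gt_zero by linarith+
  have \<beta>: "\<beta> > 0" "C \<ge> 0" by (rule resolvent_decayD[OF u])+
  have ch: "cosh ?x > 0" by simp
  have e: "cmod (exp (- ?z * of_real t)) \<le> exp (- t * \<rho>\<^sub>1 * cosh ?x)"
    using mult_left_mono[OF Re_zeta_ge[OF w'(1,2)] t] by (simp add: norm_exp_eq_Re mult_ac)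
  have r: "norm (R ?z u - (1 / ?z) *\<^sub>C u) \<le> C * (\<rho>\<^sub>1 * cosh ?x) powr (-1 - \<beta>)"
  proof -
    have "norm (R ?z u - (1 / ?z) *\<^sub>C u) \<le> C * (cmod ?z) powr (-1 - \<beta>)"
      by (rule resolvent_decayD(3)[OF u zeta_in_\<Omega>[OF w'(3) w(2)] Re_zeta_ge_\<rho>\<^sub>1[OF w'(1,2)]])
    also have "\<dots> \<le> C * (\<rho>\<^sub>1 * cosh ?x) powr (-1 - \<beta>)"
      using \<beta> \<rho>\<^sub>1 ch cmod_zeta_ge_cosh[OF w'(1,2)] by (intro mult_left_mono powr_mono2') auto
    finally show ?thesis .
  qed
  have p: "(\<rho>\<^sub>1 * cosh ?x) powr (-1 - \<beta>) * (focus * cosh ?x) \<le> focus / \<rho>\<^sub>1 * ((\<rho>\<^sub>1 / 2) powr (-\<beta>) * exp (- \<beta> * \<bar>?x\<bar>))"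
  proof -
    have "(\<rho>\<^sub>1 * cosh ?x) powr (-1 - \<beta>) = (\<rho>\<^sub>1 * cosh ?x) powr (-\<beta>) / (\<rho>\<^sub>1 * cosh ?x)"
    proof -
      have e: "-1 - \<beta> = - \<beta> - 1" by simp
      have "\<rho>\<^sub>1 * cosh ?x > 0" using \<rho>\<^sub>1(1) ch by (rule mult_pos_pos)
      then show ?thesis unfolding e powr_diff by simp
    qed
    then have "(\<rho>\<^sub>1 * cosh ?x) powr (-1 - \<beta>) * (focus * cosh ?x) = focus / \<rho>\<^sub>1 * (\<rho>\<^sub>1 * cosh ?x) powr (-\<beta>)"
      using \<rho>\<^sub>1 ch by simp
    also have "\<dots> \<le> focus / \<rho>\<^sub>1 * (\<rho>\<^sub>1 / 2 * exp \<bar>?x\<bar>) powr (-\<beta>)"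
    proof -
      have "\<rho>\<^sub>1 * (exp \<bar>?x\<bar> / 2) \<le> \<rho>\<^sub>1 * cosh ?x" using \<rho>\<^sub>1 exp_abs_le_cosh by (intro mult_left_mono) auto
      then show ?thesis using focus_pos \<rho>\<^sub>1 \<beta> by (intro mult_left_mono powr_mono2') auto
    qed
    also have "(\<rho>\<^sub>1 / 2 * exp \<bar>?x\<bar>) powr (-\<beta>) = (\<rho>\<^sub>1 / 2) powr (-\<beta>) * exp (- \<beta> * \<bar>?x\<bar>)"
      using \<rho>\<^sub>1 by (subst powr_mult) (auto simp: exp_powr_real mult.commute)
    finally show ?thesis .
  qed
  have "norm (F u t w) = cmod (exp (- ?z * of_real t)) * cmod (zeta' w) * cmod (Binv ?z) * norm (R ?z u - (1 / ?z) *\<^sub>C u)"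
    by (simp only: F_def norm_scaleC norm_mult)
  also have "\<dots> \<le> exp (- t * \<rho>\<^sub>1 * cosh ?x) * (focus * cosh ?x) * (1 / (1 - q1)) * (C * (\<rho>\<^sub>1 * cosh ?x) powr (-1 - \<beta>))"
    by (intro mult_mono e cmod_zeta'_le cmod_Binv_le Re_zeta_ge_\<rho>\<^sub>1[OF w'(1,2)] r mult_nonneg_nonneg)
      (use focus_pos q1 in simp_all)
  also have "\<dots> = exp (- t * \<rho>\<^sub>1 * cosh ?x) * (1 / (1 - q1)) * C * ((\<rho>\<^sub>1 * cosh ?x) powr (-1 - \<beta>) * (focus * cosh ?x))"
    by (simp add: mult_ac)
  also have "\<dots> \<le> exp (- t * \<rho>\<^sub>1 * cosh ?x) * (1 / (1 - q1)) * C * (focus / \<rho>\<^sub>1 * ((\<rho>\<^sub>1 / 2) powr (-\<beta>) * exp (- \<beta> * \<bar>?x\<bar>)))"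
    using q1 \<beta> by (intro mult_left_mono p) auto
  also have "\<dots> = decay_const \<beta> * C * exp (- t * \<rho>\<^sub>1 * cosh ?x) * exp (- \<beta> * \<bar>?x\<bar>)"
    by (simp add: decay_const_def mult_ac)
  finally show ?thesis .
qed

lemma F_bound':
  assumes u: "resolvent_decay u C \<beta>" and w: "- \<theta> \<le> Im w" "Im w \<le> - \<phi>" and t: "t \<ge> 0"
  shows "norm (F u t w) \<le> decay_const \<beta> * C * exp (- \<beta> * \<bar>Re w\<bar>)"
proof -
  have "C \<ge> 0" by (rule resolvent_decayD(2)[OF u])
  have "0 \<le> t * \<rho>\<^sub>1 * cosh (Re w)" using t \<rho>\<^sub>1 by (intro mult_nonneg_nonneg) auto
  then have "exp (- t * \<rho>\<^sub>1 * cosh (Re w)) \<le> 1" by simp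
  then have "decay_const \<beta> * C * exp (- t * \<rho>\<^sub>1 * cosh (Re w)) * exp (- \<beta> * \<bar>Re w\<bar>)
      \<le> decay_const \<beta> * C * 1 * exp (- \<beta> * \<bar>Re w\<bar>)"
    using \<open>C \<ge> 0\<close> less_imp_le[OF decay_const_pos[of \<beta>]] by (intro mult_right_mono mult_left_mono) auto
  with F_bound[OF assms] show ?thesis by linarith
qed

end

section \<open>The contour representation of the solution\<close>

context nonlocal_problem
begin

lemma \<psi>_line: "- \<theta> \<le> - \<psi>" "- \<psi> \<le> - \<phi>" "- pi \<le> - \<psi>" "- \<psi> \<le> \<theta>"
  using angles(4-8) \<phi>(1) by linarith+

lemma zeta_\<psi>: "zeta (Complex x (-\<psi>)) \<in> \<Omega>" "\<rho>\<^sub>1 \<le> Re (zeta (Complex x (-\<psi>)))" "zeta (Complex x (-\<psi>)) \<noteq> 0"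
  using zeta_in_\<Omega>[of "Complex x (-\<psi>)"] Re_zeta_ge_\<rho>\<^sub>1[of "Complex x (-\<psi>)"]
    zeta_nonzero[of "Complex x (-\<psi>)"] \<psi>_line by simp_all

lemma continuous_on_F_line: "continuous_on X (\<lambda>x. F u t (Complex x (-\<psi>)))"
  by (rule continuous_on_hline[OF vholo_continuous_on[OF vholo_F]]) (use \<psi>_line in simp)

lemma F_integrable:
  assumes "resolvent_decay u C \<beta>" "t \<ge> 0"
  shows "(\<lambda>x. F u t (Complex x (-\<psi>))) integrable_on UNIV"
proof (rule exp_decay_integrable[where L=0])
  show "continuous_on UNIV (\<lambda>x. F u t (Complex x (-\<psi>)))" by (rule continuous_on_F_line)
  show "\<beta> > 0" by (rule resolvent_decayD[OF assms(1)])
  show "norm (F u t (Complex x (-\<psi>))) \<le> decay_const \<beta> * C * exp (- \<beta> * \<bar>x\<bar>)" for x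
    using F_bound'[OF assms(1) _ _ assms(2), of "Complex x (-\<psi>)"] \<psi>_line by simp
qed simp

definition contour_sol :: "real \<Rightarrow> 'a \<Rightarrow> 'a" where
  "contour_sol t u = (1 / (2 * of_real pi * \<i>)) *\<^sub>C integral UNIV (\<lambda>x. F u t (Complex x (-\<psi>)))"

text \<open>A bounded operator that commutes with the resolvent can be pulled through the integral. This serves \<open>S(t)\<close>, \<open>B\<close>
  and \<open>A\<^sup>-\<^sup>1\<close> alike.\<close>
lemma contour_sol_commute:
  assumes P: "bounded_clinear P" and PR: "\<And>z x. z \<in> \<Omega> \<Longrightarrow> P (R z x) = R z (P x)"
    and u: "resolvent_decay u C \<beta>" and t: "t \<ge> 0"
  shows "P (contour_sol t u) = contour_sol t (P u)"
proof -
  have bl: "bounded_linear P" and PC: "\<And>c x. P (c *\<^sub>C x) = c *\<^sub>C P x"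
    using P by (auto simp: bounded_clinear_def)
  have "P (F u t (Complex x (-\<psi>))) = F (P u) t (Complex x (-\<psi>))" for x
    unfolding F_def by (simp add: PC linear_simps(2)[OF bl] PR zeta_\<psi>)
  then have "P (integral UNIV (\<lambda>x. F u t (Complex x (-\<psi>)))) = integral UNIV (\<lambda>x. F (P u) t (Complex x (-\<psi>)))"
    using integral_linear[OF F_integrable[OF u t] bl] by (simp add: o_def)
  then show ?thesis by (simp add: contour_sol_def PC)
qed

text \<open>By Duhamel's formula the difference of the two integrands is \<open>z' B\<^sup>-\<^sup>1(z) \<Theta>(z) / z\<close> with a finite Laplace
  transform \<open>\<Theta>\<close>. It is analytic between the integration line and the real axis, decays like \<open>1 / cosh x\<close>, and is odd
  on the real axis.\<close>
lemma S_contour_sol_on_D: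
  assumes u: "u \<in> D" and t: "t \<ge> 0"
  shows "S t (contour_sol 0 u) = contour_sol t u"
proof -
  define y where "y = A u"
  define \<Theta> where "\<Theta> z = integral {0..t} (\<lambda>s. exp (- z * of_real (t - s)) *\<^sub>C S s y)" for z
  define H where "H w = (zeta' w * Binv (zeta w)) *\<^sub>C (1 / zeta w) *\<^sub>C \<Theta> (zeta w)" for w
  note dec = resolvent_decay_on_D[OF u]
  have diff: "S t (F u 0 w) - F u t w = H w" if w: "w = Complex x (-\<psi>)" for w x
  proof -
    let ?z = "zeta w"
    have z: "?z \<in> \<Omega>" "?z \<noteq> 0" using zeta_\<psi> w by auto
    have R: "R ?z u - (1 / ?z) *\<^sub>C u = (1 / ?z) *\<^sub>C R ?z y"
      unfolding y_def by (rule R_minus_inverse_on_D[OF z u])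
    have "S t (F u 0 w) = (zeta' w * Binv ?z) *\<^sub>C (1 / ?z) *\<^sub>C S t (R ?z y)"
      by (simp add: F_def R S_scaleC t)
    moreover have "F u t w = (zeta' w * Binv ?z) *\<^sub>C (1 / ?z) *\<^sub>C exp (- ?z * of_real t) *\<^sub>C R ?z y"
      by (simp add: F_def R scaleC_scaleC mult_ac)
    ultimately show ?thesis unfolding H_def \<Theta>_def S_R_Duhamel[OF z(1) t, symmetric]
      by (simp only: scaleC.diff_right)
  qed
  have zero: "integral UNIV (\<lambda>x. H (Complex x (-\<psi>))) = 0"
  proof -
    obtain K where K: "K > 0" "\<And>z y. Re z > 0 \<Longrightarrow>
        norm (integral {0..t} (\<lambda>s. exp (- z * of_real (t - s)) *\<^sub>C S s y)) \<le> K * norm y / Re z"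
      using S_Laplace_bound[OF t] by blast
    define C where "C = focus / (1 - q1) * (K * norm y / (\<rho>\<^sub>1 * \<rho>\<^sub>1)) * 2"
    let ?X = "{w. - \<psi> \<le> Im w \<and> Im w \<le> 0}"
    have sub: "?X \<subseteq> {w. - \<theta> \<le> Im w \<and> Im w \<le> 0}" using \<psi>_line by auto
    show ?thesis
    proof (rule contour_integral_zero_if_odd)
      have "vholo UNIV \<Theta>" unfolding \<Theta>_def[abs_def] by (rule vholo_finite_Laplace[OF S_continuous_on t])
      then have T: "vholo ?X (\<lambda>w. \<Theta> (zeta w))" by (rule vholo_compose[OF _ sholo_zeta]) simp
      have "vholo ?X (\<lambda>w. zeta' w *\<^sub>C Binv (zeta w) *\<^sub>C (1 / zeta w) *\<^sub>C \<Theta> (zeta w))"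
        by (intro vholo_scaleC sholo_zeta' sholo_subset[OF sholo_Binv_zeta sub] sholo_subset[OF sholo_inverse_zeta sub] T)
      then show "vholo ?X H" by (rule vholo_cong) (simp only: H_def scaleC_scaleC mult.assoc)
      show "- \<psi> < 0" using angles(4) by simp
      show "(1::real) > 0" by simp
      show "norm (H w) \<le> C * exp (- 1 * \<bar>Re w\<bar>)" if w: "- \<psi> \<le> Im w" "Im w \<le> 0" for w
      proof -
        have w': "- \<theta> \<le> Im w" "Im w \<le> \<theta>" using w \<psi>_line angles(7) \<phi>(1) by linarith+
        let ?c = "cosh (Re w)"
        have c: "?c > 0" by simp
        have Rz: "\<rho>\<^sub>1 * ?c \<le> Re (zeta w)" by (rule Re_zeta_ge[OF w'])
        have pc: "\<rho>\<^sub>1 * ?c > 0" using \<rho>\<^sub>1 c by simp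
        have 1: "norm (\<Theta> (zeta w)) \<le> K * norm y / (\<rho>\<^sub>1 * ?c)"
        proof -
          have "norm (\<Theta> (zeta w)) \<le> K * norm y / Re (zeta w)" unfolding \<Theta>_def using Rz pc by (intro K) linarith
          also have "\<dots> \<le> K * norm y / (\<rho>\<^sub>1 * ?c)" using Rz pc K(1) less_le_trans[OF pc Rz] \<rho>\<^sub>1(1) by (intro divide_left_mono mult_pos_pos) auto
          finally show ?thesis .
        qed
        have 2: "cmod (1 / zeta w) \<le> 1 / (\<rho>\<^sub>1 * ?c)"
          unfolding norm_divide norm_one using cmod_zeta_ge_cosh[OF w'] pc \<rho>\<^sub>1(1) zeta_nonzero[OF w'] by (intro divide_left_mono mult_pos_pos) auto
        have "norm (H w) = cmod (zeta' w) * cmod (Binv (zeta w)) * (cmod (1 / zeta w) * norm (\<Theta> (zeta w)))"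
          by (simp only: H_def norm_scaleC norm_mult)
        also have "\<dots> \<le> (focus * ?c) * (1 / (1 - q1)) * (1 / (\<rho>\<^sub>1 * ?c) * (K * norm y / (\<rho>\<^sub>1 * ?c)))"
          by (intro mult_mono cmod_zeta'_le cmod_Binv_le Re_zeta_ge_\<rho>\<^sub>1[OF w'] 1 2 mult_nonneg_nonneg norm_ge_zero)
            (use focus_pos q1 pc K(1) in simp_all)
        also have "\<dots> = focus / (1 - q1) * (K * norm y / (\<rho>\<^sub>1 * \<rho>\<^sub>1)) * (1 / ?c)"
          using c by (simp add: divide_simps)
        also have "\<dots> \<le> focus / (1 - q1) * (K * norm y / (\<rho>\<^sub>1 * \<rho>\<^sub>1)) * (2 * exp (- \<bar>Re w\<bar>))"
        proof (rule mult_left_mono)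
          have "1 / ?c \<le> 1 / (exp \<bar>Re w\<bar> / 2)" using exp_abs_le_cosh[of "Re w"] c by (intro divide_left_mono mult_pos_pos) auto
          then show "1 / ?c \<le> 2 * exp (- \<bar>Re w\<bar>)" by (simp add: exp_minus field_simps)
          show "0 \<le> focus / (1 - q1) * (K * norm y / (\<rho>\<^sub>1 * \<rho>\<^sub>1))" using focus_pos q1 K(1) by simp
        qed
        finally show ?thesis by (simp add: C_def)
      qed
      show "H (Complex (-x) 0) = - H (Complex x 0)" for x
      proof -
        have "Complex (-x) 0 = - Complex x 0" by (simp add: complex_eq_iff)
        then have "zeta (Complex (-x) 0) = zeta (Complex x 0)" "zeta' (Complex (-x) 0) = - zeta' (Complex x 0)"
          by (simp_all add: zeta_def zeta'_def)
        then show ?thesis by (simp add: H_def scaleC.minus_left)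
      qed
    qed
  qed
  have i0: "(\<lambda>x. F u 0 (Complex x (-\<psi>))) integrable_on UNIV" by (rule F_integrable[OF dec]) simp
  have it: "(\<lambda>x. F u t (Complex x (-\<psi>))) integrable_on UNIV" by (rule F_integrable[OF dec t])
  have "S t (integral UNIV (\<lambda>x. F u 0 (Complex x (-\<psi>)))) - integral UNIV (\<lambda>x. F u t (Complex x (-\<psi>)))
      = integral UNIV (\<lambda>x. S t (F u 0 (Complex x (-\<psi>))) - F u t (Complex x (-\<psi>)))"
    using integral_linear[OF i0 S_bounded_linear[OF t]] integrable_linear[OF i0 S_bounded_linear[OF t]] it
    by (simp add: o_def Henstock_Kurzweil_Integration.integral_diff)
  also have "\<dots> = 0" using zero by (simp add: diff)
  finally show ?thesis by (simp add: contour_sol_def S_scaleC t)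
qed

text \<open>What remains of the integrand after \<open>B\<close> has cancelled the factor \<open>B\<^sup>-\<^sup>1(z)\<close>.\<close>
definition G :: "'a \<Rightarrow> complex \<Rightarrow> 'a" where
  "G u w = zeta' w *\<^sub>C (R (zeta w) u - (1 / zeta w) *\<^sub>C u)"

lemma F_sum_eq_G:
  "F u 0 (Complex x (-\<psi>)) + (\<Sum>i=1..m. al i *\<^sub>R F u (tt i) (Complex x (-\<psi>))) = G u (Complex x (-\<psi>))"
proof -
  let ?w = "Complex x (-\<psi>)"
  let ?z = "zeta ?w"
  define v where "v = R ?z u - (1 / ?z) *\<^sub>C u"
  have F: "F u t ?w = (exp (- ?z * of_real t) * (zeta' ?w * Binv ?z)) *\<^sub>C v" for t
    by (simp add: F_def v_def mult.assoc)
  have "(\<Sum>i=1..m. al i *\<^sub>R F u (tt i) ?w) = (\<Sum>i=1..m. (of_real (al i) * exp (- ?z * of_real (tt i)) * (zeta' ?w * Binv ?z)) *\<^sub>C v)"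
    by (simp add: F scaleR_scaleC scaleC_scaleC mult.assoc)
  also have "\<dots> = ((\<Sum>i=1..m. of_real (al i) * exp (- ?z * of_real (tt i))) * (zeta' ?w * Binv ?z)) *\<^sub>C v"
    by (simp add: scaleC.sum_left sum_distrib_right)
  finally have "F u 0 ?w + (\<Sum>i=1..m. al i *\<^sub>R F u (tt i) ?w)
      = ((1 + (\<Sum>i=1..m. of_real (al i) * exp (- ?z * of_real (tt i)))) * (zeta' ?w * Binv ?z)) *\<^sub>C v"
    using F[of 0] by (simp add: scaleC.add_left distrib_right)
  also have "(1 + (\<Sum>i=1..m. of_real (al i) * exp (- ?z * of_real (tt i)))) * (zeta' ?w * Binv ?z) = zeta' ?w"
    using symbol_nonzero[OF zeta_\<psi>(2)[of x]] unfolding B_inv_symbol_def by (simp del: of_real_minus)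
  finally show ?thesis by (simp add: G_def v_def)
qed

lemma sinh_cosh_bounds: "L \<ge> 1 \<Longrightarrow> exp L / 4 \<le> sinh (L::real)" "L \<ge> 1 \<Longrightarrow> cosh L \<le> exp (L::real)"
proof -
  assume L: "L \<ge> 1"
  have "exp (- L) \<le> 1" using L by simp
  moreover have "2 \<le> exp L" using exp_ge_add_one_self[of L] L by linarith
  moreover have "b / 4 \<le> (b - a) / 2 \<and> (b + a) / 2 \<le> b" if "a \<le> 1" "2 \<le> b" for a b :: real
    using that by simp
  ultimately show "exp L / 4 \<le> sinh L" "cosh L \<le> exp L"
    unfolding sinh_field_def cosh_field_def by blast+
qed

lemma tanh_near_sgn:
  assumes L: "L \<ge> 1" and w: "Re w = sg * L" "sg = 1 \<or> sg = -1"
  shows "cmod (sinh w / cosh w - of_real sg) \<le> 4 * exp (- L)"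
proof -
  have s: "exp L / 4 \<le> cmod (cosh w)"
    using sinh_cosh_bounds(1)[OF L] abs_sinh_le_cmod_cosh[of w] w by auto
  have pos: "cmod (cosh w) > 0" using s by (smt (verit) exp_gt_zero divide_pos_pos)
  then have ne: "cosh w \<noteq> 0" by auto
  have "sinh w - of_real sg * cosh w = - of_real sg * exp (- of_real sg * w)"
    using w(2) by (auto simp: sinh_field_def cosh_field_def field_simps)
  moreover have "sinh w / cosh w - of_real sg = (sinh w - of_real sg * cosh w) / cosh w"
    using ne by (simp add: diff_divide_distrib)
  ultimately have "sinh w / cosh w - of_real sg = - of_real sg * exp (- of_real sg * w) / cosh w"
    by (simp only:)
  then have "cmod (sinh w / cosh w - of_real sg) = exp (- L) / cmod (cosh w)"
    using w by (auto simp: norm_divide norm_mult norm_exp_eq_Re)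
  also have "\<dots> \<le> exp (- L) / (exp L / 4)" using s pos by (intro divide_left_mono) auto
  also have "\<dots> \<le> exp (- L) / (1 / 4)" using L by (intro divide_left_mono) auto
  finally show ?thesis by simp
qed

text \<open>The two parts of \<open>G = f1 - f2\<close>, \<open>f1 = z' R(z) u\<close> and \<open>f2 = (z'/z) u\<close>, continue analytically to different
  sides: the resolvent to the left, down to \<open>Im w = -\<pi>\<close>, and \<open>1/z\<close> to the right, up to \<open>Im w = 0\<close>. On these two
  lines the functions are odd, so only the vertical sides contribute. There both functions tend to \<open>\<plusminus>u\<close>, and
  the sides have total length \<open>(\<pi> - \<psi>) + \<psi>\<close> at either end, which gives \<open>2 \<pi> \<i> u\<close>. Neither integral
  converges on its own, hence the truncation at \<open>\<plusminus>L\<close>.\<close>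
lemma integral_G:
  assumes u: "u \<in> D"
  shows "(\<lambda>x. G u (Complex x (-\<psi>))) integrable_on UNIV"
    and "integral UNIV (\<lambda>x. G u (Complex x (-\<psi>))) = (2 * of_real pi * \<i>) *\<^sub>C u"
proof -
  define C1 where "C1 = M * norm (A u)"
  have C1: "C1 \<ge> 0" using M by (simp add: C1_def)
  define f1 where "f1 w = zeta' w *\<^sub>C R (zeta w) u" for w
  define f2 where "f2 w = (zeta' w * (1 / zeta w)) *\<^sub>C u" for w
  let ?X1 = "{w. - pi \<le> Im w \<and> Im w \<le> - \<psi>}" and ?X2 = "{w. - \<psi> \<le> Im w \<and> Im w \<le> 0}"
  have h1: "vholo ?X1 f1" unfolding f1_def[abs_def]
    by (intro vholo_scaleC sholo_zeta' vholo_compose[OF vholo_R sholo_zeta] image_subsetI zeta_in_\<Omega>)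
      (use \<psi>_line in auto)
  have h2: "vholo ?X2 f2"
  proof -
    have sub: "?X2 \<subseteq> {w. - \<theta> \<le> Im w \<and> Im w \<le> 0}" using \<psi>_line by auto
    have "vholo ?X2 (\<lambda>w. zeta' w *\<^sub>C (1 / zeta w) *\<^sub>C u)"
      by (intro vholo_scaleC sholo_zeta' sholo_subset[OF sholo_inverse_zeta sub] vholo_const)
    then show ?thesis by (rule vholo_cong) (simp only: f2_def scaleC_scaleC)
  qed
  have f12: "G u w = f1 w - f2 w" for w
    by (simp add: G_def f1_def f2_def scaleC.diff_right scaleC_scaleC)
  have cG: "continuous_on X (\<lambda>x. G u (Complex x (-\<psi>)))" for X
    unfolding f12 by (intro continuous_intros continuous_on_hline[OF vholo_continuous_on[OF h1]]
        continuous_on_hline[OF vholo_continuous_on[OF h2]]) (use \<psi>_line angles(4) in simp_all)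
  have bG: "norm (G u (Complex x (-\<psi>))) \<le> (focus / (\<rho>\<^sub>1 * \<rho>\<^sub>1) * C1 * 2) * exp (- 1 * \<bar>x\<bar>)" for x
  proof -
    let ?w = "Complex x (-\<psi>)" and ?c = "cosh x"
    have c: "?c > 0" by simp
    have pc: "\<rho>\<^sub>1 * ?c > 0" using \<rho>\<^sub>1 c by simp
    have zc: "\<rho>\<^sub>1 * ?c \<le> cmod (zeta ?w)" using cmod_zeta_ge_cosh[of ?w] \<psi>_line by simp
    have "norm (R (zeta ?w) u - (1 / zeta ?w) *\<^sub>C u) \<le> C1 / (cmod (zeta ?w))\<^sup>2"
      unfolding C1_def by (rule R_minus_inverse_decay_on_D[OF zeta_\<psi>(1,3) u])
    also have "\<dots> \<le> C1 / (\<rho>\<^sub>1 * ?c)\<^sup>2"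
      using C1 pc zc less_le_trans[OF pc zc] \<rho>\<^sub>1(1) by (intro divide_left_mono power_mono mult_pos_pos zero_less_power) auto
    finally have "norm (G u ?w) \<le> (focus * ?c) * (C1 / (\<rho>\<^sub>1 * ?c)\<^sup>2)"
      unfolding G_def norm_scaleC using cmod_zeta'_le[of ?w] focus_pos by (intro mult_mono) auto
    also have "\<dots> = focus / (\<rho>\<^sub>1 * \<rho>\<^sub>1) * C1 * (1 / ?c)"
      using c \<rho>\<^sub>1 by (simp add: power2_eq_square divide_simps)
    also have "\<dots> \<le> focus / (\<rho>\<^sub>1 * \<rho>\<^sub>1) * C1 * (2 * exp (- \<bar>x\<bar>))"
    proof (rule mult_left_mono)
      have "1 / ?c \<le> 1 / (exp \<bar>x\<bar> / 2)" using exp_abs_le_cosh[of x] c by (intro divide_left_mono mult_pos_pos) auto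
      then show "1 / ?c \<le> 2 * exp (- \<bar>x\<bar>)" by (simp add: exp_minus field_simps)
      show "0 \<le> focus / (\<rho>\<^sub>1 * \<rho>\<^sub>1) * C1" using focus_pos C1 by simp
    qed
    finally show ?thesis by simp
  qed
  show "(\<lambda>x. G u (Complex x (-\<psi>))) integrable_on UNIV"
    by (rule exp_decay_integrable[OF cG zero_less_one bG, of 0]) simp
  define \<epsilon> where "\<epsilon> = 16 * C1 / focus + 4 * norm u"
  have near2: "norm (f2 (Complex (sg * L) y) - of_real sg *\<^sub>C u) \<le> \<epsilon> * exp (- L)"
    if L: "L \<ge> 1" and sg: "sg = 1 \<or> sg = -1" for L sg y
  proof -
    let ?w = "Complex (sg * L) y"
    have "zeta' ?w * (1 / zeta ?w) = sinh ?w / cosh ?w" using focus_pos by (simp add: zeta_def zeta'_def)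
    then have "norm (f2 ?w - of_real sg *\<^sub>C u) = cmod (sinh ?w / cosh ?w - of_real sg) * norm u"
      by (simp add: f2_def scaleC.diff_left[symmetric] norm_scaleC)
    also have "\<dots> \<le> 4 * exp (- L) * norm u"
      by (intro mult_right_mono tanh_near_sgn[OF L _ sg]) auto
    also have "\<dots> \<le> \<epsilon> * exp (- L)" using C1 focus_pos by (simp add: \<epsilon>_def algebra_simps)
    finally show ?thesis .
  qed
  have near1: "norm (f1 (Complex (sg * L) y) - of_real sg *\<^sub>C u) \<le> \<epsilon> * exp (- L)"
    if L: "L \<ge> 1" and sg: "sg = 1 \<or> sg = -1" and y: "- pi \<le> y" "y \<le> - \<psi>" for L sg y
  proof -
    let ?w = "Complex (sg * L) y"
    let ?z = "zeta ?w"
    have z: "?z \<in> \<Omega>" by (rule zeta_in_\<Omega>) (use y \<psi>_line in auto)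
    have sL: "\<bar>sinh (Re ?w)\<bar> = sinh L" "cosh (Re ?w) = cosh L" using sg L by auto
    have zL: "focus * (exp L / 4) \<le> cmod ?z"
    proof -
      have "focus * (exp L / 4) \<le> focus * sinh L" using sinh_cosh_bounds(1)[OF L] focus_pos by (intro mult_left_mono) auto
      then show ?thesis using cmod_zeta_ge[of ?w] sL by simp
    qed
    have pos: "focus * (exp L / 4) > 0" using focus_pos by simp
    then have z0: "?z \<noteq> 0" using zL by auto
    have "zeta' ?w * (1 / ?z) = sinh ?w / cosh ?w" using focus_pos by (simp add: zeta_def zeta'_def)
    then have eq: "f1 ?w - of_real sg *\<^sub>C u
        = zeta' ?w *\<^sub>C (R ?z u - (1 / ?z) *\<^sub>C u) + (sinh ?w / cosh ?w - of_real sg) *\<^sub>C u"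
      by (simp add: f1_def scaleC.diff_right scaleC.diff_left scaleC_scaleC)
    have "norm (zeta' ?w *\<^sub>C (R ?z u - (1 / ?z) *\<^sub>C u)) \<le> (focus * exp L) * (C1 / (focus * (exp L / 4))\<^sup>2)"
    proof -
      have "norm (R ?z u - (1 / ?z) *\<^sub>C u) \<le> C1 / (cmod ?z)\<^sup>2"
        unfolding C1_def by (rule R_minus_inverse_decay_on_D[OF z z0 u])
      also have "\<dots> \<le> C1 / (focus * (exp L / 4))\<^sup>2"
        using C1 pos zL z0 focus_pos by (intro divide_left_mono power_mono mult_pos_pos zero_less_power) auto
      finally have 1: "norm (R ?z u - (1 / ?z) *\<^sub>C u) \<le> C1 / (focus * (exp L / 4))\<^sup>2" .
      have "focus * cosh L \<le> focus * exp L" using sinh_cosh_bounds(2)[OF L] focus_pos by (intro mult_left_mono) auto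
      then have 2: "cmod (zeta' ?w) \<le> focus * exp L" 
        using cmod_zeta'_le[of ?w] unfolding sL(2) by (rule order_trans[rotated])
      show ?thesis unfolding norm_scaleC using focus_pos by (intro mult_mono 1 2) auto
    qed
    also have "\<dots> = 16 * C1 / focus * exp (- L)"
      using focus_pos by (simp add: power2_eq_square exp_minus field_simps)
    finally have a: "norm (zeta' ?w *\<^sub>C (R ?z u - (1 / ?z) *\<^sub>C u)) \<le> 16 * C1 / focus * exp (- L)" .
    have b: "norm ((sinh ?w / cosh ?w - of_real sg) *\<^sub>C u) \<le> 4 * exp (- L) * norm u"
      unfolding norm_scaleC by (intro mult_right_mono tanh_near_sgn[OF L _ sg]) auto
    have "norm (f1 ?w - of_real sg *\<^sub>C u) \<le> 16 * C1 / focus * exp (- L) + 4 * exp (- L) * norm u"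
      unfolding eq by (rule order_trans[OF norm_triangle_ineq add_mono[OF a b]])
    also have "\<dots> = \<epsilon> * exp (- L)" by (simp add: \<epsilon>_def algebra_simps)
    finally show ?thesis .
  qed
  have odd1: "f1 (Complex (-x) (-pi)) = - f1 (Complex x (-pi))" for x
  proof -
    have "zeta (Complex (-x) (-pi)) = zeta (Complex x (-pi))" "zeta' (Complex (-x) (-pi)) = - zeta' (Complex x (-pi))"
      by (simp_all add: zeta_def zeta'_def complex_eq_iff Re_cosh_complex Im_cosh_complex Re_sinh_complex Im_sinh_complex)
    then show ?thesis by (simp add: f1_def scaleC.minus_left)
  qed
  have odd2: "f2 (Complex (-x) 0) = - f2 (Complex x 0)" for x
  proof -
    have "zeta (Complex (-x) 0) = zeta (Complex x 0)" "zeta' (Complex (-x) 0) = - zeta' (Complex x 0)"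
      by (simp_all add: zeta_def zeta'_def complex_eq_iff Re_cosh_complex Im_cosh_complex Re_sinh_complex Im_sinh_complex)
    then show ?thesis by (simp add: f2_def scaleC.minus_left)
  qed
  define K where "K = 2 * (focus / (\<rho>\<^sub>1 * \<rho>\<^sub>1) * C1 * 2) + 2 * \<epsilon> * pi"
  have "integral UNIV (\<lambda>x. G u (Complex x (-\<psi>))) - (2 * of_real pi * \<i>) *\<^sub>C u = 0"
  proof (rule eq_zero_if_exp_bound)
    fix L :: real assume L: "L \<ge> 1"
    have tail: "norm (integral UNIV (\<lambda>x. G u (Complex x (-\<psi>))) - hline (G u) (-\<psi>) (-L) L)
        \<le> 2 * (focus / (\<rho>\<^sub>1 * \<rho>\<^sub>1) * C1 * 2) * exp (- 1 * L) / 1"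
      unfolding hline_def by (rule exp_decay_tail[OF cG zero_less_one bG]) (use L in auto)
    have "vholo (rectangle (-L) L (-pi) (-\<psi>)) f1" by (rule vholo_subset[OF h1]) auto
    from cauchy_rectangle[OF this] L angles(8) hline_odd[of f1 "-pi" L, OF odd1]
    have r1: "hline f1 (-\<psi>) (-L) L = vline f1 L (-pi) (-\<psi>) - vline f1 (-L) (-pi) (-\<psi>)" by (simp add: algebra_simps)
    have "vholo (rectangle (-L) L (-\<psi>) 0) f2" by (rule vholo_subset[OF h2]) auto
    from cauchy_rectangle[OF this] L angles(4) hline_odd[of f2 0 L, OF odd2]
    have r2: "hline f2 (-\<psi>) (-L) L = vline f2 (-L) (-\<psi>) 0 - vline f2 L (-\<psi>) 0" by (simp add: algebra_simps)
    have r: "hline (G u) (-\<psi>) (-L) L = hline f1 (-\<psi>) (-L) L - hline f2 (-\<psi>) (-L) L"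
      unfolding hline_def f12
      by (intro Henstock_Kurzweil_Integration.integral_diff integrable_continuous_interval
          continuous_on_hline[OF vholo_continuous_on[OF h1]] continuous_on_hline[OF vholo_continuous_on[OF h2]])
        (use \<psi>_line angles(4) in simp_all)
    have v1: "norm (vline f1 (sg * L) (-pi) (-\<psi>) - (\<i> * of_real (- \<psi> - - pi)) *\<^sub>C of_real sg *\<^sub>C u) \<le> \<epsilon> * exp (- L) * (- \<psi> - - pi)"
      if "sg = 1 \<or> sg = -1" for sg
      by (rule vline_approx[OF continuous_on_vline[OF vholo_continuous_on[OF h1]]])
        (use near1[OF L that] angles(8) in auto)
    have v2: "norm (vline f2 (sg * L) (-\<psi>) 0 - (\<i> * of_real (0 - - \<psi>)) *\<^sub>C of_real sg *\<^sub>C u) \<le> \<epsilon> * exp (- L) * (0 - - \<psi>)"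
      if "sg = 1 \<or> sg = -1" for sg
      by (rule vline_approx[OF continuous_on_vline[OF vholo_continuous_on[OF h2]]])
        (use near2[OF L that] angles(4) in auto)
    let ?a = "\<lambda>sg. vline f1 (sg * L) (-pi) (-\<psi>) - (\<i> * of_real (- \<psi> - - pi)) *\<^sub>C of_real sg *\<^sub>C u"
    let ?b = "\<lambda>sg. vline f2 (sg * L) (-\<psi>) 0 - (\<i> * of_real (0 - - \<psi>)) *\<^sub>C of_real sg *\<^sub>C u"
    have "hline (G u) (-\<psi>) (-L) L - (2 * of_real pi * \<i>) *\<^sub>C u = ?a 1 - ?a (-1) + ?b 1 - ?b (-1)"
    proof -
      have "(2 * of_real pi * \<i>) *\<^sub>C u = (\<i> * of_real (- \<psi> - - pi)) *\<^sub>C u + (\<i> * of_real (- \<psi> - - pi)) *\<^sub>C u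
          + (\<i> * of_real (0 - - \<psi>)) *\<^sub>C u + (\<i> * of_real (0 - - \<psi>)) *\<^sub>C u"
        by (simp add: scaleC.add_left[symmetric] algebra_simps)
      then show ?thesis unfolding r r1 r2
        by (simp add: scaleC_one scaleC.minus_left scaleC.minus_right)
    qed
    also have "norm (?a 1 - ?a (-1) + ?b 1 - ?b (-1)) \<le> norm (?a 1) + norm (?a (-1)) + norm (?b 1) + norm (?b (-1))"
      by (smt (verit) norm_triangle_ineq norm_triangle_ineq4)
    also have "\<dots> \<le> \<epsilon> * exp (- L) * (- \<psi> - - pi) + \<epsilon> * exp (- L) * (- \<psi> - - pi)
        + \<epsilon> * exp (- L) * (0 - - \<psi>) + \<epsilon> * exp (- L) * (0 - - \<psi>)"
      by (intro add_mono v1 v2) auto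
    finally have h: "norm (hline (G u) (-\<psi>) (-L) L - (2 * of_real pi * \<i>) *\<^sub>C u) \<le> 2 * \<epsilon> * pi * exp (- L)"
      by (simp add: algebra_simps)
    have "norm (integral UNIV (\<lambda>x. G u (Complex x (-\<psi>))) - (2 * of_real pi * \<i>) *\<^sub>C u)
      \<le> 2 * (focus / (\<rho>\<^sub>1 * \<rho>\<^sub>1) * C1 * 2) * exp (- 1 * L) / 1 + 2 * \<epsilon> * pi * exp (- L)"
      using norm_diff_triangle_le[OF tail h] .
    then show "norm (integral UNIV (\<lambda>x. G u (Complex x (-\<psi>))) - (2 * of_real pi * \<i>) *\<^sub>C u) \<le> K * exp (- 1 * L)"
      by (simp add: K_def algebra_simps)
  qed simp
  then show "integral UNIV (\<lambda>x. G u (Complex x (-\<psi>))) = (2 * of_real pi * \<i>) *\<^sub>C u" by simp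
qed

lemma B_contour_sol_on_D:
  assumes u: "u \<in> D"
  shows "B_op S m al tt (contour_sol 0 u) = u"
proof -
  note dec = resolvent_decay_on_D[OF u]
  let ?I = "\<lambda>t. integral UNIV (\<lambda>x. F u t (Complex x (-\<psi>)))"
  have hi: "((\<lambda>x. F u t (Complex x (-\<psi>))) has_integral ?I t) UNIV" if "t \<ge> 0" for t
    using F_integrable[OF dec that] by (rule integrable_integral)
  have "((\<lambda>x. F u 0 (Complex x (-\<psi>)) + (\<Sum>i=1..m. al i *\<^sub>R F u (tt i) (Complex x (-\<psi>)))) has_integral
      (?I 0 + (\<Sum>i=1..m. al i *\<^sub>R ?I (tt i)))) UNIV"
    by (intro has_integral_add has_integral_sum has_integral_cmul hi tt_nonneg) auto
  then have "?I 0 + (\<Sum>i=1..m. al i *\<^sub>R ?I (tt i)) = (2 * of_real pi * \<i>) *\<^sub>C u"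
    unfolding F_sum_eq_G using integral_G(2)[OF u] by (simp add: integral_unique)
  then have "(1 / (2 * of_real pi * \<i>)) *\<^sub>C (?I 0 + (\<Sum>i=1..m. al i *\<^sub>R ?I (tt i))) = u"
    by (simp add: scaleC_scaleC scaleC_one)
  moreover have "B_op S m al tt (contour_sol 0 u) = contour_sol 0 u + (\<Sum>i=1..m. al i *\<^sub>R contour_sol (tt i) u)"
    unfolding B_op_def using S_contour_sol_on_D[OF u tt_nonneg] by simp
  moreover have "\<dots> = (1 / (2 * of_real pi * \<i>)) *\<^sub>C (?I 0 + (\<Sum>i=1..m. al i *\<^sub>R ?I (tt i)))"
    by (simp add: contour_sol_def scaleC.add_right scaleC.sum_right scaleC.scaleR_right)
  ultimately show ?thesis by simp
qed

lemma B_bounded_clinear: "bounded_clinear (B_op S m al tt)"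
proof -
  have "bounded_linear (\<lambda>x. x + (\<Sum>i=1..m. al i *\<^sub>R S (tt i) x))"
    by (intro bounded_linear_add bounded_linear_ident bounded_linear_sum
        bounded_linear_compose[OF bounded_linear_scaleR_right] S_bounded_linear tt_nonneg)
  moreover have "B_op S m al tt (c *\<^sub>C x) = c *\<^sub>C B_op S m al tt x" for c x
    unfolding B_op_def by (simp add: S_scaleC tt_nonneg scaleC.add_right scaleC.sum_right scaleC.scaleR_right)
  ultimately show ?thesis by (simp add: bounded_clinear_def B_op_def[abs_def])
qed

lemma B_R_commute: "z \<in> \<Omega> \<Longrightarrow> B_op S m al tt (R z x) = R z (B_op S m al tt x)"
  unfolding B_op_def
  by (simp add: S_R_commute tt_nonneg linear_simps(1)[OF R_bounded_linear] linear_sum[OF bounded_linear.linear[OF R_bounded_linear]]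
      linear_simps(5)[OF R_bounded_linear])

text \<open>The contour integral at time \<open>0\<close> is a left inverse of \<open>B\<close> on the domain of \<open>A\<close>, because it commutes with
  \<open>B\<close>; a vector of the kernel is moved into that domain by \<open>A\<^sup>-\<^sup>1\<close>.\<close>
lemma inj_B: "inj (B_op S m al tt)"
proof -
  have bl: "bounded_linear (B_op S m al tt)" using B_bounded_clinear by (simp add: bounded_clinear_def)
  have "x = 0" if x: "B_op S m al tt x = 0" for x
  proof -
    let ?u = "R 0 x"
    have u: "?u \<in> D" by (rule R_in_D[OF zero_in_\<Omega>])
    have "?u = B_op S m al tt (contour_sol 0 ?u)" using B_contour_sol_on_D[OF u] by simp
    also have "\<dots> = contour_sol 0 (B_op S m al tt ?u)"
      by (rule contour_sol_commute[OF B_bounded_clinear B_R_commute resolvent_decay_on_D[OF u]]) auto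
    also have "B_op S m al tt ?u = R 0 (B_op S m al tt x)" by (rule B_R_commute[OF zero_in_\<Omega>])
    also have "\<dots> = 0" using x linear_simps(3)[OF R_bounded_linear[OF zero_in_\<Omega>]] by simp
    also have "contour_sol 0 0 = 0" by (simp add: contour_sol_def F_def linear_simps(3)[OF R_bounded_linear] zeta_\<psi> scaleC.zero_right)
    finally show ?thesis by (rule R_inj[OF zero_in_\<Omega>])
  qed
  then show ?thesis
    using linear_injective_0[OF bounded_linear.linear[OF bl]] by blast
qed

text \<open>Applying the injective operator \<open>R 0\<close> to both sides reduces the claims to vectors in the domain of \<open>A\<close>.\<close>
theorem u_hom_eq_contour_sol:
  assumes u: "resolvent_decay u C \<beta>" and t: "t \<ge> 0"
  shows "u_hom S m al tt u t = contour_sol t u"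
proof -
  let ?B = "B_op S m al tt" and ?r = "R 0 u"
  have r: "?r \<in> D" by (rule R_in_D[OF zero_in_\<Omega>])
  have R_sol: "R 0 (contour_sol s u) = contour_sol s ?r" if "s \<ge> 0" for s
    by (rule contour_sol_commute[OF R_bounded_clinear[OF zero_in_\<Omega>] R_commute[OF zero_in_\<Omega>] u that])
  have inj: "x = y" if "R 0 x = R 0 y" for x y
    using R_inj[OF zero_in_\<Omega>, of "x - y"] that linear_simps(2)[OF R_bounded_linear[OF zero_in_\<Omega>]] by simp
  have "R 0 (?B (contour_sol 0 u)) = ?B (contour_sol 0 ?r)" using B_R_commute[OF zero_in_\<Omega>, of "contour_sol 0 u"] R_sol[of 0] by simp
  also have "\<dots> = R 0 u" by (rule B_contour_sol_on_D[OF r])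
  finally have "?B (contour_sol 0 u) = u" by (rule inj)
  then have inv: "inv ?B u = contour_sol 0 u" by (rule inv_f_eq[OF inj_B])
  have "R 0 (S t (contour_sol 0 u)) = S t (contour_sol 0 ?r)" using S_R_commute[OF zero_in_\<Omega> t, of "contour_sol 0 u"] R_sol[of 0] by simp
  also have "\<dots> = R 0 (contour_sol t u)" using S_contour_sol_on_D[OF r t] R_sol[OF t] by simp
  finally have "S t (contour_sol 0 u) = contour_sol t u" by (rule inj)
  then show ?thesis by (simp add: u_hom_def inv)
qed

section \<open>Convergence of the quadrature\<close>

text \<open>The strip of half-width \<open>\<delta>/2\<close> around the integration line is exactly the one between the two boundary
  hyperbolas, so the discretization factor is \<open>q = exp (- 2 \<pi> (\<delta>/2) / h)\<close>.\<close>
theorem quadrature_error: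
  fixes N :: nat
  assumes u: "resolvent_decay u C \<beta>" and t: "t \<ge> 0" and h: "h > 0"
  defines "L \<equiv> (real N + 1/2) * h" and "q \<equiv> exp (- pi * \<delta> / h)"
  shows "norm (u_hom S m al tt u t - u_sinc D A \<rho>\<^sub>0 \<phi> \<rho>\<^sub>1 m al tt u h N t)
    \<le> decay_const \<beta> * C * (4 / \<beta> * (q / (1 - q)) + (2 / \<beta> + 3 * \<delta>) * exp (- t * \<rho>\<^sub>1 * cosh L) * exp (- \<beta> * L))"
proof -
  define f where "f w = F u t (w + of_real (-\<psi>) * \<i>)" for w
  define d where "d = \<delta> / 2"
  have d: "d > 0" using angles(1) by (simp add: d_def)
  have \<beta>: "\<beta> > 0" and C: "C \<ge> 0" using resolvent_decayD(1,2)[OF u] .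
  have strip: "- \<theta> \<le> Im (w + of_real (-\<psi>) * \<i>)" "Im (w + of_real (-\<psi>) * \<i>) \<le> - \<phi>" if "\<bar>Im w\<bar> \<le> d" for w
    using that by (auto simp: \<theta>_def \<psi>_def d_def abs_le_iff)
  have hol: "vholo {w. \<bar>Im w\<bar> \<le> d} f"
    unfolding f_def[abs_def]
  proof (rule vholo_compose[OF vholo_F])
    show "sholo {w. \<bar>Im w\<bar> \<le> d} (\<lambda>w. w + of_real (-\<psi>) * \<i>)"
      by (rule holomorphic_on_imp_sholo[of _ UNIV]) (auto intro!: holomorphic_intros)
  qed (use strip in auto)
  have b1: "norm (f w) \<le> decay_const \<beta> * C * exp (- \<beta> * \<bar>Re w\<bar>)" if "\<bar>Im w\<bar> \<le> d" for w
    using F_bound'[OF u strip[OF that] t] by (simp add: f_def)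
  have L0: "L \<ge> 0" using h by (simp add: L_def)
  have b2: "norm (f w) \<le> decay_const \<beta> * C * exp (- t * \<rho>\<^sub>1 * cosh L) * exp (- \<beta> * \<bar>Re w\<bar>)"
    if "\<bar>Im w\<bar> \<le> d" "\<bar>Re w\<bar> \<ge> L" for w
  proof -
    have "cosh L \<le> cosh (Re w)"
      using cosh_real_nonneg_le_iff[of L "\<bar>Re w\<bar>"] that(2) L0 by simp
    then have "t * \<rho>\<^sub>1 * cosh L \<le> t * \<rho>\<^sub>1 * cosh (Re w)" using t \<rho>\<^sub>1 by (intro mult_left_mono) auto
    then have "exp (- t * \<rho>\<^sub>1 * cosh (Re w)) \<le> exp (- t * \<rho>\<^sub>1 * cosh L)" by simp
    then have "decay_const \<beta> * C * exp (- t * \<rho>\<^sub>1 * cosh (Re w)) * exp (- \<beta> * \<bar>Re w\<bar>)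
       \<le> decay_const \<beta> * C * exp (- t * \<rho>\<^sub>1 * cosh L) * exp (- \<beta> * \<bar>Re w\<bar>)"
      using C decay_const_pos[of \<beta>] by (intro mult_right_mono mult_left_mono) auto
    moreover have "norm (f w) \<le> decay_const \<beta> * C * exp (- t * \<rho>\<^sub>1 * cosh (Re w)) * exp (- \<beta> * \<bar>Re w\<bar>)"
      using F_bound[OF u strip[OF that(1)] t] by (simp add: f_def)
    ultimately show ?thesis by linarith
  qed
  define Err where "Err = integral UNIV (\<lambda>x. f (of_real x)) - h *\<^sub>R (\<Sum>k\<in>{- int N..int N}. f (of_real (of_int k * h)))"
  define RHS where "RHS = decay_const \<beta> * C * (4 / \<beta> * (q / (1 - q)) + (2 / \<beta> + 3 * \<delta>) * exp (- t * \<rho>\<^sub>1 * cosh L) * exp (- \<beta> * L))"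
  have q: "exp (- 2 * pi * d / h) = q" by (simp add: q_def d_def)
  have "norm Err \<le> 4 * (decay_const \<beta> * C) / \<beta> * (q / (1 - q))
      + (2 / \<beta> + 6 * d) * (decay_const \<beta> * C * exp (- t * \<rho>\<^sub>1 * cosh L)) * exp (- \<beta> * L)"
    using sinc_quadrature_error[OF hol h d \<beta> b1 L_def[THEN meta_eq_to_obj_eq] b2] unfolding q Err_def by simp
  also have "\<dots> = RHS" by (simp add: RHS_def d_def algebra_simps)
  finally have E: "norm Err \<le> RHS" .
  have fx: "f (of_real x) = F u t (Complex x (-\<psi>))" for x
  proof -
    have "of_real x + of_real (-\<psi>) * \<i> = Complex x (-\<psi>)" by (simp add: complex_eq_iff)
    then show ?thesis by (simp only: f_def)
  qed
  have "u_hom S m al tt u t - u_sinc D A \<rho>\<^sub>0 \<phi> \<rho>\<^sub>1 m al tt u h N t = (1 / (2 * of_real pi * \<i>)) *\<^sub>C Err"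
    unfolding u_hom_eq_contour_sol[OF u t] contour_sol_def u_sinc_def Err_def integrand_eq fx
    by (simp add: scaleC.diff_right scaleR_scaleC scaleC_scaleC)
  then have "norm (u_hom S m al tt u t - u_sinc D A \<rho>\<^sub>0 \<phi> \<rho>\<^sub>1 m al tt u h N t) = 1 / (2 * pi) * norm Err"
    by (simp add: norm_scaleC norm_divide norm_mult)
  also have "\<dots> \<le> 1 * norm Err"
    using pi_gt3 by (intro mult_right_mono) (auto simp: divide_le_eq)
  finally show ?thesis using E by (simp add: RHS_def)
qed


lemma resolvent_decay_frac_domain:
  assumes \<alpha>: "0 < \<alpha>" "\<alpha> < 1"
  obtains C where "C > 0"
    "\<And>u. u \<in> frac_domain D A \<alpha> \<Longrightarrow> resolvent_decay u (C * norm (frac_power D A \<alpha> u)) \<alpha>"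
proof -
  obtain C where C: "C > 0" "\<And>z v. z \<in> \<Omega> \<Longrightarrow> z \<noteq> 0 \<Longrightarrow> Re z \<ge> 0 \<Longrightarrow>
       norm (R z (neg_frac_power D A \<alpha> v) - (1 / z) *\<^sub>C neg_frac_power D A \<alpha> v)
         \<le> C * norm v * (cmod z) powr (-1 - \<alpha>)"
    using R_minus_inverse_decay_frac[OF \<alpha>] by blast
  show ?thesis
  proof (rule that[OF C(1)])
    fix u assume "u \<in> frac_domain D A \<alpha>"
    then have u: "neg_frac_power D A \<alpha> (frac_power D A \<alpha> u) = u"
      unfolding frac_domain_def frac_power_def by (rule f_inv_into_f)
    have "norm (R z u - (1 / z) *\<^sub>C u) \<le> C * norm (frac_power D A \<alpha> u) * (cmod z) powr (-1 - \<alpha>)"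
      if "z \<in> \<Omega>" "\<rho>\<^sub>1 \<le> Re z" for z
    proof -
      have "z \<noteq> 0" "Re z \<ge> 0" using that(2) \<rho>\<^sub>1 by auto
      from C(2)[OF that(1) this, of "frac_power D A \<alpha> u"] show ?thesis by (simp only: u)
    qed
    moreover have "0 \<le> C * norm (frac_power D A \<alpha> u)" using C(1) by simp
    ultimately show "resolvent_decay u (C * norm (frac_power D A \<alpha> u)) \<alpha>"
      unfolding resolvent_decay_def using \<alpha>(1) by blast
  qed
qed

text \<open>With \<open>X\<close> the exponent in the claim, the step satisfies \<open>\<pi> \<delta> / h = X\<close> and \<open>\<alpha> (N + 1) h = 2 X\<close>. Truncation
  at \<open>N + 1/2\<close> instead of \<open>N + 1\<close> costs only the factor \<open>exp (\<alpha> h / 2)\<close>, and \<open>h\<close> is bounded.\<close>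
theorem uniform_quadrature_error:
  assumes \<alpha>: "0 < \<alpha>" "\<alpha> < 1"
  shows "\<exists>c'>0. \<forall>u\<^sub>0 \<in> frac_domain D A \<alpha>. \<forall>t\<ge>0. \<forall>N\<ge>1.
            norm (u_hom S m al tt u\<^sub>0 t
                  - u_sinc D A \<rho>\<^sub>0 \<phi> \<rho>\<^sub>1 m al tt u\<^sub>0
                      (sqrt (2 * pi * d1 \<rho>\<^sub>0 \<phi> \<rho>\<^sub>1 / (\<alpha> * (real N + 1)))) N t)
            \<le> c' / \<alpha> * exp (- sqrt (pi * d1 \<rho>\<^sub>0 \<phi> \<rho>\<^sub>1 * \<alpha> / 2 * (real N + 1)))
                * norm (frac_power D A \<alpha> u\<^sub>0)"
proof -
  obtain C where C: "C > 0"
    "\<And>u. u \<in> frac_domain D A \<alpha> \<Longrightarrow> resolvent_decay u (C * norm (frac_power D A \<alpha> u)) \<alpha>"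
    using resolvent_decay_frac_domain[OF \<alpha>] by blast
  define h where "h N = sqrt (2 * pi * \<delta> / (\<alpha> * (real N + 1)))" for N :: nat
  define X where "X N = sqrt (pi * \<delta> * \<alpha> / 2 * (real N + 1))" for N :: nat
  define H where "H = sqrt (2 * pi * \<delta> / \<alpha>)"
  define q0 where "q0 = exp (- pi * \<delta> / H)"
  define c where "c = decay_const \<alpha> * C * (4 / (1 - q0) + (2 + 3 * \<delta> * \<alpha>) * exp (\<alpha> * H / 2))"
  have H: "H > 0" using angles(1) \<alpha> by (simp add: H_def)
  have q0: "q0 < 1" using H angles(1) by (simp add: q0_def)
  have X0: "X N \<ge> 0" for N using angles(1) \<alpha> by (simp add: X_def)
  have cpos: "c > 0" unfolding c_def using decay_const_pos[of \<alpha>] C(1) q0 angles(1) \<alpha>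
    by (intro mult_pos_pos add_pos_pos) auto
  have main: "norm (u_hom S m al tt u t - u_sinc D A \<rho>\<^sub>0 \<phi> \<rho>\<^sub>1 m al tt u (h N) N t)
      \<le> c / \<alpha> * exp (- X N) * norm (frac_power D A \<alpha> u)"
    if u: "u \<in> frac_domain D A \<alpha>" and t: "t \<ge> 0" for u t N
  proof -
    have hp: "h N > 0" using angles(1) \<alpha> by (simp add: h_def)
    have hH: "h N \<le> H" unfolding h_def H_def
      using angles(1) \<alpha> by (intro real_sqrt_le_mono divide_left_mono) auto
    have prod: "\<alpha> * (real N + 1) * (h N)\<^sup>2 = 2 * pi * \<delta>"
      using angles(1) \<alpha> by (simp add: h_def)
    have Xh: "\<alpha> * (real N + 1) * h N = 2 * X N" 
    proof -
      have "(\<alpha> * (real N + 1) * h N)\<^sup>2 = \<alpha> * (real N + 1) * (\<alpha> * (real N + 1) * (h N)\<^sup>2)"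
        by (simp add: power2_eq_square)
      also have "\<dots> = (2 * X N)\<^sup>2" unfolding prod using angles(1) \<alpha> by (simp add: X_def power_mult_distrib)
      finally show ?thesis by (rule power2_eq_imp_eq) (use X0 hp \<alpha> in simp_all)
    qed
    have "2 * pi * \<delta> = \<alpha> * (real N + 1) * h N * h N"
      unfolding prod[symmetric] by (simp add: power2_eq_square)
    also have "\<dots> = 2 * X N * h N" by (simp only: Xh)
    finally have "pi * \<delta> = h N * X N" by simp
    then have Xq: "pi * \<delta> / h N = X N" using hp by simp
    define q where "q = exp (- pi * \<delta> / h N)"
    have qX: "q = exp (- X N)" by (simp add: q_def Xq[symmetric])
    have qq0: "q \<le> q0" unfolding q_def q0_def
      using hp hH angles(1) by (simp add: divide_left_mono)
    define L where "L = (real N + 1/2) * h N"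
    have "\<alpha> * L = 2 * X N - \<alpha> * h N / 2" unfolding L_def Xh[symmetric] by (simp add: algebra_simps)
    also have "\<dots> \<ge> X N - \<alpha> * H / 2" using X0[of N] mult_left_mono[OF hH less_imp_le[OF \<alpha>(1)]] by linarith
    finally have eL: "exp (- \<alpha> * L) \<le> exp (\<alpha> * H / 2) * exp (- X N)" by (simp add: exp_add[symmetric])
    have "norm (u_hom S m al tt u t - u_sinc D A \<rho>\<^sub>0 \<phi> \<rho>\<^sub>1 m al tt u (h N) N t)
      \<le> decay_const \<alpha> * (C * norm (frac_power D A \<alpha> u)) * (4 / \<alpha> * (q / (1 - q)) + (2 / \<alpha> + 3 * \<delta>) * exp (- t * \<rho>\<^sub>1 * cosh L) * exp (- \<alpha> * L))"
      unfolding q_def L_def by (rule quadrature_error[OF C(2)[OF u] t hp])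
    also have "\<dots> \<le> decay_const \<alpha> * (C * norm (frac_power D A \<alpha> u)) *
        (4 / \<alpha> * (exp (- X N) / (1 - q0)) + (2 / \<alpha> + 3 * \<delta>) * 1 * (exp (\<alpha> * H / 2) * exp (- X N)))"
    proof (rule mult_left_mono)
      have "q / (1 - q) \<le> exp (- X N) / (1 - q0)" unfolding qX[symmetric] using qq0 q0
        by (intro frac_le) (auto simp: q_def)
      moreover have "exp (- t * \<rho>\<^sub>1 * cosh L) \<le> 1" using t \<rho>\<^sub>1 mult_nonneg_nonneg[of "t * \<rho>\<^sub>1" "cosh L"] by simp
      ultimately show "4 / \<alpha> * (q / (1 - q)) + (2 / \<alpha> + 3 * \<delta>) * exp (- t * \<rho>\<^sub>1 * cosh L) * exp (- \<alpha> * L)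
        \<le> 4 / \<alpha> * (exp (- X N) / (1 - q0)) + (2 / \<alpha> + 3 * \<delta>) * 1 * (exp (\<alpha> * H / 2) * exp (- X N))"
        using \<alpha> angles(1) eL by (intro add_mono mult_mono mult_left_mono) auto
      show "0 \<le> decay_const \<alpha> * (C * norm (frac_power D A \<alpha> u))"
        using decay_const_pos[of \<alpha>] C(1) by simp
    qed
    also have "\<dots> = c / \<alpha> * exp (- X N) * norm (frac_power D A \<alpha> u)"
      using \<alpha> q0 unfolding c_def by (simp add: field_simps)
    finally show ?thesis .
  qed
  show ?thesis using cpos main unfolding h_def X_def \<delta>_def by blast
qed

text \<open>The choice \<open>c\<^sub>1 = 1\<close>. Then \<open>cosh ((N + 1/2) h) \<ge> N / 2\<close>, so the tail, of order \<open>exp (- t \<rho>\<^sub>1 N / 2)\<close>, is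
  eventually smaller than the discretization error \<open>exp (- \<pi> \<delta> N / ln N)\<close>.\<close>
theorem pointwise_quadrature_error:
  assumes \<alpha>: "0 < \<alpha>" "\<alpha> < 1" and u: "u\<^sub>0 \<in> frac_domain D A \<alpha>" and t: "t > 0"
  shows "(\<lambda>N. norm (u_hom S m al tt u\<^sub>0 t
            - u_sinc D A \<rho>\<^sub>0 \<phi> \<rho>\<^sub>1 m al tt u\<^sub>0 (1 * ln (real N) / real N) N t))
      \<in> O[sequentially](\<lambda>N. exp (- (pi * \<delta> * real N) / ln (real N)))"
proof -
  obtain C where dec: "resolvent_decay u\<^sub>0 C \<alpha>"
    using resolvent_decay_frac_domain[OF \<alpha>] u by blast
  have C: "C \<ge> 0" by (rule resolvent_decayD(2)[OF dec])
  define K where "K = decay_const \<alpha> * C * (8 / \<alpha> + (2 / \<alpha> + 3 * \<delta>))"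
  (* for large N the first condition makes the discretization factor q at most 1/2,
     the second one makes the tail at most q *)
  have ev1: "eventually (\<lambda>N. ln (real N) / real N \<le> pi * \<delta> / ln 2) sequentially"
  proof -
    have "((\<lambda>x::real. ln x / x) \<longlongrightarrow> 0) at_top" by (rule ln_x_over_x_tendsto_0)
    then have "(\<lambda>N. ln (real N) / real N) \<longlonglongrightarrow> 0" by (rule filterlim_compose[OF _ filterlim_real_sequentially])
    moreover have "pi * \<delta> / ln 2 > 0" using angles(1) by simp
    ultimately have "eventually (\<lambda>N. ln (real N) / real N < pi * \<delta> / ln 2) sequentially" by (rule order_tendstoD(2))
    then show ?thesis by (rule eventually_mono) simp
  qed
  have ev2: "eventually (\<lambda>N. ln (real N) \<ge> 2 * pi * \<delta> / (t * \<rho>\<^sub>1)) sequentially"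
    using filterlim_compose[OF ln_at_top filterlim_real_sequentially] by (simp add: filterlim_at_top)
  have "eventually (\<lambda>N. norm (norm (u_hom S m al tt u\<^sub>0 t
            - u_sinc D A \<rho>\<^sub>0 \<phi> \<rho>\<^sub>1 m al tt u\<^sub>0 (1 * ln (real N) / real N) N t))
      \<le> K * norm (exp (- (pi * \<delta> * real N) / ln (real N)))) sequentially"
    using ev1 ev2 eventually_ge_at_top[of 2]
  proof eventually_elim
    case (elim N)
    define h where "h = ln (real N) / real N"
    define q where "q = exp (- pi * \<delta> / h)"
    define L where "L = (real N + 1/2) * h"
    have N: "real N \<ge> 2" using elim(3) by simp
    have lnN: "ln (real N) > 0" using N by simp
    have h: "h > 0" using N lnN by (simp add: h_def)
    have q_eq: "q = exp (- (pi * \<delta> * real N) / ln (real N))" by (simp add: q_def h_def)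
    have "ln 2 \<le> pi * \<delta> / h"
      using elim(1) h angles(1) by (simp add: h_def[symmetric] field_simps)
    then have "q \<le> exp (- ln 2)" by (simp add: q_def)
    then have q: "0 < q" "q \<le> 1 / 2" by (simp_all add: q_def exp_minus)
    have qq: "q / (1 - q) \<le> 2 * q"
    proof -
      have "q / (1 - q) \<le> q / (1 / 2)" using q by (intro divide_left_mono) auto
      then show ?thesis by simp
    qed
    have L: "ln (real N) \<le> L" "L \<ge> 0" using N lnN by (auto simp: L_def h_def field_simps)
    have tail: "exp (- t * \<rho>\<^sub>1 * cosh L) \<le> q"
    proof -
      have "exp (ln (real N)) \<le> exp L" using L(1) by simp
      then have "real N / 2 \<le> exp L / 2" using N by simp
      also have "\<dots> \<le> cosh L" using exp_abs_le_cosh[of L] L(2) by simp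
      finally have c: "real N / 2 \<le> cosh L" .
      have "2 * pi * \<delta> \<le> ln (real N) * (t * \<rho>\<^sub>1)" using elim(2) t \<rho>\<^sub>1 by (simp add: divide_le_eq)
      then have "2 * pi * \<delta> * (real N / 2) \<le> ln (real N) * (t * \<rho>\<^sub>1) * (real N / 2)"
        by (rule mult_right_mono) simp
      also have "\<dots> \<le> ln (real N) * (t * \<rho>\<^sub>1) * cosh L"
        using c lnN t \<rho>\<^sub>1 by (intro mult_left_mono) auto
      finally have "pi * \<delta> * real N / ln (real N) \<le> t * \<rho>\<^sub>1 * cosh L"
        using lnN by (simp add: divide_le_eq mult_ac)
      then show ?thesis unfolding q_eq by simp
    qed
    have tl: "exp (- t * \<rho>\<^sub>1 * cosh L) * exp (- \<alpha> * L) \<le> q * 1"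
      using tail L(2) \<alpha>(1) q(1) by (intro mult_mono) auto
    have "norm (u_hom S m al tt u\<^sub>0 t - u_sinc D A \<rho>\<^sub>0 \<phi> \<rho>\<^sub>1 m al tt u\<^sub>0 h N t)
      \<le> decay_const \<alpha> * C * (4 / \<alpha> * (q / (1 - q)) + (2 / \<alpha> + 3 * \<delta>) * exp (- t * \<rho>\<^sub>1 * cosh L) * exp (- \<alpha> * L))"
      unfolding q_def L_def using quadrature_error[OF dec _ h] t by simp
    also have "\<dots> \<le> decay_const \<alpha> * C * (4 / \<alpha> * (2 * q) + (2 / \<alpha> + 3 * \<delta>) * (q * 1))"
      unfolding mult.assoc[of "2 / \<alpha> + 3 * \<delta>"]
      using qq tl decay_const_pos[of \<alpha>] C \<alpha>(1) angles(1)
      by (intro mult_left_mono add_mono mult_nonneg_nonneg) auto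
    also have "\<dots> = K * q" by (simp add: K_def algebra_simps)
    finally show ?case unfolding q_eq[symmetric] using q(1) by (simp add: h_def)
  qed
  then show ?thesis by (rule bigoI)
qed

end

theorem theorem2:
  fixes D :: "'a::complex_banach set" and A :: "'a \<Rightarrow> 'a" and S :: "real \<Rightarrow> 'a \<Rightarrow> 'a"
    and \<rho>\<^sub>0 \<phi> \<rho>\<^sub>1 \<alpha> T :: real and m :: nat and al tt :: "nat \<Rightarrow> real"
  assumes "strongly_positive D A \<rho>\<^sub>0 \<phi>"
    and "semigroup_generated_by S D (\<lambda>x. - A x)"
    and "m \<ge> 1" and "0 < tt 1" and "strict_mono_on {1..m} tt" and "tt m \<le> T"
    and "(\<Sum>i=1..m. \<bar>al i\<bar>) < 1 \<or> (\<Sum>i=1..m. \<bar>al i\<bar> * exp (- \<rho>\<^sub>0 * tt i)) < 1"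
    and "0 < \<rho>\<^sub>1" and "\<rho>\<^sub>1 < \<rho>\<^sub>0" and "(\<Sum>i=1..m. \<bar>al i\<bar> * exp (- \<rho>\<^sub>1 * tt i)) < 1"
    and "0 < \<alpha>" and "\<alpha> < 1"
  shows "(\<exists>c'>0. \<forall>u\<^sub>0 \<in> frac_domain D A \<alpha>. \<forall>t\<ge>0. \<forall>N\<ge>1.
            norm (u_hom S m al tt u\<^sub>0 t
                  - u_sinc D A \<rho>\<^sub>0 \<phi> \<rho>\<^sub>1 m al tt u\<^sub>0
                      (sqrt (2 * pi * d1 \<rho>\<^sub>0 \<phi> \<rho>\<^sub>1 / (\<alpha> * (real N + 1)))) N t)
            \<le> c' / \<alpha> * exp (- sqrt (pi * d1 \<rho>\<^sub>0 \<phi> \<rho>\<^sub>1 * \<alpha> / 2 * (real N + 1)))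
                * norm (frac_power D A \<alpha> u\<^sub>0))
       \<and> (\<forall>u\<^sub>0 \<in> frac_domain D A \<alpha>. \<forall>t>0. \<exists>c\<^sub>1>0.
            (\<lambda>N. norm (u_hom S m al tt u\<^sub>0 t
                  - u_sinc D A \<rho>\<^sub>0 \<phi> \<rho>\<^sub>1 m al tt u\<^sub>0 (c\<^sub>1 * ln (real N) / real N) N t))
            \<in> O[sequentially](\<lambda>N. max
                (exp (- (pi * d1 \<rho>\<^sub>0 \<phi> \<rho>\<^sub>1 * real N) / (c\<^sub>1 * ln (real N))))
                (exp (- (c\<^sub>1 * a_I \<rho>\<^sub>0 \<phi> \<rho>\<^sub>1 * t * real N / 2) - c\<^sub>1 * \<alpha> * ln (real N)))))"
proof -
  obtain M where M: "sectorial_operator D A \<rho>\<^sub>0 \<phi> M"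
    using strongly_positive_imp_sectorial[OF assms(1)] by blast
  have tt: "tt i \<ge> 0" if "i \<in> {1..m}" for i
  proof (cases "i = 1")
    case False
    then have "tt 1 < tt i" using that \<open>m \<ge> 1\<close> by (intro strict_mono_onD[OF assms(5)]) auto
    then show ?thesis using assms(4) by simp
  qed (use assms(4) in simp)
  interpret nonlocal_problem D A \<rho>\<^sub>0 \<phi> M S \<rho>\<^sub>1 m al tt
    using M assms(2,8-10) tt
    by (intro nonlocal_problem.intro sectorial_semigroup.intro sectorial_semigroup_axioms.intro
        nonlocal_problem_axioms.intro) auto
  show ?thesis
  proof (intro conjI ballI allI impI)
    fix u\<^sub>0 t assume u: "u\<^sub>0 \<in> frac_domain D A \<alpha>" and t: "(0::real) < t"
    have "(\<lambda>N. exp (- (pi * \<delta> * real N) / ln (real N))) \<in> O[sequentially](\<lambda>N. max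
                (exp (- (pi * d1 \<rho>\<^sub>0 \<phi> \<rho>\<^sub>1 * real N) / (1 * ln (real N))))
                (exp (- (1 * a_I \<rho>\<^sub>0 \<phi> \<rho>\<^sub>1 * t * real N / 2) - 1 * \<alpha> * ln (real N))))"
      by (intro landau_o.big_mono always_eventually) (auto simp: \<delta>_def)
    from landau_o.big_trans[OF pointwise_quadrature_error[OF assms(11,12) u t] this]
    show "\<exists>c\<^sub>1>0. (\<lambda>N. norm (u_hom S m al tt u\<^sub>0 t
                  - u_sinc D A \<rho>\<^sub>0 \<phi> \<rho>\<^sub>1 m al tt u\<^sub>0 (c\<^sub>1 * ln (real N) / real N) N t))
            \<in> O[sequentially](\<lambda>N. max
                (exp (- (pi * d1 \<rho>\<^sub>0 \<phi> \<rho>\<^sub>1 * real N) / (c\<^sub>1 * ln (real N))))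
                (exp (- (c\<^sub>1 * a_I \<rho>\<^sub>0 \<phi> \<rho>\<^sub>1 * t * real N / 2) - c\<^sub>1 * \<alpha> * ln (real N))))"
      using zero_less_one by blast
  qed (rule uniform_quadrature_error[OF assms(11,12)])
qed

end
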